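(* Let $s$ be any Pascal symbol, with associated rational map $p_s:\mathcal H^\circ\dashrightarrow(\mathbb P^2)^*$, and let $\beta:\mathbb X\to\mathcal H^\circ$ be the iterated blow-up defined in the context. Then there is a regular morphism $q_s:\mathbb X\to(\mathbb P^2)^*$ making the diagram formed by $\beta$, $p_s$ and $q_s$ commutative, in the following sense: if $\tilde h\in\mathbb X$ is a point such that $p_s$ is already defined at $h=\beta(\tilde h)$, then $q_s(\tilde h)=p_s(h)$.
   Context: Work over the complex numbers. Let $\mathcal K\subseteq\mathbb P^2$ be a nonsingular conic, let $L=\{\mathbb A,\mathbb B,\mathbb C,\mathbb D,\mathbb E,\mathbb F\}$ be a set of six letters, and let $\mathcal H=\mathcal K^{L}\simeq(\mathbb P^1)^6$ be the variety of all maps $h:L\to\mathcal K$. A partition of $L$ is written by separating its blocks by dots; its type is the list of block sizes, e.g. $\mathbb A\mathbb C\mathbb D.\mathbb B.\mathbb E\mathbb F$ has type $(3,2,1)$. For a partition $\pi$, the polydiagonal of type $\pi$ is $\Delta_\pi=\{h\in\mathcal H: h(x)=h(y)\text{ whenever }x,y\text{ are in the same block of }\pi\}$. A Pascal symbol is an array $s=\left\{\begin{array}{ccc} x_1&x_2&x_3\\ y_1&y_2&y_3\end{array}\right\}$ with $\{x_1,x_2,x_3,y_1,y_2,y_3\}=L$, considered up to permuting its rows and permuting its columns; there are $60$ symbols. For injective $h$, Pascal's theorem says that the three points $h(x_i)h(y_j)\cap h(x_j)h(y_i)$ ($1\le i<j\le 3$) are collinear, where $PQ$ denotes the line joining $P,Q$;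 the line containing them is the Pascal line. The assignment of the Pascal line to $h$ defines a rational map $p_s:\mathcal H\dashrightarrow(\mathbb P^2)^*$, where $(\mathbb P^2)^*$ is the space of lines in $\mathbb P^2$. Let $\mathcal H^\circ=\mathcal H\setminus\bigcup_\mu\Delta_\mu$, the union being over all partitions $\mu$ of type $(3,2,1)$ or $(4,1,1)$ (this removes also all polydiagonals of types $(5,1),(3,3),(4,2),(6)$). The restriction of $p_s$ to $\mathcal H^\circ$ is again denoted $p_s$. For $\pi$ of type $(2,2,1,1)$, $(3,1,1,1)$ or $(2,2,2)$, put $\Delta_\pi^\circ=\mathcal H^\circ\cap\Delta_\pi$. Let $Z\subseteq\mathcal H^\circ$ be the union of all $\Delta^\circ_\pi$ with $\pi$ of type $(2,2,2)$, and let $Y\subseteq\mathcal H^\circ$ be the union of all $\Delta^\circ_\pi$ with $\pi$ of type $(2,2,1,1)$ or $(3,1,1,1)$; thus $Z\subseteq Y$. Let $\beta_1:\mathbb X'\to\mathcal H^\circ$ be the blow-up of $\mathcal H^\circ$ along $Z$, let $Y'\subseteq\mathbb X'$ be the proper transform of $Y$, let $\beta_2:\mathbb X\to\mathbb X'$ be the blow-up of $\mathbb X'$ along $Y'$, and let $\beta=\beta_1\circ\beta_2:\mathbb X\to\mathcal H^\circ$. *)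

theory Defs
  imports "HOL-Analysis.Analysis" "HOL-Library.Multiset" "HOL-Library.Disjoint_Sets"
begin

section \<open>Complex projective space\<close>

definition same_line :: "complex^'n \<Rightarrow> complex^'n \<Rightarrow> bool" where
  "same_line v w \<longleftrightarrow> v \<noteq> 0 \<and> (\<exists>c. c \<noteq> 0 \<and> w = c *s v)"

lemma same_line_part_equivp: "part_equivp (same_line :: complex^'n \<Rightarrow> complex^'n \<Rightarrow> bool)"
proof (rule part_equivpI)
  show "\<exists>v :: complex^'n. same_line v v"
    by (rule exI[of _ "\<chi> i. 1"]) (auto simp: same_line_def vec_eq_iff intro!: exI[of _ 1])
  show "symp (same_line :: complex^'n \<Rightarrow> complex^'n \<Rightarrow> bool)"
  proof (rule sympI)
    fix v w :: "complex^'n"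
    assume "same_line v w"
    then obtain c where c: "v \<noteq> 0" "c \<noteq> 0" "w = c *s v"
      by (auto simp: same_line_def)
    then have "v = inverse c *s w" and "w \<noteq> 0"
      by (auto simp: vec_eq_iff)
    with c show "same_line w v"
      unfolding same_line_def by (metis nonzero_imp_inverse_nonzero)
  qed
  show "transp (same_line :: complex^'n \<Rightarrow> complex^'n \<Rightarrow> bool)"
  proof (rule transpI)
    fix u v w :: "complex^'n"
    assume "same_line u v" "same_line v w"
    then obtain c d where "u \<noteq> 0" "c \<noteq> 0" "d \<noteq> 0" "w = (d * c) *s u"
      by (auto simp: same_line_def vec_eq_iff mult.assoc)
    then show "same_line u w"
      unfolding same_line_def by (metis mult_eq_0_iff)
  qed
qed

text \<open>The points of the projective space with homogeneous coordinates indexed by \<open>'n\<close>, so that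
  \<open>3 proj\<close> is the projective plane. The value of \<open>abs_proj\<close> is meaningful on nonzero vectors only.\<close>

quotient_type 'n proj = "complex^'n" / partial: same_line
  by (rule same_line_part_equivp)

lift_definition coord_nonzero :: "'n::finite \<Rightarrow> 'n proj \<Rightarrow> bool" is "\<lambda>j v. v $ j \<noteq> 0"
  by (auto simp: same_line_def)

lift_definition coord_ratio :: "'n::finite \<Rightarrow> 'n \<Rightarrow> 'n proj \<Rightarrow> complex" is "\<lambda>i j v. v $ i / v $ j"
  by (auto simp: same_line_def)

section \<open>Subvarieties of products of projective spaces\<close>

text \<open>The ambient spaces are iterated products of projective spaces. Such a space is described by its
  standard affine charts: a pair \<open>(V, \<Phi>)\<close> in \<open>charts\<close> is an open set isomorphic to an affine space,
  with its set of affine coordinate functions. The values of these functions outside \<open>V\<close> play no role.\<close>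

class charted =
  fixes charts :: "('a set \<times> ('a \<Rightarrow> complex) set) set"

instantiation proj :: (finite) charted
begin
definition charts_proj :: "('a proj set \<times> ('a proj \<Rightarrow> complex) set) set" where
  "charts_proj = (\<lambda>j. ({P. coord_nonzero j P}, (\<lambda>i. coord_ratio i j) ` UNIV)) ` UNIV"
instance ..
end

instantiation prod :: (charted, charted) charted
begin
definition charts_prod :: "(('a \<times> 'b) set \<times> ('a \<times> 'b \<Rightarrow> complex) set) set" where
  "charts_prod = {(V \<times> W, (\<lambda>\<phi>. \<phi> \<circ> fst) ` \<Phi> \<union> (\<lambda>\<psi>. \<psi> \<circ> snd) ` \<Psi>) | V \<Phi> W \<Psi>.
     (V, \<Phi>) \<in> charts \<and> (W, \<Psi>) \<in> charts}"
instance ..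
end

text \<open>The power of a charted space with a finite index type.\<close>

instantiation "fun" :: (finite, charted) charted
begin
definition charts_fun :: "(('a \<Rightarrow> 'b) set \<times> (('a \<Rightarrow> 'b) \<Rightarrow> complex) set) set" where
  "charts_fun = {({h. \<forall>a. h a \<in> V a}, {\<lambda>h. \<phi> (h a) | a \<phi>. \<phi> \<in> \<Phi> a}) | V \<Phi>.
     \<forall>a. (V a, \<Phi> a) \<in> charts}"
instance ..
end

inductive_set polynomials :: "('a \<Rightarrow> complex) set \<Rightarrow> ('a \<Rightarrow> complex) set"
  for \<Phi> :: "('a \<Rightarrow> complex) set" where
  const: "(\<lambda>_. c) \<in> polynomials \<Phi>"
| coord: "\<phi> \<in> \<Phi> \<Longrightarrow> \<phi> \<in> polynomials \<Phi>"
| add: "p \<in> polynomials \<Phi> \<Longrightarrow> q \<in> polynomials \<Phi> \<Longrightarrow> (\<lambda>x. p x + q x) \<in> polynomials \<Phi>"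
| mult: "p \<in> polynomials \<Phi> \<Longrightarrow> q \<in> polynomials \<Phi> \<Longrightarrow> (\<lambda>x. p x * q x) \<in> polynomials \<Phi>"

definition zariski :: "'a::charted topology" where
  "zariski = topology_generated_by
     {{x \<in> V. q x \<noteq> 0} | V \<Phi> q. (V, \<Phi>) \<in> charts \<and> q \<in> polynomials \<Phi>}"

abbreviation zariski_on :: "'a::charted set \<Rightarrow> 'a topology" where
  "zariski_on S \<equiv> subtopology zariski S"

text \<open>Regular functions on a locally closed subset with its reduced structure: locally they are
  quotients of polynomials in affine coordinates.\<close>

definition regular_on :: "'a::charted set \<Rightarrow> ('a \<Rightarrow> complex) \<Rightarrow> bool" where
  "regular_on S f \<longleftrightarrow> (\<forall>x\<in>S. \<exists>V \<Phi> p q. (V, \<Phi>) \<in> charts \<and> x \<in> V \<and>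
     p \<in> polynomials \<Phi> \<and> q \<in> polynomials \<Phi> \<and> q x \<noteq> 0 \<and>
     (\<forall>y \<in> S \<inter> V. q y \<noteq> 0 \<longrightarrow> f y = p y / q y))"

definition regular_morphism ::
    "'a::charted set \<Rightarrow> 'b::charted set \<Rightarrow> ('a \<Rightarrow> 'b) \<Rightarrow> bool" where
  "regular_morphism S T f \<longleftrightarrow> continuous_map (zariski_on S) (zariski_on T) f \<and>
     (\<forall>W g. openin (zariski_on T) W \<and> regular_on W g \<longrightarrow> regular_on {x \<in> S. f x \<in> W} (g \<circ> f))"

text \<open>Let \<open>p\<close> be regular on a dense open subset \<open>D\<close> of \<open>X\<close>. The rational map given by \<open>p\<close> is defined
  at \<open>x\<close>, with value \<open>y\<close>.\<close>

definition rational_map_value ::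
    "'a::charted set \<Rightarrow> 'a set \<Rightarrow> ('a \<Rightarrow> 'b::charted) \<Rightarrow> 'a \<Rightarrow> 'b \<Rightarrow> bool" where
  "rational_map_value X D p x y \<longleftrightarrow> (\<exists>U \<phi>. openin (zariski_on X) U \<and> x \<in> U \<and>
     regular_morphism U UNIV \<phi> \<and> (\<forall>u \<in> U \<inter> D. \<phi> u = p u) \<and> \<phi> x = y)"

section \<open>Blow-ups\<close>

text \<open>The regular functions \<open>f i\<close> generate, on the open subset \<open>U\<close>, the ideal sheaf of all regular
  functions vanishing on \<open>Z\<close>.\<close>

definition generates_ideal_sheaf ::
    "'a::charted set \<Rightarrow> 'a set \<Rightarrow> ('r::finite \<Rightarrow> 'a \<Rightarrow> complex) \<Rightarrow> bool" where
  "generates_ideal_sheaf U Z f \<longleftrightarrow>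
     (\<forall>i. regular_on U (f i) \<and> (\<forall>x \<in> U \<inter> Z. f i x = 0)) \<and>
     (\<forall>W g. openin (zariski_on U) W \<and> regular_on W g \<and> (\<forall>x \<in> W \<inter> Z. g x = 0) \<longrightarrow>
        (\<forall>x\<in>W. \<exists>W' a. openin (zariski_on W) W' \<and> x \<in> W' \<and>
           (\<forall>i. regular_on W' (a i)) \<and> (\<forall>y\<in>W'. g y = (\<Sum>i\<in>UNIV. a i y * f i y))))"

text \<open>\<open>B\<close> is the blow-up of \<open>X\<close> along the closed reduced subvariety \<open>Z\<close>, embedded in the product of \<open>X\<close>
  with a projective space; the blow-down morphism is \<open>fst\<close>. Locally on \<open>X\<close>, the blow-up is the closure
  of the graph of the map to projective space given by generators of the ideal of \<open>Z\<close>. Up to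
  isomorphism over \<open>X\<close> it does not depend on the generators, nor on the embedding.\<close>

definition is_blow_up ::
    "'a::charted set \<Rightarrow> 'a set \<Rightarrow> ('a \<times> 'r::finite proj) set \<Rightarrow> bool" where
  "is_blow_up X Z B \<longleftrightarrow> closedin (zariski_on X) Z \<and> fst ` B \<subseteq> X \<and>
     (\<forall>x\<in>X. \<exists>U f. openin (zariski_on X) U \<and> x \<in> U \<and> generates_ideal_sheaf U Z f \<and>
        {b \<in> B. fst b \<in> U} =
          zariski_on (U \<times> UNIV) closure_of {(u, abs_proj (\<chi> i. f i u)) | u. u \<in> U - Z})"

definition proper_transform ::
    "'a::charted set \<Rightarrow> ('a \<times> 'r::finite proj) set \<Rightarrow> 'a set \<Rightarrow> ('a \<times> 'r proj) set" where
  "proper_transform Z B Y = zariski_on B closure_of {b \<in> B. fst b \<in> Y - Z}"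

section \<open>Plane geometry\<close>

text \<open>A line is given by the coefficients of its equation, as a point of the dual plane.\<close>

type_synonym point = "3 proj"
type_synonym line = "3 proj"

lift_definition incident :: "point \<Rightarrow> line \<Rightarrow> bool" is "\<lambda>v w. (\<Sum>i\<in>UNIV. w $ i * v $ i) = 0"
proof -
  fix v v' w w' :: "complex^3"
  assume "same_line v v'" "same_line w w'"
  then obtain c d where "c \<noteq> 0" "d \<noteq> 0" "v' = c *s v" "w' = d *s w"
    by (auto simp: same_line_def)
  moreover from this have "(\<Sum>i\<in>UNIV. w' $ i * v' $ i) = (d * c) * (\<Sum>i\<in>UNIV. w $ i * v $ i)"
    by (simp add: sum_distrib_left mult_ac)
  ultimately show "((\<Sum>i\<in>UNIV. w $ i * v $ i) = 0) = ((\<Sum>i\<in>UNIV. w' $ i * v' $ i) = 0)"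
    by simp
qed

definition join :: "point \<Rightarrow> point \<Rightarrow> line" where
  "join P Q = (THE l. incident P l \<and> incident Q l)"

definition meet :: "line \<Rightarrow> line \<Rightarrow> point" where
  "meet l m = (THE P. incident P l \<and> incident P m)"

lift_definition on_conic :: "complex^3^3 \<Rightarrow> point \<Rightarrow> bool"
  is "\<lambda>A v. (\<Sum>i\<in>UNIV. v $ i * (A *v v) $ i) = 0"
proof -
  fix A :: "complex^3^3" and v v' :: "complex^3"
  assume "same_line v v'"
  then obtain c where "c \<noteq> 0" "v' = c *s v"
    by (auto simp: same_line_def)
  moreover from this have
    "(\<Sum>i\<in>UNIV. v' $ i * (A *v v') $ i) = (c * c) * (\<Sum>i\<in>UNIV. v $ i * (A *v v) $ i)"
    by (simp add: sum_distrib_left mult_ac vector_scalar_commute)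
  ultimately show
    "((\<Sum>i\<in>UNIV. v $ i * (A *v v) $ i) = 0) = ((\<Sum>i\<in>UNIV. v' $ i * (A *v v') $ i) = 0)"
    by simp
qed

definition nonsingular_conic :: "point set \<Rightarrow> bool" where
  "nonsingular_conic K \<longleftrightarrow>
     (\<exists>A :: complex^3^3. transpose A = A \<and> det A \<noteq> 0 \<and> K = {P. on_conic A P})"

section \<open>Sextuples of points on a conic\<close>

datatype letter = LA | LB | LC | LD | LE | LF

instance letter :: finite
proof
  have "(UNIV :: letter set) = {LA, LB, LC, LD, LE, LF}"
    using letter.exhaust by auto
  then show "finite (UNIV :: letter set)"
    by (metis finite.emptyI finite.insertI)
qed

type_synonym sextuple = "letter \<Rightarrow> point"

definition sextuples :: "point set \<Rightarrow> sextuple set" where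
  "sextuples K = {h. range h \<subseteq> K}"

definition partitions_of_type :: "nat multiset \<Rightarrow> letter set set set" where
  "partitions_of_type \<tau> = {\<pi>. partition_on UNIV \<pi> \<and> image_mset card (mset_set \<pi>) = \<tau>}"

definition polydiagonal :: "point set \<Rightarrow> letter set set \<Rightarrow> sextuple set" where
  "polydiagonal K \<pi> = {h \<in> sextuples K. \<forall>S\<in>\<pi>. \<forall>x\<in>S. \<forall>y\<in>S. h x = h y}"

definition sextuples0 :: "point set \<Rightarrow> sextuple set" where
  "sextuples0 K = sextuples K -
     (\<Union>\<mu> \<in> partitions_of_type {#3, 2, 1#} \<union> partitions_of_type {#4, 1, 1#}. polydiagonal K \<mu>)"

definition polydiagonal0 :: "point set \<Rightarrow> letter set set \<Rightarrow> sextuple set" where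
  "polydiagonal0 K \<pi> = sextuples0 K \<inter> polydiagonal K \<pi>"

definition center_Z :: "point set \<Rightarrow> sextuple set" where
  "center_Z K = (\<Union>\<pi> \<in> partitions_of_type {#2, 2, 2#}. polydiagonal0 K \<pi>)"

definition center_Y :: "point set \<Rightarrow> sextuple set" where
  "center_Y K =
     (\<Union>\<pi> \<in> partitions_of_type {#2, 2, 1, 1#} \<union> partitions_of_type {#3, 1, 1, 1#}. polydiagonal0 K \<pi>)"

section \<open>Pascal lines\<close>

text \<open>An array is the pair of its rows; a symbol is the class of an array under permutations of the
  rows and of the columns.\<close>

type_synonym pascal_array = "(3 \<Rightarrow> letter) \<times> (3 \<Rightarrow> letter)"

definition array_class :: "(3 \<Rightarrow> letter) \<Rightarrow> (3 \<Rightarrow> letter) \<Rightarrow> pascal_array set" where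
  "array_class x y = {(x \<circ> \<sigma>, y \<circ> \<sigma>) | \<sigma>. bij \<sigma>} \<union> {(y \<circ> \<sigma>, x \<circ> \<sigma>) | \<sigma>. bij \<sigma>}"

definition pascal_symbols :: "pascal_array set set" where
  "pascal_symbols = {array_class x y | x y. range x \<union> range y = UNIV}"

definition pascal_line :: "pascal_array set \<Rightarrow> sextuple \<Rightarrow> line" where
  "pascal_line s h = (THE l. \<forall>(x, y) \<in> s. \<forall>i j. i < j \<longrightarrow>
     incident (meet (join (h (x i)) (h (y j))) (join (h (x j)) (h (y i)))) l)"

text \<open>The rational map from \<open>sextuples0 K\<close> to the dual plane given by Pascal lines is defined at \<open>h\<close>,
  with value \<open>l\<close>.\<close>

definition pascal_map_value :: "point set \<Rightarrow> pascal_array set \<Rightarrow> sextuple \<Rightarrow> line \<Rightarrow> bool" where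
  "pascal_map_value K s = rational_map_value (sextuples0 K) {h \<in> sextuples0 K. inj h} (pascal_line s)"

end

theory Submission
  imports Defs
begin

text \<open>In a parametrization of the conic by the affine line, the Pascal line is the axis of the projectivity
  \<open>x\<^sub>i \<mapsto> y\<^sub>i\<close>, given by three polynomials \<open>F\<close> in the six parameters. Near a point of their common zero
  set one of the following holds: all \<open>x\<^sub>i = y\<^sub>i\<close>; or \<open>x\<^sub>i = x\<^sub>j\<close> and \<open>y\<^sub>i = y\<^sub>j\<close> for two columns; or all
  the \<open>x\<^sub>i\<close> (or all the \<open>y\<^sub>i\<close>) coincide. In each case \<open>F\<close> is a combination \<open>\<Sum>\<^sub>k z\<^sub>k P\<^sub>k\<close> of the equations \<open>z\<^sub>k\<close> of the
  corresponding polydiagonal whose coefficient vectors \<open>P\<^sub>k\<close> are linearly independent at the point. Hence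
  as soon as the ideal of the \<open>z\<^sub>k\<close> becomes principal, generated by \<open>t\<close> say, \<open>F / t\<close> has no zero and extends
  the Pascal map. Blowing up makes the ideal of the centre principal; at a point of \<open>Z\<close> on a polydiagonal
  \<open>u = v = 0\<close> of type \<open>(2, 2, 1, 1)\<close>, where \<open>Z\<close> is \<open>u = v = w = 0\<close>, the first blow-up either makes \<open>(u, v)\<close>
  principal or yields \<open>(u, v) = w (u / w, v / w)\<close> with \<open>(u / w, v / w)\<close> the ideal of the proper transform of \<open>Y\<close>.
  The local extensions agree with the Pascal line on the dense set of injective sextuples, so they
  glue.\<close>

section \<open>Germs of regular functions and of morphisms\<close>

text \<open>The ideal of a centre consists of all regular functions vanishing on it, so the
  differences of parameters have to be shown to generate a radical ideal. The device is a
  retraction: merging letters, \<open>u \<mapsto> u \<circ> \<theta>\<close>, is the identity modulo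
  these differences, hence a function \<open>g\<close> is congruent to its pullback, which vanishes
  if \<open>g\<close> vanishes on the polydiagonal. The same device, with the retraction lifted to
  the first blow-up, computes the ideal of the proper transform. Cancelling a factor such as
  \<open>w\<close> is justified by the density of the injective sextuples on every level, which
  takes the place of irreducibility. A blow-up is known only through unspecified local generators,
  so everything is phrased with ideals of germs, which do not depend on them. An affine
  parametrization misses one point of the conic; it is therefore chosen anew for each sextuple, and
  the uniqueness of extensions makes the choice harmless.\<close>

lemma polynomials_compose:
  assumes "p \<in> polynomials \<Phi>" "\<And>\<phi>. \<phi> \<in> \<Phi> \<Longrightarrow> (\<lambda>x. \<phi> (f x)) \<in> polynomials \<Psi>"
  shows "(\<lambda>x. p (f x)) \<in> polynomials \<Psi>"
  using assms(1) by induction (auto intro: polynomials.intros assms(2))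

lemma polynomials_prod:
  assumes "finite A" "\<And>a. a \<in> A \<Longrightarrow> p a \<in> polynomials \<Phi>"
  shows "(\<lambda>x. \<Prod>a\<in>A. p a x) \<in> polynomials \<Phi>"
  using assms by (induction A rule: finite_induct) (auto intro: polynomials.intros)

text \<open>\<open>charted\<close> prescribes no relation between charts. The axioms added here say
  that near each point of an overlap the coordinates of one chart are quotients of polynomials in
  the other, and that the overlap contains a principal open neighbourhood of the point. This permits
  all later computations to be made in a single chart.\<close>

class charted_space = charted +
  assumes chart_cover: "\<exists>V \<Phi>. (V, \<Phi>) \<in> charts \<and> x \<in> V"
    and chart_change: "(V, \<Phi>) \<in> charts \<Longrightarrow> (V', \<Phi>') \<in> charts \<Longrightarrow> x \<in> V \<Longrightarrow> x \<in> V' \<Longrightarrow>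
      \<exists>r \<in> polynomials \<Phi>. r x \<noteq> 0 \<and> (\<forall>y\<in>V. r y \<noteq> 0 \<longrightarrow> y \<in> V')"
    and chart_coord: "(V, \<Phi>) \<in> charts \<Longrightarrow> (V', \<Phi>') \<in> charts \<Longrightarrow> x \<in> V \<Longrightarrow> x \<in> V' \<Longrightarrow> \<phi> \<in> \<Phi>' \<Longrightarrow>
      \<exists>p \<in> polynomials \<Phi>. \<exists>r \<in> polynomials \<Phi>. r x \<noteq> 0 \<and> (\<forall>y\<in>V. r y \<noteq> 0 \<longrightarrow> \<phi> y = p y / r y)"

section \<open>Projective spaces, products and powers have compatible charts\<close>

lemma proj_cases:
  obtains v where "v \<noteq> 0" "P = abs_proj v"
proof
  show "rep_proj P \<noteq> 0" "P = abs_proj (rep_proj P)"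
    using Quotient_rep_reflp[OF Quotient_proj, of P] Quotient_abs_rep[OF Quotient_proj, of P]
    by (auto simp: same_line_def)
qed

lemma same_line_refl: "v \<noteq> 0 \<Longrightarrow> same_line v v"
  by (auto simp: same_line_def intro!: exI[of _ 1])

lemma coord_nonzero_abs_proj: "v \<noteq> 0 \<Longrightarrow> coord_nonzero j (abs_proj v) \<longleftrightarrow> v $ j \<noteq> 0"
  by (simp add: coord_nonzero.abs_eq same_line_refl)

lemma coord_ratio_abs_proj: "v \<noteq> 0 \<Longrightarrow> coord_ratio i j (abs_proj v) = v $ i / v $ j"
  by (simp add: coord_ratio.abs_eq same_line_refl)

lemma abs_proj_eq_iff:
  assumes "v \<noteq> 0" "w \<noteq> 0"
  shows "abs_proj v = abs_proj w \<longleftrightarrow> (\<exists>c. c \<noteq> 0 \<and> w = c *s v)"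
  using assms Quotient_rel[OF Quotient_proj, of v w]
  by (auto simp: same_line_refl) (auto simp: same_line_def)

lemma coord_nonzero_exists: "\<exists>j. coord_nonzero j P"
  by (rule proj_cases[of P]) (auto simp: coord_nonzero_abs_proj vec_eq_iff)

instance proj :: (finite) charted_space
proof
  fix P :: "'a proj" and V V' \<Phi> \<Phi>' \<phi>
  show "\<exists>V \<Phi>. (V, \<Phi>) \<in> charts \<and> P \<in> V"
    using coord_nonzero_exists[of P] by (auto simp: charts_proj_def)
  assume V: "(V, \<Phi>) \<in> charts" "P \<in> V" and V': "(V', \<Phi>') \<in> charts" "P \<in> V'"
  from V(1) obtain j where j: "V = {P. coord_nonzero j P}" "\<Phi> = range (\<lambda>i. coord_ratio i j)"
    by (auto simp: charts_proj_def)
  from V'(1) obtain k where k: "V' = {P. coord_nonzero k P}" "\<Phi>' = range (\<lambda>i. coord_ratio i k)"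
    by (auto simp: charts_proj_def)
  have r: "coord_ratio k j \<in> polynomials \<Phi>"
    using j by (auto intro: polynomials.coord)
  have rP: "coord_ratio k j P \<noteq> 0"
    using V(2) V'(2) unfolding j k
    by (rule_tac proj_cases[of P]) (auto simp: coord_nonzero_abs_proj coord_ratio_abs_proj)
  show "\<exists>r\<in>polynomials \<Phi>. r P \<noteq> 0 \<and> (\<forall>y\<in>V. r y \<noteq> 0 \<longrightarrow> y \<in> V')"
  proof (rule bexI[OF _ r], intro conjI ballI impI)
    fix Q assume "Q \<in> V" "coord_ratio k j Q \<noteq> 0"
    then show "Q \<in> V'" unfolding j k
      by (rule_tac proj_cases[of Q]) (auto simp: coord_nonzero_abs_proj coord_ratio_abs_proj)
  qed (rule rP)
  assume "\<phi> \<in> \<Phi>'"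
  then obtain i where i: "\<phi> = coord_ratio i k" unfolding k by auto
  have p: "coord_ratio i j \<in> polynomials \<Phi>"
    using j by (auto intro: polynomials.coord)
  show "\<exists>p\<in>polynomials \<Phi>. \<exists>r\<in>polynomials \<Phi>. r P \<noteq> 0 \<and> (\<forall>y\<in>V. r y \<noteq> 0 \<longrightarrow> \<phi> y = p y / r y)"
  proof (rule bexI[OF _ p], rule bexI[OF _ r], intro conjI ballI impI)
    fix Q assume "Q \<in> V" "coord_ratio k j Q \<noteq> 0"
    then show "\<phi> Q = coord_ratio i j Q / coord_ratio k j Q" unfolding j i
      by (rule_tac proj_cases[of Q]) (auto simp: coord_nonzero_abs_proj coord_ratio_abs_proj)
  qed (rule rP)
qed

instance prod :: (charted_space, charted_space) charted_space
proof
  fix x :: "'a \<times> 'b" and V V' \<Phi> \<Phi>' \<phi>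
  obtain V1 and \<Phi>1 :: "('a \<Rightarrow> complex) set" where 1: "(V1, \<Phi>1) \<in> charts" "fst x \<in> V1"
    using chart_cover by blast
  obtain V2 and \<Phi>2 :: "('b \<Rightarrow> complex) set" where 2: "(V2, \<Phi>2) \<in> charts" "snd x \<in> V2"
    using chart_cover by blast
  have "(V1 \<times> V2, (\<lambda>\<phi>. \<phi> \<circ> fst) ` \<Phi>1 \<union> (\<lambda>\<psi>. \<psi> \<circ> snd) ` \<Phi>2) \<in> charts"
    unfolding charts_prod_def using 1 2 by blast
  moreover have "x \<in> V1 \<times> V2" using 1 2 by (simp add: mem_Times_iff)
  ultimately show "\<exists>V \<Phi>. (V, \<Phi>) \<in> charts \<and> x \<in> V" by blast
  assume V: "(V, \<Phi>) \<in> charts" "x \<in> V" and V': "(V', \<Phi>') \<in> charts" "x \<in> V'"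
  from V(1) obtain V1 \<Phi>1 V2 \<Phi>2 where
    c: "V = V1 \<times> V2" "\<Phi> = (\<lambda>\<phi>. \<phi> \<circ> fst) ` \<Phi>1 \<union> (\<lambda>\<psi>. \<psi> \<circ> snd) ` \<Phi>2" "(V1, \<Phi>1) \<in> charts" "(V2, \<Phi>2) \<in> charts"
    by (auto simp: charts_prod_def)
  from V'(1) obtain V1' \<Phi>1' V2' \<Phi>2' where
    d: "V' = V1' \<times> V2'" "\<Phi>' = (\<lambda>\<phi>. \<phi> \<circ> fst) ` \<Phi>1' \<union> (\<lambda>\<psi>. \<psi> \<circ> snd) ` \<Phi>2'" "(V1', \<Phi>1') \<in> charts" "(V2', \<Phi>2') \<in> charts"
    by (auto simp: charts_prod_def)
  have x: "fst x \<in> V1" "snd x \<in> V2" "fst x \<in> V1'" "snd x \<in> V2'"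
    using V V' c d by auto
  have p1: "(\<lambda>x. p (fst x)) \<in> polynomials \<Phi>" if "p \<in> polynomials \<Phi>1" for p
    by (rule polynomials_compose[OF that], rule polynomials.coord) (auto simp: c o_def)
  have p2: "(\<lambda>x. p (snd x)) \<in> polynomials \<Phi>" if "p \<in> polynomials \<Phi>2" for p
    by (rule polynomials_compose[OF that], rule polynomials.coord) (auto simp: c o_def)
  obtain r1 where r1: "r1 \<in> polynomials \<Phi>1" "r1 (fst x) \<noteq> 0" "\<And>y. y \<in> V1 \<Longrightarrow> r1 y \<noteq> 0 \<Longrightarrow> y \<in> V1'"
    using chart_change[OF c(3) d(3) x(1,3)] by blast
  obtain r2 where r2: "r2 \<in> polynomials \<Phi>2" "r2 (snd x) \<noteq> 0" "\<And>y. y \<in> V2 \<Longrightarrow> r2 y \<noteq> 0 \<Longrightarrow> y \<in> V2'"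
    using chart_change[OF c(4) d(4) x(2,4)] by blast
  show "\<exists>r\<in>polynomials \<Phi>. r x \<noteq> 0 \<and> (\<forall>y\<in>V. r y \<noteq> 0 \<longrightarrow> y \<in> V')"
    by (rule bexI[OF _ polynomials.mult[OF p1[OF r1(1)] p2[OF r2(1)]]])
       (auto simp: c d r1(2) r2(2) intro: r1(3) r2(3))
  assume "\<phi> \<in> \<Phi>'"
  then consider \<psi> where "\<psi> \<in> \<Phi>1'" "\<phi> = \<psi> \<circ> fst" | \<psi> where "\<psi> \<in> \<Phi>2'" "\<phi> = \<psi> \<circ> snd"
    unfolding d by auto
  then show "\<exists>p\<in>polynomials \<Phi>. \<exists>r\<in>polynomials \<Phi>. r x \<noteq> 0 \<and> (\<forall>y\<in>V. r y \<noteq> 0 \<longrightarrow> \<phi> y = p y / r y)"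
  proof cases
    case 1
    obtain p r where "p \<in> polynomials \<Phi>1" "r \<in> polynomials \<Phi>1" "r (fst x) \<noteq> 0"
      "\<And>y. y \<in> V1 \<Longrightarrow> r y \<noteq> 0 \<Longrightarrow> \<psi> y = p y / r y"
      using chart_coord[OF c(3) d(3) x(1,3) 1(1)] by blast
    then show ?thesis
      by (intro bexI[OF _ p1[of p]] bexI[OF _ p1[of r]]) (auto simp: 1 c)
  next
    case 2
    obtain p r where "p \<in> polynomials \<Phi>2" "r \<in> polynomials \<Phi>2" "r (snd x) \<noteq> 0"
      "\<And>y. y \<in> V2 \<Longrightarrow> r y \<noteq> 0 \<Longrightarrow> \<psi> y = p y / r y"
      using chart_coord[OF c(4) d(4) x(2,4) 2(1)] by blast
    then show ?thesis
      by (intro bexI[OF _ p2[of p]] bexI[OF _ p2[of r]]) (auto simp: 2 c)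
  qed
qed

instance "fun" :: (finite, charted_space) charted_space
proof
  fix x :: "'a \<Rightarrow> 'b" and V V' \<Phi> \<Phi>' \<phi>
  have "\<forall>a. \<exists>V \<Phi>. (V, \<Phi>) \<in> charts \<and> x a \<in> V" using chart_cover by blast
  then obtain V0 \<Phi>0 where "\<And>a. (V0 a, \<Phi>0 a) \<in> charts" "\<And>a. x a \<in> V0 a" by metis
  then show "\<exists>V \<Phi>. (V, \<Phi>) \<in> charts \<and> x \<in> V"
    unfolding charts_fun_def by blast
  assume V: "(V, \<Phi>) \<in> charts" "x \<in> V" and V': "(V', \<Phi>') \<in> charts" "x \<in> V'"
  from V(1) obtain V0 \<Phi>0 where
    c: "V = {h. \<forall>a. h a \<in> V0 a}" "\<Phi> = {\<lambda>h. \<phi> (h a) | a \<phi>. \<phi> \<in> \<Phi>0 a}" "\<And>a. (V0 a, \<Phi>0 a) \<in> charts"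
    by (auto simp: charts_fun_def)
  from V'(1) obtain V1 \<Phi>1 where
    d: "V' = {h. \<forall>a. h a \<in> V1 a}" "\<Phi>' = {\<lambda>h. \<phi> (h a) | a \<phi>. \<phi> \<in> \<Phi>1 a}" "\<And>a. (V1 a, \<Phi>1 a) \<in> charts"
    by (auto simp: charts_fun_def)
  have x: "x a \<in> V0 a" "x a \<in> V1 a" for a
    using V V' c d by auto
  have p1: "(\<lambda>x. p (x a)) \<in> polynomials \<Phi>" if "p \<in> polynomials (\<Phi>0 a)" for p a
    by (rule polynomials_compose[OF that], rule polynomials.coord) (auto simp: c)
  obtain r1 where r1: "\<And>a. r1 a \<in> polynomials (\<Phi>0 a)" "\<And>a. r1 a (x a) \<noteq> 0"
    "\<And>a y. y \<in> V0 a \<Longrightarrow> r1 a y \<noteq> 0 \<Longrightarrow> y \<in> V1 a"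
    using chart_change[OF c(3) d(3) x] by metis
  have "(\<lambda>x. \<Prod>a\<in>UNIV. r1 a (x a)) \<in> polynomials \<Phi>"
    by (intro polynomials_prod p1 r1(1)) simp
  then show "\<exists>r\<in>polynomials \<Phi>. r x \<noteq> 0 \<and> (\<forall>y\<in>V. r y \<noteq> 0 \<longrightarrow> y \<in> V')"
    by (rule bexI[rotated]) (auto simp: c d r1(2) intro: r1(3))
  assume "\<phi> \<in> \<Phi>'"
  then obtain a \<psi> where 1: "\<psi> \<in> \<Phi>1 a" "\<phi> = (\<lambda>h. \<psi> (h a))" unfolding d by auto
  obtain p r where "p \<in> polynomials (\<Phi>0 a)" "r \<in> polynomials (\<Phi>0 a)" "r (x a) \<noteq> 0"
    "\<And>y. y \<in> V0 a \<Longrightarrow> r y \<noteq> 0 \<Longrightarrow> \<psi> y = p y / r y"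
    using chart_coord[OF c(3) d(3) x 1(1)] by blast
  then show "\<exists>p\<in>polynomials \<Phi>. \<exists>r\<in>polynomials \<Phi>. r x \<noteq> 0 \<and> (\<forall>y\<in>V. r y \<noteq> 0 \<longrightarrow> \<phi> y = p y / r y)"
    by (intro bexI[OF _ p1[of p a]] bexI[OF _ p1[of r a]]) (auto simp: 1 c)
qed

lemma chart_polynomial:
  fixes x :: "'a::charted_space"
  assumes "(V, \<Phi>) \<in> charts" "(V', \<Phi>') \<in> charts" "x \<in> V" "x \<in> V'" "q \<in> polynomials \<Phi>'"
  shows "\<exists>p \<in> polynomials \<Phi>. \<exists>r \<in> polynomials \<Phi>. r x \<noteq> 0 \<and> (\<forall>y\<in>V. r y \<noteq> 0 \<longrightarrow> q y = p y / r y)"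
  using assms(5)
proof induction
  case (const c)
  show ?case
    by (intro bexI[OF _ polynomials.const[of c]] bexI[OF _ polynomials.const[of 1]]) auto
next
  case (coord \<phi>)
  then show ?case using chart_coord[OF assms(1-4)] by blast
next
  case (add q1 q2)
  then obtain p1 r1 p2 r2 where *: "p1 \<in> polynomials \<Phi>" "r1 \<in> polynomials \<Phi>" "p2 \<in> polynomials \<Phi>" "r2 \<in> polynomials \<Phi>"
    "r1 x \<noteq> 0" "r2 x \<noteq> 0" "\<forall>y\<in>V. r1 y \<noteq> 0 \<longrightarrow> q1 y = p1 y / r1 y" "\<forall>y\<in>V. r2 y \<noteq> 0 \<longrightarrow> q2 y = p2 y / r2 y"
    by blast
  show ?case
    by (intro bexI[of _ "\<lambda>y. p1 y * r2 y + p2 y * r1 y"] bexI[of _ "\<lambda>y. r1 y * r2 y"])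
      (use * in \<open>auto intro: polynomials.intros simp: field_simps\<close>)
next
  case (mult q1 q2)
  then obtain p1 r1 p2 r2 where *: "p1 \<in> polynomials \<Phi>" "r1 \<in> polynomials \<Phi>" "p2 \<in> polynomials \<Phi>" "r2 \<in> polynomials \<Phi>"
    "r1 x \<noteq> 0" "r2 x \<noteq> 0" "\<forall>y\<in>V. r1 y \<noteq> 0 \<longrightarrow> q1 y = p1 y / r1 y" "\<forall>y\<in>V. r2 y \<noteq> 0 \<longrightarrow> q2 y = p2 y / r2 y"
    by blast
  show ?case
    by (intro bexI[of _ "\<lambda>y. p1 y * p2 y"] bexI[of _ "\<lambda>y. r1 y * r2 y"])
      (use * in \<open>auto intro: polynomials.intros\<close>)
qed

section \<open>The Zariski topology and its neighbourhood filters\<close>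

lemma openin_zariski_basic:
  "(V, \<Phi>) \<in> charts \<Longrightarrow> q \<in> polynomials \<Phi> \<Longrightarrow> openin zariski {y \<in> V. q y \<noteq> 0}"
  unfolding zariski_def by (rule topology_generated_by_Basis) blast

lemma openin_zariski_chart:
  assumes "(V, \<Phi>) \<in> charts"
  shows "openin zariski V"
  using openin_zariski_basic[OF assms polynomials.const[of 1]] by simp

lemma topspace_zariski [simp]: "topspace (zariski :: 'a::charted_space topology) = UNIV"
proof -
  have "x \<in> topspace zariski" for x :: 'a
    using chart_cover[of x] openin_subset[OF openin_zariski_chart] by blast
  then show ?thesis by auto
qed

text \<open>The topology is generated by the principal open sets of all charts together. Chart
  changes turn each of them, near a point, into a principal open set of one fixed chart, so these
  already form a base there.\<close>

lemma zariski_neighbourhood: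
  fixes x :: "'a::charted_space"
  assumes "openin zariski W" "x \<in> W" "(V, \<Phi>) \<in> charts" "x \<in> V"
  shows "\<exists>q \<in> polynomials \<Phi>. q x \<noteq> 0 \<and> (\<forall>y\<in>V. q y \<noteq> 0 \<longrightarrow> y \<in> W)"
proof -
  have "generate_topology_on {{x \<in> V. q x \<noteq> 0} | V \<Phi> q. (V, \<Phi>) \<in> charts \<and> q \<in> polynomials \<Phi>} W"
    using assms(1) unfolding zariski_def by (rule openin_topology_generated_by)
  then show ?thesis using assms(2)
  proof induction
    case Empty
    then show ?case by simp
  next
    case (Int a b)
    then obtain p q where "p \<in> polynomials \<Phi>" "q \<in> polynomials \<Phi>" "p x \<noteq> 0" "q x \<noteq> 0"
      "\<forall>y\<in>V. p y \<noteq> 0 \<longrightarrow> y \<in> a" "\<forall>y\<in>V. q y \<noteq> 0 \<longrightarrow> y \<in> b" by blast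
    then show ?case
      by (intro bexI[of _ "\<lambda>y. p y * q y"]) (auto intro: polynomials.intros)
  next
    case (UN K)
    then obtain k where k: "k \<in> K" "x \<in> k" by blast
    from UN(2)[OF this] k(1) show ?case by blast
  next
    case (Basis s)
    then obtain V' \<Phi>' q where s: "s = {x \<in> V'. q x \<noteq> 0}" "(V', \<Phi>') \<in> charts" "q \<in> polynomials \<Phi>'"
      by blast
    obtain r where r: "r \<in> polynomials \<Phi>" "r x \<noteq> 0" "\<forall>y\<in>V. r y \<noteq> 0 \<longrightarrow> y \<in> V'"
      using chart_change[OF assms(3) s(2) assms(4)] Basis s by blast
    obtain p r' where p: "p \<in> polynomials \<Phi>" "r' \<in> polynomials \<Phi>" "r' x \<noteq> 0"
      "\<forall>y\<in>V. r' y \<noteq> 0 \<longrightarrow> q y = p y / r' y"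
      using chart_polynomial[OF assms(3) s(2) assms(4) _ s(3)] Basis s by blast
    have "p x \<noteq> 0" using p(3,4) assms(4) Basis s by auto
    then show ?case using r p
      by (intro bexI[of _ "\<lambda>y. p y * (r y * r' y)"]) (auto intro: polynomials.intros simp: s)
  qed
qed

text \<open>The neighbourhoods are not deleted: \<open>eventually\<close> speaks of germs along
  \<open>S\<close>, including the value at \<open>x\<close> if \<open>x\<close> lies in
  \<open>S\<close>. Accordingly \<open>frequently\<close> expresses membership in a closure.\<close>

definition nz :: "'a::charted_space set \<Rightarrow> 'a \<Rightarrow> 'a filter" where
  "nz S x = inf (nhdsin zariski x) (principal S)"

lemma eventually_nz:
  "eventually P (nz S x) \<longleftrightarrow> (\<exists>W. openin zariski W \<and> x \<in> W \<and> (\<forall>y\<in>W \<inter> S. P y))"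
  by (auto simp: nz_def eventually_inf_principal eventually_nhdsin)

lemma eventually_nz_chart:
  assumes "(V, \<Phi>) \<in> charts" "x \<in> V"
  shows "eventually P (nz S x) \<longleftrightarrow>
    (\<exists>q \<in> polynomials \<Phi>. q x \<noteq> 0 \<and> (\<forall>y\<in>S \<inter> V. q y \<noteq> 0 \<longrightarrow> P y))" (is "_ \<longleftrightarrow> ?R")
proof
  assume "eventually P (nz S x)"
  then obtain W where "openin zariski W" "x \<in> W" "\<forall>y\<in>W \<inter> S. P y" by (auto simp: eventually_nz)
  then show ?R using zariski_neighbourhood[OF _ _ assms, of W] by blast
next
  assume ?R
  then obtain q where "q \<in> polynomials \<Phi>" "q x \<noteq> 0" "\<forall>y\<in>S \<inter> V. q y \<noteq> 0 \<longrightarrow> P y" by blast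
  then show "eventually P (nz S x)" unfolding eventually_nz using assms
    by (intro exI[of _ "{y \<in> V. q y \<noteq> 0}"]) (auto intro: openin_zariski_basic)
qed

lemma nz_mono: "T \<subseteq> S \<Longrightarrow> nz T x \<le> nz S x"
  unfolding nz_def by (intro inf_mono) auto

lemma eventually_nz_subset: "eventually P (nz S x) \<Longrightarrow> T \<subseteq> S \<Longrightarrow> eventually P (nz T x)"
  using nz_mono by (rule filter_leD)

lemma eventually_nz_self: "eventually (\<lambda>y. y \<in> S) (nz S x)"
  by (auto simp: nz_def eventually_inf_principal)

lemma eventually_nz_at: "eventually P (nz S x) \<Longrightarrow> x \<in> S \<Longrightarrow> P x"
  by (auto simp: eventually_nz)

lemma eventually_nz_iterate:
  "eventually P (nz S x) \<Longrightarrow> eventually (\<lambda>y. eventually P (nz S y)) (nz S x)"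
  by (auto simp: eventually_nz)

text \<open>Germs along a relatively open subset are germs along the ambient set; this removes the
  auxiliary open sets from all later statements.\<close>

lemma eventually_nz_cong: "eventually (\<lambda>y. y \<in> W) (nz S x) \<Longrightarrow> W \<subseteq> S \<Longrightarrow> nz W x = nz S x"
  unfolding filter_eq_iff eventually_nz by (blast intro: openin_Int)

lemma openin_zariski_on_iff:
  "openin (zariski_on S) W \<longleftrightarrow> W \<subseteq> S \<and> (\<forall>x\<in>W. eventually (\<lambda>y. y \<in> W) (nz S x))"
proof
  assume "openin (zariski_on S) W"
  then show "W \<subseteq> S \<and> (\<forall>x\<in>W. eventually (\<lambda>y. y \<in> W) (nz S x))"
    unfolding openin_subtopology eventually_nz by blast
next
  assume r: "W \<subseteq> S \<and> (\<forall>x\<in>W. eventually (\<lambda>y. y \<in> W) (nz S x))"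
  then obtain T where T: "\<forall>x\<in>W. openin zariski (T x) \<and> x \<in> T x \<and> (\<forall>y\<in>T x \<inter> S. y \<in> W)"
    unfolding eventually_nz by metis
  have "openin zariski (\<Union>(T ` W))" using T by blast
  moreover have "W = \<Union>(T ` W) \<inter> S" using T r by blast
  ultimately show "openin (zariski_on S) W" unfolding openin_subtopology by blast
qed

lemma openin_zariski_on_subset: "openin (zariski_on S) W \<Longrightarrow> W \<subseteq> S"
  by (auto simp: openin_subtopology)

lemma openin_zariski_on_nz: "openin (zariski_on S) W \<Longrightarrow> x \<in> W \<Longrightarrow> nz W x = nz S x"
  by (auto simp: openin_zariski_on_iff intro: eventually_nz_cong)

lemma eventually_nz_open:
  assumes "eventually P (nz S x)" "x \<in> S"
  obtains W where "openin (zariski_on S) W" "x \<in> W" "\<And>y. y \<in> W \<Longrightarrow> P y"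
  using assms unfolding eventually_nz openin_subtopology by blast

section \<open>Germs of regular functions\<close>

definition reg :: "'a::charted_space set \<Rightarrow> 'a \<Rightarrow> ('a \<Rightarrow> complex) \<Rightarrow> bool" where
  "reg S x g \<longleftrightarrow> (\<exists>V \<Phi> p q. (V, \<Phi>) \<in> charts \<and> x \<in> V \<and> p \<in> polynomials \<Phi> \<and> q \<in> polynomials \<Phi> \<and>
     q x \<noteq> 0 \<and> eventually (\<lambda>y. g y = p y / q y) (nz S x))"

text \<open>Any chart at the point will do: the chart change writes numerator and denominator as
  quotients, and clearing their denominators gives \<open>g = (p1 * q2) / (p2 * q1)\<close>.\<close>

lemma reg_chart:
  assumes "(V, \<Phi>) \<in> charts" "x \<in> V"
  shows "reg S x g \<longleftrightarrow> (\<exists>p \<in> polynomials \<Phi>. \<exists>q \<in> polynomials \<Phi>. q x \<noteq> 0 \<and>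
    eventually (\<lambda>y. q y \<noteq> 0 \<and> g y = p y / q y) (nz S x))" (is "_ \<longleftrightarrow> ?R")
proof
  assume "reg S x g"
  then obtain V' \<Phi>' p q where *: "(V', \<Phi>') \<in> charts" "x \<in> V'" "p \<in> polynomials \<Phi>'" "q \<in> polynomials \<Phi>'"
     "q x \<noteq> 0" "eventually (\<lambda>y. g y = p y / q y) (nz S x)" unfolding reg_def by blast
  obtain p1 p2 where p: "p1 \<in> polynomials \<Phi>" "p2 \<in> polynomials \<Phi>" "p2 x \<noteq> 0" "\<forall>y\<in>V. p2 y \<noteq> 0 \<longrightarrow> p y = p1 y / p2 y"
    using chart_polynomial[OF assms(1) *(1) assms(2) *(2) *(3)] by blast
  obtain q1 q2 where q: "q1 \<in> polynomials \<Phi>" "q2 \<in> polynomials \<Phi>" "q2 x \<noteq> 0" "\<forall>y\<in>V. q2 y \<noteq> 0 \<longrightarrow> q y = q1 y / q2 y"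
    using chart_polynomial[OF assms(1) *(1) assms(2) *(2) *(4)] by blast
  have q1: "q1 x \<noteq> 0" using q * assms by auto
  have m: "(\<lambda>y. p2 y * (q1 y * q2 y)) \<in> polynomials \<Phi>" using p q by (auto intro: polynomials.mult)
  have "eventually (\<lambda>y. y \<in> V \<and> p2 y * (q1 y * q2 y) \<noteq> 0) (nz S x)"
    by (subst eventually_nz_chart[OF assms], rule bexI[OF _ m]) (use p q q1 in auto)
  then have "eventually (\<lambda>y. p2 y * q1 y \<noteq> 0 \<and> g y = (p1 y * q2 y) / (p2 y * q1 y)) (nz S x)"
    using *(6) by eventually_elim (use p q in auto)
  then show ?R using p q q1
    by (intro bexI[of _ "\<lambda>y. p1 y * q2 y"] bexI[of _ "\<lambda>y. p2 y * q1 y"]) (auto intro: polynomials.intros)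
next
  assume ?R
  then obtain p q where "p \<in> polynomials \<Phi>" "q \<in> polynomials \<Phi>" "q x \<noteq> 0"
    "eventually (\<lambda>y. q y \<noteq> 0 \<and> g y = p y / q y) (nz S x)" by blast
  moreover from this(4) have "eventually (\<lambda>y. g y = p y / q y) (nz S x)" by eventually_elim simp
  ultimately show "reg S x g" unfolding reg_def using assms by blast
qed

lemma regular_on_iff_reg: "regular_on S f \<longleftrightarrow> (\<forall>x\<in>S. reg S x f)"
proof
  assume r: "regular_on S f"
  show "\<forall>x\<in>S. reg S x f"
  proof
    fix x assume "x \<in> S"
    then obtain V \<Phi> p q where "(V, \<Phi>) \<in> charts" "x \<in> V" "p \<in> polynomials \<Phi>" "q \<in> polynomials \<Phi>" "q x \<noteq> 0"
      "\<forall>y\<in>S \<inter> V. q y \<noteq> 0 \<longrightarrow> f y = p y / q y"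
      using r unfolding regular_on_def by blast
    then show "reg S x f" unfolding reg_def
      by (intro exI[of _ V] exI[of _ \<Phi>] exI[of _ p] exI[of _ q])
        (auto simp: eventually_nz_chart[of V \<Phi>])
  qed
next
  assume r: "\<forall>x\<in>S. reg S x f"
  show "regular_on S f" unfolding regular_on_def
  proof
    fix x assume "x \<in> S"
    then have "reg S x f" using r by blast
    then obtain V \<Phi> p q where *: "(V, \<Phi>) \<in> charts" "x \<in> V" "p \<in> polynomials \<Phi>" "q \<in> polynomials \<Phi>"
     "q x \<noteq> 0" "eventually (\<lambda>y. f y = p y / q y) (nz S x)" unfolding reg_def by blast
    then obtain r where r: "r \<in> polynomials \<Phi>" "r x \<noteq> 0" "\<forall>y\<in>S \<inter> V. r y \<noteq> 0 \<longrightarrow> f y = p y / q y"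
      by (auto simp: eventually_nz_chart[OF *(1,2)])
    \<comment> \<open>\<open>regular_on\<close> demands the quotient formula wherever the
      denominator is nonzero. Multiplying by \<open>r\<close>, which is nonzero on
      \<open>S \<inter> V\<close> only where the formula is known, achieves this.\<close>
    show "\<exists>V \<Phi> p q. (V, \<Phi>) \<in> charts \<and> x \<in> V \<and> p \<in> polynomials \<Phi> \<and> q \<in> polynomials \<Phi> \<and> q x \<noteq> 0 \<and>
     (\<forall>y \<in> S \<inter> V. q y \<noteq> 0 \<longrightarrow> f y = p y / q y)"
      using * r
      by (intro exI[of _ V] exI[of _ \<Phi>] exI[of _ "\<lambda>y. p y * r y"] exI[of _ "\<lambda>y. q y * r y"])
        (auto intro: polynomials.intros)
  qed
qed

lemma reg_eq_cong:
  assumes "reg S x g" "eventually (\<lambda>y. f y = g y) (nz S x)"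
  shows "reg S x f"
proof -
  obtain V \<Phi> p q where "(V, \<Phi>) \<in> charts" "x \<in> V" "p \<in> polynomials \<Phi>" "q \<in> polynomials \<Phi>"
     "q x \<noteq> 0" "eventually (\<lambda>y. g y = p y / q y) (nz S x)" using assms(1) unfolding reg_def by blast
  moreover from this(6) assms(2) have "eventually (\<lambda>y. f y = p y / q y) (nz S x)"
    by eventually_elim simp
  ultimately show ?thesis unfolding reg_def by blast
qed

lemma reg_subset: "reg S x g \<Longrightarrow> T \<subseteq> S \<Longrightarrow> reg T x g"
  unfolding reg_def by (meson eventually_nz_subset)

lemma reg_polynomial: "(V, \<Phi>) \<in> charts \<Longrightarrow> x \<in> V \<Longrightarrow> p \<in> polynomials \<Phi> \<Longrightarrow> reg S x p"
  unfolding reg_chart by (rule bexI[of _ p], rule bexI[OF _ polynomials.const[of 1]]) auto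

lemma reg_const [simp]: "reg S x (\<lambda>_. c)"
  using chart_cover[of x] reg_polynomial[OF _ _ polynomials.const] by blast

lemma reg_add:
  assumes "reg S x f" "reg S x g"
  shows "reg S x (\<lambda>y. f y + g y)"
proof -
  obtain V \<Phi> where c: "(V, \<Phi>) \<in> charts" "x \<in> V" using chart_cover by blast
  obtain p q p' q' where *: "p \<in> polynomials \<Phi>" "q \<in> polynomials \<Phi>" "q x \<noteq> 0"
    "eventually (\<lambda>y. q y \<noteq> 0 \<and> f y = p y / q y) (nz S x)"
    "p' \<in> polynomials \<Phi>" "q' \<in> polynomials \<Phi>" "q' x \<noteq> 0"
    "eventually (\<lambda>y. q' y \<noteq> 0 \<and> g y = p' y / q' y) (nz S x)"
    using assms unfolding reg_chart[OF c] by blast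
  from *(4,8) have "eventually (\<lambda>y. q y * q' y \<noteq> 0 \<and> f y + g y = (p y * q' y + p' y * q y) / (q y * q' y)) (nz S x)"
    by eventually_elim (auto simp: field_simps)
  then show ?thesis unfolding reg_chart[OF c] using *
    by (intro bexI[of _ "\<lambda>y. p y * q' y + p' y * q y"] bexI[of _ "\<lambda>y. q y * q' y"])
      (auto intro: polynomials.intros)
qed

lemma reg_mult:
  assumes "reg S x f" "reg S x g"
  shows "reg S x (\<lambda>y. f y * g y)"
proof -
  obtain V \<Phi> where c: "(V, \<Phi>) \<in> charts" "x \<in> V" using chart_cover by blast
  obtain p q p' q' where *: "p \<in> polynomials \<Phi>" "q \<in> polynomials \<Phi>" "q x \<noteq> 0"
    "eventually (\<lambda>y. q y \<noteq> 0 \<and> f y = p y / q y) (nz S x)"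
    "p' \<in> polynomials \<Phi>" "q' \<in> polynomials \<Phi>" "q' x \<noteq> 0"
    "eventually (\<lambda>y. q' y \<noteq> 0 \<and> g y = p' y / q' y) (nz S x)"
    using assms unfolding reg_chart[OF c] by blast
  from *(4,8) have "eventually (\<lambda>y. q y * q' y \<noteq> 0 \<and> f y * g y = (p y * p' y) / (q y * q' y)) (nz S x)"
    by eventually_elim (auto simp: field_simps)
  then show ?thesis unfolding reg_chart[OF c] using *
    by (intro bexI[of _ "\<lambda>y. p y * p' y"] bexI[of _ "\<lambda>y. q y * q' y"])
      (auto intro: polynomials.intros)
qed

lemma reg_nonzero:
  assumes "reg S x g" "x \<in> S" "g x \<noteq> 0"
  shows "eventually (\<lambda>y. g y \<noteq> 0) (nz S x)"
proof -
  obtain V \<Phi> where c: "(V, \<Phi>) \<in> charts" "x \<in> V" using chart_cover by blast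
  obtain p q where *: "p \<in> polynomials \<Phi>" "q \<in> polynomials \<Phi>" "q x \<noteq> 0"
    "eventually (\<lambda>y. q y \<noteq> 0 \<and> g y = p y / q y) (nz S x)"
    using assms(1) unfolding reg_chart[OF c] by blast
  have "p x \<noteq> 0" using eventually_nz_at[OF *(4) assms(2)] assms(3) by auto
  then have "eventually (\<lambda>y. p y \<noteq> 0) (nz S x)"
    unfolding eventually_nz_chart[OF c] using *(1) by blast
  then show ?thesis using *(4) by eventually_elim auto
qed

lemma reg_inverse:
  assumes "reg S x g" "x \<in> S" "g x \<noteq> 0"
  shows "reg S x (\<lambda>y. inverse (g y))"
proof -
  obtain V \<Phi> where c: "(V, \<Phi>) \<in> charts" "x \<in> V" using chart_cover by blast
  obtain p q where *: "p \<in> polynomials \<Phi>" "q \<in> polynomials \<Phi>" "q x \<noteq> 0"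
    "eventually (\<lambda>y. q y \<noteq> 0 \<and> g y = p y / q y) (nz S x)"
    using assms(1) unfolding reg_chart[OF c] by blast
  have p: "p x \<noteq> 0" using eventually_nz_at[OF *(4) assms(2)] assms(3) by auto
  have "eventually (\<lambda>y. g y \<noteq> 0) (nz S x)" using assms by (rule reg_nonzero)
  with *(4) have "eventually (\<lambda>y. p y \<noteq> 0 \<and> inverse (g y) = q y / p y) (nz S x)"
    by eventually_elim (auto simp: field_simps)
  then show ?thesis unfolding reg_chart[OF c] using * p by blast
qed

lemma reg_divide:
  "reg S x f \<Longrightarrow> reg S x g \<Longrightarrow> x \<in> S \<Longrightarrow> g x \<noteq> 0 \<Longrightarrow> reg S x (\<lambda>y. f y / g y)"
  unfolding divide_inverse by (intro reg_mult reg_inverse)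

lemma reg_minus: "reg S x f \<Longrightarrow> reg S x (\<lambda>y. - f y)"
  using reg_mult[OF reg_const[of S x "-1"], of f] by simp

lemma reg_diff: "reg S x f \<Longrightarrow> reg S x g \<Longrightarrow> reg S x (\<lambda>y. f y - g y)"
  using reg_add[OF _ reg_minus, of S x f g] by simp

lemma reg_power: "reg S x f \<Longrightarrow> reg S x (\<lambda>y. f y ^ n)"
  by (induction n) (auto intro: reg_mult)

lemma reg_sum: "(\<And>i. i \<in> I \<Longrightarrow> reg S x (f i)) \<Longrightarrow> reg S x (\<lambda>y. \<Sum>i\<in>I. f i y)"
  by (induction I rule: infinite_finite_induct) (auto intro: reg_add)

lemmas reg_intros = reg_const reg_add reg_mult reg_minus reg_diff reg_power reg_sum

lemma reg_eventually:
  assumes "reg S x g"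
  shows "eventually (\<lambda>y. reg S y g) (nz S x)"
proof -
  obtain V \<Phi> where c: "(V, \<Phi>) \<in> charts" "x \<in> V" using chart_cover by blast
  obtain p q where *: "p \<in> polynomials \<Phi>" "q \<in> polynomials \<Phi>" "q x \<noteq> 0"
    "eventually (\<lambda>y. q y \<noteq> 0 \<and> g y = p y / q y) (nz S x)"
    using assms(1) unfolding reg_chart[OF c] by blast
  have V: "eventually (\<lambda>y. y \<in> V) (nz S x)"
    using openin_zariski_chart[OF c(1)] c(2) by (auto simp: eventually_nz)
  show ?thesis using V *(4) eventually_nz_iterate[OF *(4)]
    by eventually_elim (use c * in \<open>auto simp: reg_chart[OF c(1)]\<close>)
qed

text \<open>The target plays no role: a germ of a morphism is given by its coordinates in one chart.\<close>

definition mor :: "'a::charted_space set \<Rightarrow> 'a \<Rightarrow> ('a \<Rightarrow> 'b::charted_space) \<Rightarrow> bool" where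
  "mor S x f \<longleftrightarrow> (\<exists>V \<Phi>. (V, \<Phi>) \<in> charts \<and> f x \<in> V \<and> eventually (\<lambda>y. f y \<in> V) (nz S x) \<and>
     (\<forall>\<phi>\<in>\<Phi>. reg S x (\<lambda>y. \<phi> (f y))))"

lemma reg_polynomials:
  assumes "p \<in> polynomials \<Phi>" "\<And>\<phi>. \<phi> \<in> \<Phi> \<Longrightarrow> reg S x (\<lambda>y. \<phi> (f y))"
  shows "reg S x (\<lambda>y. p (f y))"
  using assms(1) by induction (auto intro: reg_add reg_mult assms(2))

text \<open>Continuity, in terms of germs. The premise \<open>f y \<in> T\<close> remains inside
  because \<open>f\<close> is not assumed to map into \<open>T\<close>; the target set is a free
  choice throughout.\<close>

lemma mor_eventually:
  assumes "mor S x f" "x \<in> S" "eventually P (nz T (f x))"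
  shows "eventually (\<lambda>y. f y \<in> T \<longrightarrow> P (f y)) (nz S x)"
proof -
  obtain V \<Phi> where m: "(V, \<Phi>) \<in> charts" "f x \<in> V" "eventually (\<lambda>y. f y \<in> V) (nz S x)"
    "\<And>\<phi>. \<phi> \<in> \<Phi> \<Longrightarrow> reg S x (\<lambda>y. \<phi> (f y))" using assms(1) unfolding mor_def by blast
  obtain q where q: "q \<in> polynomials \<Phi>" "q (f x) \<noteq> 0" "\<forall>y\<in>T \<inter> V. q y \<noteq> 0 \<longrightarrow> P y"
    using assms(3) unfolding eventually_nz_chart[OF m(1,2)] by blast
  have "eventually (\<lambda>y. q (f y) \<noteq> 0) (nz S x)"
    using q(2) by (intro reg_nonzero[OF reg_polynomials[OF q(1) m(4)] assms(2)])
  with m(3) show ?thesis by eventually_elim (use q in auto)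
qed

lemma mor_reg:
  assumes "mor S x f" "x \<in> S" "reg T (f x) g" "eventually (\<lambda>y. f y \<in> T) (nz S x)"
  shows "reg S x (\<lambda>y. g (f y))"
proof -
  obtain V \<Phi> where m: "(V, \<Phi>) \<in> charts" "f x \<in> V" "eventually (\<lambda>y. f y \<in> V) (nz S x)"
    "\<And>\<phi>. \<phi> \<in> \<Phi> \<Longrightarrow> reg S x (\<lambda>y. \<phi> (f y))" using assms(1) unfolding mor_def by blast
  obtain p q where *: "p \<in> polynomials \<Phi>" "q \<in> polynomials \<Phi>" "q (f x) \<noteq> 0"
    "eventually (\<lambda>y. q y \<noteq> 0 \<and> g y = p y / q y) (nz T (f x))"
    using assms(3) unfolding reg_chart[OF m(1,2)] by blast
  have "eventually (\<lambda>y. g (f y) = p (f y) / q (f y)) (nz S x)"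
    using mor_eventually[OF assms(1,2) *(4)] assms(4) by eventually_elim auto
  then show ?thesis
    by (rule reg_eq_cong[rotated]) (intro reg_divide reg_polynomials[OF *(1) m(4)] reg_polynomials[OF *(2) m(4)] assms(2) *(3))
qed

lemma mor_chart:
  assumes "mor S x f" "x \<in> S" "(V, \<Phi>) \<in> charts" "f x \<in> V"
  shows "eventually (\<lambda>y. f y \<in> V) (nz S x)" "\<phi> \<in> \<Phi> \<Longrightarrow> reg S x (\<lambda>y. \<phi> (f y))"
proof -
  have "eventually (\<lambda>y. y \<in> V) (nz UNIV (f x))"
    using openin_zariski_chart assms by (auto simp: eventually_nz)
  from mor_eventually[OF assms(1,2) this] show "eventually (\<lambda>y. f y \<in> V) (nz S x)" by simp
  show "\<phi> \<in> \<Phi> \<Longrightarrow> reg S x (\<lambda>y. \<phi> (f y))"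
    by (rule mor_reg[OF assms(1,2) reg_polynomial[OF assms(3,4), of _ UNIV] ]) (auto intro: polynomials.coord)
qed

lemma mor_I:
  assumes "\<And>V \<Phi>. (V, \<Phi>) \<in> charts \<Longrightarrow> f x \<in> V \<Longrightarrow> eventually (\<lambda>y. f y \<in> V) (nz S x) \<and>
     (\<forall>\<phi>\<in>\<Phi>. reg S x (\<lambda>y. \<phi> (f y)))"
  shows "mor S x f"
  using assms chart_cover[of "f x"] unfolding mor_def by blast

lemma mor_subset: "mor S x f \<Longrightarrow> T \<subseteq> S \<Longrightarrow> mor T x f"
  unfolding mor_def by (meson eventually_nz_subset reg_subset)

lemma mor_eq_cong:
  assumes "mor S x f" "eventually (\<lambda>y. g y = f y) (nz S x)" "x \<in> S"
  shows "mor S x g"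
proof -
  obtain V \<Phi> where m: "(V, \<Phi>) \<in> charts" "f x \<in> V" "eventually (\<lambda>y. f y \<in> V) (nz S x)"
    "\<And>\<phi>. \<phi> \<in> \<Phi> \<Longrightarrow> reg S x (\<lambda>y. \<phi> (f y))" using assms(1) unfolding mor_def by blast
  have "g x \<in> V" using m(2) eventually_nz_at[OF assms(2,3)] by simp
  moreover from m(3) assms(2) have "eventually (\<lambda>y. g y \<in> V) (nz S x)" by eventually_elim simp
  moreover have "reg S x (\<lambda>y. \<phi> (g y))" if "\<phi> \<in> \<Phi>" for \<phi>
    by (rule reg_eq_cong[OF m(4)[OF that]]) (use assms(2) in \<open>auto elim!: eventually_mono\<close>)
  ultimately show ?thesis unfolding mor_def using m(1) by blast
qed

section \<open>Morphisms into products, powers and projective spaces\<close>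

lemma mor_id [simp]: "mor S x (\<lambda>y. y)"
proof (rule mor_I)
  fix V and \<Phi> :: "('a \<Rightarrow> complex) set" assume c: "(V, \<Phi>) \<in> charts" "x \<in> V"
  then show "eventually (\<lambda>y. y \<in> V) (nz S x) \<and> (\<forall>\<phi>\<in>\<Phi>. reg S x \<phi>)"
    using openin_zariski_chart[OF c(1)] reg_polynomial[OF c polynomials.coord]
    by (auto simp: eventually_nz)
qed

lemma mor_compose:
  assumes "mor S x f" "x \<in> S" "mor T (f x) g" "eventually (\<lambda>y. f y \<in> T) (nz S x)"
  shows "mor S x (\<lambda>y. g (f y))"
proof -
  obtain V \<Phi> where m: "(V, \<Phi>) \<in> charts" "g (f x) \<in> V" "eventually (\<lambda>y. g y \<in> V) (nz T (f x))"
    "\<And>\<phi>. \<phi> \<in> \<Phi> \<Longrightarrow> reg T (f x) (\<lambda>y. \<phi> (g y))" using assms(3) unfolding mor_def by blast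
  have "eventually (\<lambda>y. g (f y) \<in> V) (nz S x)"
    using mor_eventually[OF assms(1,2) m(3)] assms(4) by eventually_elim auto
  then show ?thesis unfolding mor_def using m mor_reg[OF assms(1,2) m(4) assms(4)] by blast
qed

lemma mor_Pair:
  assumes "mor S x f" "mor S x g"
  shows "mor S x (\<lambda>y. (f y, g y))"
proof -
  obtain V \<Phi> where m: "(V, \<Phi>) \<in> charts" "f x \<in> V" "eventually (\<lambda>y. f y \<in> V) (nz S x)"
    "\<And>\<phi>. \<phi> \<in> \<Phi> \<Longrightarrow> reg S x (\<lambda>y. \<phi> (f y))" using assms(1) unfolding mor_def by blast
  obtain W \<Psi> where n: "(W, \<Psi>) \<in> charts" "g x \<in> W" "eventually (\<lambda>y. g y \<in> W) (nz S x)"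
    "\<And>\<phi>. \<phi> \<in> \<Psi> \<Longrightarrow> reg S x (\<lambda>y. \<phi> (g y))" using assms(2) unfolding mor_def by blast
  have "(V \<times> W, (\<lambda>\<phi>. \<phi> \<circ> fst) ` \<Phi> \<union> (\<lambda>\<psi>. \<psi> \<circ> snd) ` \<Psi>) \<in> charts"
    using m(1) n(1) unfolding charts_prod_def by blast
  moreover have "eventually (\<lambda>y. (f y, g y) \<in> V \<times> W) (nz S x)"
    using m(3) n(3) by eventually_elim auto
  ultimately show ?thesis unfolding mor_def using m n
    by (intro exI[of _ "V \<times> W"] exI[of _ "(\<lambda>\<phi>. \<phi> \<circ> fst) ` \<Phi> \<union> (\<lambda>\<psi>. \<psi> \<circ> snd) ` \<Psi>"]) auto
qed

lemma mor_fst_id: "mor S x fst"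
proof (rule mor_I)
  fix V and \<Phi> :: "('a \<Rightarrow> complex) set" assume c: "(V, \<Phi>) \<in> charts" "fst x \<in> V"
  obtain W and \<Psi> :: "('b \<Rightarrow> complex) set" where d: "(W, \<Psi>) \<in> charts" "snd x \<in> W"
    using chart_cover by blast
  have e: "(V \<times> W, (\<lambda>\<phi>. \<phi> \<circ> fst) ` \<Phi> \<union> (\<lambda>\<psi>. \<psi> \<circ> snd) ` \<Psi>) \<in> charts" "x \<in> V \<times> W"
    using c d unfolding charts_prod_def by (blast, simp add: mem_Times_iff)
  from mor_chart[OF mor_id, of x UNIV, OF _ e] c d have
    "eventually (\<lambda>y. y \<in> V \<times> W) (nz UNIV x)" "\<forall>\<phi>\<in>\<Phi>. reg UNIV x (\<lambda>y. \<phi> (fst y))"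
    by (auto simp: o_def)
  then show "eventually (\<lambda>y. fst y \<in> V) (nz S x) \<and> (\<forall>\<phi>\<in>\<Phi>. reg S x (\<lambda>y. \<phi> (fst y)))"
    using eventually_nz_subset[of "\<lambda>y. y \<in> V \<times> W" UNIV x S]
    by (auto elim: eventually_mono intro: reg_subset[of UNIV])
qed

lemma mor_snd_id: "mor S x snd"
proof (rule mor_I)
  fix W and \<Psi> :: "('b \<Rightarrow> complex) set" assume c: "(W, \<Psi>) \<in> charts" "snd x \<in> W"
  obtain V and \<Phi> :: "('a \<Rightarrow> complex) set" where d: "(V, \<Phi>) \<in> charts" "fst x \<in> V"
    using chart_cover by blast
  have e: "(V \<times> W, (\<lambda>\<phi>. \<phi> \<circ> fst) ` \<Phi> \<union> (\<lambda>\<psi>. \<psi> \<circ> snd) ` \<Psi>) \<in> charts" "x \<in> V \<times> W"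
    using c d unfolding charts_prod_def by (blast, simp add: mem_Times_iff)
  from mor_chart[OF mor_id, of x UNIV, OF _ e] c d have
    "eventually (\<lambda>y. y \<in> V \<times> W) (nz UNIV x)" "\<forall>\<phi>\<in>\<Psi>. reg UNIV x (\<lambda>y. \<phi> (snd y))"
    by (auto simp: o_def)
  then show "eventually (\<lambda>y. snd y \<in> W) (nz S x) \<and> (\<forall>\<phi>\<in>\<Psi>. reg S x (\<lambda>y. \<phi> (snd y)))"
    using eventually_nz_subset[of "\<lambda>y. y \<in> V \<times> W" UNIV x S]
    by (auto elim: eventually_mono intro: reg_subset[of UNIV])
qed

lemma mor_eval_id: "mor S x (\<lambda>h. h a)"
proof (rule mor_I)
  fix V and \<Phi> :: "('b \<Rightarrow> complex) set" assume c: "(V, \<Phi>) \<in> charts" "x a \<in> V"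
  have "\<forall>a. \<exists>V \<Phi>. (V, \<Phi> :: ('b \<Rightarrow> complex) set) \<in> charts \<and> x a \<in> V" using chart_cover by blast
  then obtain V0 \<Phi>0 where d: "\<And>a. (V0 a, \<Phi>0 a :: ('b \<Rightarrow> complex) set) \<in> charts" "\<And>a. x a \<in> V0 a" by metis
  define V1 where "V1 = V0(a := V)"
  define \<Phi>1 where "\<Phi>1 = \<Phi>0(a := \<Phi>)"
  have "(V1 b, \<Phi>1 b) \<in> charts" for b using c d by (auto simp: V1_def \<Phi>1_def)
  then have e: "({h. \<forall>a. h a \<in> V1 a}, {\<lambda>h. \<phi> (h a) | a \<phi>. \<phi> \<in> \<Phi>1 a}) \<in> charts"
     "x \<in> {h. \<forall>a. h a \<in> V1 a}"
    using c d unfolding charts_fun_def by (blast, auto simp: V1_def)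
  have "eventually (\<lambda>h. h \<in> {h. \<forall>a. h a \<in> V1 a}) (nz S x)"
    using mor_chart(1)[OF mor_id, of x UNIV, OF _ e] by (auto intro: eventually_nz_subset[of _ UNIV])
  then have 1: "eventually (\<lambda>h. h a \<in> V) (nz S x)"
    by (rule eventually_mono) (metis (mono_tags, lifting) V1_def fun_upd_same mem_Collect_eq)
  have "reg S x (\<lambda>h. \<phi> (h a))" if "\<phi> \<in> \<Phi>" for \<phi>
  proof (rule reg_subset[of UNIV])
    have "\<exists>a' \<psi>. (\<lambda>h. \<phi> (h a)) = (\<lambda>h. \<psi> (h a')) \<and> \<psi> \<in> \<Phi>1 a'"
      by (rule exI[of _ a], rule exI[of _ \<phi>]) (simp add: that \<Phi>1_def)
    then show "reg UNIV x (\<lambda>h. \<phi> (h a))"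
      by (intro mor_chart(2)[OF mor_id, of x UNIV, OF _ e, of "\<lambda>h. \<phi> (h a)"]) auto
  qed simp
  with 1 show "eventually (\<lambda>y. y a \<in> V) (nz S x) \<and> (\<forall>\<phi>\<in>\<Phi>. reg S x (\<lambda>y. \<phi> (y a)))" by blast
qed

lemma mor_fst: "mor S x f \<Longrightarrow> x \<in> S \<Longrightarrow> mor S x (\<lambda>y. fst (f y))"
  by (rule mor_compose[OF _ _ mor_fst_id[of UNIV]]) auto

lemma mor_eval: "mor S x f \<Longrightarrow> x \<in> S \<Longrightarrow> mor S x (\<lambda>y. f y a)"
  by (rule mor_compose[OF _ _ mor_eval_id[of UNIV]]) auto

lemma mor_fun:
  fixes f :: "'a::charted_space \<Rightarrow> 'b::finite \<Rightarrow> 'c::charted_space"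
  assumes "\<And>a. mor S x (\<lambda>y. f y a)"
  shows "mor S x f"
proof -
  have "\<forall>a. \<exists>V \<Phi>. (V, \<Phi>) \<in> charts \<and> f x a \<in> V \<and> eventually (\<lambda>y. f y a \<in> V) (nz S x) \<and>
    (\<forall>\<phi>\<in>\<Phi>. reg S x (\<lambda>y. \<phi> (f y a)))"
    using assms unfolding mor_def by blast
  then obtain V \<Phi> where m: "\<And>a. (V a, \<Phi> a) \<in> charts" "\<And>a. f x a \<in> V a" "\<And>a. eventually (\<lambda>y. f y a \<in> V a) (nz S x)"
    "\<And>a \<phi>. \<phi> \<in> \<Phi> a \<Longrightarrow> reg S x (\<lambda>y. \<phi> (f y a))"
    by metis
  have "({h. \<forall>a. h a \<in> V a}, {\<lambda>h. \<phi> (h a) | a \<phi>. \<phi> \<in> \<Phi> a}) \<in> charts"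
    using m(1) unfolding charts_fun_def by blast
  moreover have "eventually (\<lambda>y. f y \<in> {h. \<forall>a. h a \<in> V a}) (nz S x)"
    using m(3) by (simp add: eventually_all_finite)
  moreover have "f x \<in> {h. \<forall>a. h a \<in> V a}" using m(2) by simp
  moreover have "\<forall>\<psi>\<in>{\<lambda>h. \<phi> (h a) | a \<phi>. \<phi> \<in> \<Phi> a}. reg S x (\<lambda>y. \<psi> (f y))"
    using m(4) by auto
  ultimately show ?thesis unfolding mor_def by blast
qed

lemma mor_abs_proj:
  fixes g :: "'n::finite \<Rightarrow> 'a::charted_space \<Rightarrow> complex"
  assumes "\<And>i. reg S x (g i)" "x \<in> S" "g j x \<noteq> 0"
  shows "mor S x (\<lambda>y. abs_proj (\<chi> i. g i y))"
proof -
  have ne: "(\<chi> i. g i y) \<noteq> 0" if "g j y \<noteq> 0" for y using that by (auto simp: vec_eq_iff)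
  have ev: "eventually (\<lambda>y. g j y \<noteq> 0) (nz S x)" using assms by (intro reg_nonzero)
  have 1: "({P. coord_nonzero j P}, (\<lambda>i. coord_ratio i j) ` UNIV) \<in> (charts :: ('n proj set \<times> _) set)"
    by (auto simp: charts_proj_def)
  have 2: "eventually (\<lambda>y. abs_proj (\<chi> i. g i y) \<in> {P. coord_nonzero j P}) (nz S x)"
    using ev by eventually_elim (simp add: coord_nonzero_abs_proj ne)
  have "reg S x (\<lambda>y. coord_ratio i j (abs_proj (\<chi> i. g i y)))" for i
  proof (rule reg_eq_cong[OF reg_divide[OF assms(1)[of i] assms(1)[of j] assms(2,3)]])
    show "eventually (\<lambda>y. coord_ratio i j (abs_proj (\<chi> i. g i y)) = g i y / g j y) (nz S x)"
      using ev by eventually_elim (simp add: coord_ratio_abs_proj ne)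
  qed
  then show ?thesis unfolding mor_def
    by (intro exI[of _ "{P. coord_nonzero j P}"] exI[of _ "(\<lambda>i. coord_ratio i j) ` UNIV"] conjI 1 2)
      (auto simp: coord_nonzero_abs_proj ne assms(3))
qed

lemma reg_coord_ratio:
  assumes "mor S x f" "x \<in> S" "coord_nonzero j (f x)"
  shows "reg S x (\<lambda>y. coord_ratio i j (f y))" "eventually (\<lambda>y. coord_nonzero j (f y)) (nz S x)"
proof -
  have 1: "({P. coord_nonzero j P}, (\<lambda>i. coord_ratio i j) ` UNIV) \<in> charts"
    by (auto simp: charts_proj_def)
  from mor_chart[OF assms(1,2) this] assms(3)
  show "reg S x (\<lambda>y. coord_ratio i j (f y))" "eventually (\<lambda>y. coord_nonzero j (f y)) (nz S x)"
    by auto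
qed

text \<open>Projective space is separated. For representatives \<open>v\<close> and \<open>w\<close>
  the functions \<open>D i\<close> are \<open>(v_i / v_j) * (w_j / w_k) - w_i / w_k\<close>: they
  vanish where \<open>f\<close> and \<open>g\<close> agree, and they vanish together only if
  \<open>w\<close> is a multiple of \<open>v\<close>.\<close>

lemma mor_proj_separated:
  fixes f g :: "'a::charted_space \<Rightarrow> 'n::finite proj"
  assumes "mor S x f" "mor S x g" "x \<in> S" "f x \<noteq> g x"
  shows "eventually (\<lambda>y. f y \<noteq> g y) (nz S x)"
proof -
  obtain j where j: "coord_nonzero j (f x)" using coord_nonzero_exists by blast
  obtain k where k: "coord_nonzero k (g x)" using coord_nonzero_exists by blast
  note F = reg_coord_ratio[OF assms(1,3) j] and G = reg_coord_ratio[OF assms(2,3) k]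
  define D where "D i y = coord_ratio i j (f y) * coord_ratio j k (g y) - coord_ratio i k (g y)" for i y
  have D: "reg S x (D i)" for i unfolding D_def by (intro reg_intros F G)
  have "\<exists>i. D i x \<noteq> 0"
  proof (rule ccontr)
    assume "\<not> ?thesis"
    then have D0: "D i x = 0" for i by blast
    obtain v w where vw: "v \<noteq> 0" "f x = abs_proj v" "w \<noteq> 0" "g x = abs_proj w"
      using proj_cases by metis
    have "v $ i / v $ j * (w $ j / w $ k) = w $ i / w $ k" for i
      using D0[of i] by (simp add: D_def vw coord_ratio_abs_proj)
    moreover have nz: "v $ j \<noteq> 0" "w $ k \<noteq> 0" using j k by (simp_all add: vw coord_nonzero_abs_proj)
    ultimately have w: "w = (w $ j / v $ j) *s v"
      by (auto simp: vec_eq_iff field_simps)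
    have "w $ j / v $ j \<noteq> 0" using w vw(3) by auto
    then have "abs_proj v = abs_proj w" using w vw by (subst abs_proj_eq_iff) blast+
    with vw assms(4) show False by simp
  qed
  then obtain i where i: "D i x \<noteq> 0" by blast
  have "eventually (\<lambda>y. D i y \<noteq> 0) (nz S x)" using D assms(3) i by (rule reg_nonzero)
  with F(2) G(2) show ?thesis
  proof eventually_elim
    case (elim y)
    obtain v where v: "v \<noteq> 0" "g y = abs_proj v" using proj_cases by metis
    show ?case
    proof
      assume "f y = g y"
      with elim v show False by (simp add: D_def coord_ratio_abs_proj coord_nonzero_abs_proj)
    qed
  qed
qed

section \<open>Regular morphisms as families of germs\<close>

lemma regular_morphism_I:
  fixes f :: "'a::charted_space \<Rightarrow> 'b::charted_space"
  assumes "\<And>x. x \<in> S \<Longrightarrow> mor S x f"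
  shows "regular_morphism S UNIV f"
  unfolding regular_morphism_def
proof (intro conjI allI impI)
  have op: "openin (zariski_on S) {x \<in> S. f x \<in> W}" if W: "openin zariski W" for W :: "'b set"
    unfolding openin_zariski_on_iff
  proof (intro conjI ballI)
    fix x assume x: "x \<in> {x \<in> S. f x \<in> W}"
    have "eventually (\<lambda>y. y \<in> W) (nz UNIV (f x))" using x W by (auto simp: eventually_nz)
    from mor_eventually[OF assms _ this] x eventually_nz_self[of S x]
    show "eventually (\<lambda>y. y \<in> {x \<in> S. f x \<in> W}) (nz S x)" by (auto elim: eventually_elim2)
  qed auto
  then show "continuous_map (zariski_on S) (zariski_on UNIV) f"
    unfolding continuous_map_def by simp
  fix W :: "'b set" and g assume W: "openin (zariski_on UNIV) W \<and> regular_on W g"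
  show "regular_on {x \<in> S. f x \<in> W} (g \<circ> f)" unfolding regular_on_iff_reg
  proof
    fix x assume x: "x \<in> {x \<in> S. f x \<in> W}"
    have "reg W (f x) g" using x W by (auto simp: regular_on_iff_reg)
    moreover have "mor {x \<in> S. f x \<in> W} x f" using x assms by (blast intro: mor_subset)
    moreover have "eventually (\<lambda>y. f y \<in> W) (nz {x \<in> S. f x \<in> W} x)"
      using eventually_nz_self by (rule eventually_mono) simp
    ultimately show "reg {x \<in> S. f x \<in> W} x (g \<circ> f)"
      using mor_reg[OF _ x] by (simp add: o_def)
  qed
qed

text \<open>The coordinate functions of a chart at \<open>f x\<close> are regular on the chart;
  their pullbacks are the required germs.\<close>

lemma regular_morphism_mor:
  assumes "regular_morphism S UNIV f" "x \<in> S"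
  shows "mor S x f"
proof (rule mor_I)
  fix V \<Phi> assume c: "(V, \<Phi>) \<in> charts" "f x \<in> V"
  have V: "openin (zariski_on UNIV) V" using openin_zariski_chart[OF c(1)] by simp
  have "openin (zariski_on S) {y \<in> topspace (zariski_on S). f y \<in> V}"
    using assms(1) V unfolding regular_morphism_def continuous_map_def by blast
  then have op: "openin (zariski_on S) {y \<in> S. f y \<in> V}" by simp
  have x: "x \<in> {y \<in> S. f y \<in> V}" using assms(2) c by simp
  have eq: "nz {y \<in> S. f y \<in> V} x = nz S x" by (rule openin_zariski_on_nz[OF op x])
  have "regular_on V \<phi>" if "\<phi> \<in> \<Phi>" for \<phi>
    unfolding regular_on_iff_reg using reg_polynomial[OF c(1) _ polynomials.coord] that by blast
  then have "\<forall>\<phi>\<in>\<Phi>. reg {y \<in> S. f y \<in> V} x (\<phi> \<circ> f)"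
    using assms(1) V x unfolding regular_morphism_def regular_on_iff_reg by blast
  then have "\<forall>\<phi>\<in>\<Phi>. reg S x (\<lambda>y. \<phi> (f y))" unfolding reg_def eq o_def .
  moreover have "eventually (\<lambda>y. f y \<in> V) (nz S x)"
    using op x unfolding openin_zariski_on_iff by (auto elim!: eventually_mono dest!: bspec[of _ _ x])
  ultimately show "eventually (\<lambda>y. f y \<in> V) (nz S x) \<and> (\<forall>\<phi>\<in>\<Phi>. reg S x (\<lambda>y. \<phi> (f y)))" by blast
qed

section \<open>Ideals of germs\<close>

definition ideal_at ::
    "'a::charted_space set \<Rightarrow> 'a \<Rightarrow> 'k set \<Rightarrow> ('k \<Rightarrow> 'a \<Rightarrow> complex) \<Rightarrow> ('a \<Rightarrow> complex) \<Rightarrow> bool" where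
  "ideal_at S x I z g \<longleftrightarrow> (\<exists>a. (\<forall>k\<in>I. reg S x (a k)) \<and>
     eventually (\<lambda>y. g y = (\<Sum>k\<in>I. a k y * z k y)) (nz S x))"

text \<open>The \<open>z k\<close> generate the full, hence radical, ideal of \<open>T\<close> in
  the local ring of \<open>S\<close> at \<open>x\<close>; \<open>ideal_at\<close> is membership in
  the ideal that they generate.\<close>

definition generates_at ::
    "'a::charted_space set \<Rightarrow> 'a set \<Rightarrow> 'a \<Rightarrow> 'k set \<Rightarrow> ('k \<Rightarrow> 'a \<Rightarrow> complex) \<Rightarrow> bool" where
  "generates_at S T x I z \<longleftrightarrow>
     (\<forall>k\<in>I. reg S x (z k) \<and> eventually (\<lambda>y. y \<in> T \<longrightarrow> z k y = 0) (nz S x)) \<and>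
     (\<forall>g. reg S x g \<longrightarrow> eventually (\<lambda>y. y \<in> T \<longrightarrow> g y = 0) (nz S x) \<longrightarrow> ideal_at S x I z g)"

lemma ideal_at_cong:
  assumes "ideal_at S x I z g" "eventually (\<lambda>y. f y = g y) (nz S x)"
  shows "ideal_at S x I z f"
proof -
  obtain a where a: "\<forall>k\<in>I. reg S x (a k)" "eventually (\<lambda>y. g y = (\<Sum>k\<in>I. a k y * z k y)) (nz S x)"
    using assms(1) unfolding ideal_at_def by blast
  from assms(2) a(2) have "eventually (\<lambda>y. f y = (\<Sum>k\<in>I. a k y * z k y)) (nz S x)"
    by eventually_elim simp
  with a(1) show ?thesis unfolding ideal_at_def by blast
qed

lemma ideal_at_zero: "ideal_at S x I z (\<lambda>_. 0)"
  unfolding ideal_at_def by (rule exI[of _ "\<lambda>_ _. 0"]) simp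

lemma ideal_at_add:
  assumes "ideal_at S x I z f" "ideal_at S x I z g"
  shows "ideal_at S x I z (\<lambda>y. f y + g y)"
proof -
  obtain a where a: "\<forall>k\<in>I. reg S x (a k)" "eventually (\<lambda>y. f y = (\<Sum>k\<in>I. a k y * z k y)) (nz S x)"
    using assms(1) unfolding ideal_at_def by blast
  obtain c where c: "\<forall>k\<in>I. reg S x (c k)" "eventually (\<lambda>y. g y = (\<Sum>k\<in>I. c k y * z k y)) (nz S x)"
    using assms(2) unfolding ideal_at_def by blast
  from a(2) c(2) have "eventually (\<lambda>y. f y + g y = (\<Sum>k\<in>I. (a k y + c k y) * z k y)) (nz S x)"
    by eventually_elim (simp add: sum.distrib algebra_simps)
  moreover have "\<forall>k\<in>I. reg S x (\<lambda>y. a k y + c k y)" using a c by (auto intro: reg_add)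
  ultimately show ?thesis unfolding ideal_at_def by (intro exI[of _ "\<lambda>k y. a k y + c k y"]) simp
qed

lemma ideal_at_mult:
  assumes "reg S x f" "ideal_at S x I z g"
  shows "ideal_at S x I z (\<lambda>y. f y * g y)"
proof -
  obtain c where c: "\<forall>k\<in>I. reg S x (c k)" "eventually (\<lambda>y. g y = (\<Sum>k\<in>I. c k y * z k y)) (nz S x)"
    using assms(2) unfolding ideal_at_def by blast
  from c(2) have "eventually (\<lambda>y. f y * g y = (\<Sum>k\<in>I. (f y * c k y) * z k y)) (nz S x)"
    by eventually_elim (simp add: sum_distrib_left mult.assoc)
  moreover have "\<forall>k\<in>I. reg S x (\<lambda>y. f y * c k y)" using c assms(1) by (auto intro: reg_mult)
  ultimately show ?thesis unfolding ideal_at_def by (intro exI[of _ "\<lambda>k y. f y * c k y"]) simp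
qed

lemma ideal_at_minus: "ideal_at S x I z g \<Longrightarrow> ideal_at S x I z (\<lambda>y. - g y)"
  using ideal_at_mult[OF reg_const[of S x "-1"]] by simp

lemma ideal_at_diff:
  "ideal_at S x I z f \<Longrightarrow> ideal_at S x I z g \<Longrightarrow> ideal_at S x I z (\<lambda>y. f y - g y)"
  using ideal_at_add[OF _ ideal_at_minus] by simp

lemma ideal_at_sum:
  "(\<And>i. i \<in> A \<Longrightarrow> ideal_at S x I z (f i)) \<Longrightarrow> ideal_at S x I z (\<lambda>y. \<Sum>i\<in>A. f i y)"
  by (induction A rule: infinite_finite_induct) (auto intro: ideal_at_add ideal_at_zero)

lemma ideal_at_generator:
  assumes "finite I" "k \<in> I"
  shows "ideal_at S x I z (z k)"
  unfolding ideal_at_def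
proof (intro exI[of _ "\<lambda>i _. if i = k then 1 else 0"] conjI ballI always_eventually allI)
  show "z k y = (\<Sum>i\<in>I. (if i = k then 1 else 0) * z i y)" for y
    using assms by (subst sum.remove[of I k]) auto
qed simp

lemma ideal_at_trans:
  assumes "ideal_at S x I z g" "\<And>k. k \<in> I \<Longrightarrow> ideal_at S x J w (z k)"
  shows "ideal_at S x J w g"
proof -
  obtain c where c: "\<forall>k\<in>I. reg S x (c k)" "eventually (\<lambda>y. g y = (\<Sum>k\<in>I. c k y * z k y)) (nz S x)"
    using assms(1) unfolding ideal_at_def by blast
  show ?thesis
    by (rule ideal_at_cong[OF ideal_at_sum c(2)]) (use c(1) assms(2) in \<open>auto intro: ideal_at_mult\<close>)
qed

lemma ideal_at_pullback:
  assumes "mor S x f" "x \<in> S" "eventually (\<lambda>y. f y \<in> T) (nz S x)" "ideal_at T (f x) I z g"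
  shows "ideal_at S x I (\<lambda>k y. z k (f y)) (\<lambda>y. g (f y))"
proof -
  obtain c where c: "\<forall>k\<in>I. reg T (f x) (c k)" "eventually (\<lambda>y. g y = (\<Sum>k\<in>I. c k y * z k y)) (nz T (f x))"
    using assms(4) unfolding ideal_at_def by blast
  have "eventually (\<lambda>y. g (f y) = (\<Sum>k\<in>I. c k (f y) * z k (f y))) (nz S x)"
    using mor_eventually[OF assms(1,2) c(2)] assms(3) by eventually_elim simp
  moreover have "\<forall>k\<in>I. reg S x (\<lambda>y. c k (f y))" using c(1) mor_reg[OF assms(1,2) _ assms(3)] by blast
  ultimately show ?thesis unfolding ideal_at_def by (intro exI[of _ "\<lambda>k y. c k (f y)"]) simp
qed

text \<open>The difference of the quotients is
  \<open>(q * (p' - p) - p * (q' - q)) / (q * q')\<close>. In this way congruences pass from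
  polynomials to regular germs.\<close>

lemma ideal_at_quotient_diff:
  assumes "ideal_at S x I z (\<lambda>y. p' y - p y)" "ideal_at S x I z (\<lambda>y. q' y - q y)"
    and "reg S x p" "reg S x q" "reg S x p'" "reg S x q'" "x \<in> S" "q x \<noteq> 0" "q' x \<noteq> 0"
  shows "ideal_at S x I z (\<lambda>y. p' y / q' y - p y / q y)"
proof -
  have "ideal_at S x I z (\<lambda>y. (1 / (q y * q' y)) * (q y * (p' y - p y) - p y * (q' y - q y)))"
    using assms by (intro ideal_at_mult[OF _ ideal_at_diff[OF ideal_at_mult ideal_at_mult]] reg_divide reg_mult reg_const) auto
  moreover have "eventually (\<lambda>y. p' y / q' y - p y / q y =
     (1 / (q y * q' y)) * (q y * (p' y - p y) - p y * (q' y - q y))) (nz S x)"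
    using reg_nonzero[OF assms(4,7,8)] reg_nonzero[OF assms(6,7,9)]
    by eventually_elim (simp add: field_simps)
  ultimately show ?thesis by (rule ideal_at_cong)
qed

text \<open>The points of \<open>S\<close> at which \<open>D\<close> is frequent form the closure of
  \<open>D\<close>, and the zeros of a regular function are closed.\<close>

lemma vanishes_on_closure:
  assumes "reg S x g" "eventually (\<lambda>y. D y \<longrightarrow> g y = 0) (nz S x)"
  shows "eventually (\<lambda>y. (\<exists>\<^sub>F u in nz S y. D u) \<longrightarrow> g y = 0) (nz S x)"
  using reg_eventually[OF assms(1)] eventually_nz_iterate[OF assms(2)] eventually_nz_self
proof eventually_elim
  case (elim y)
  show ?case
  proof (rule impI, rule ccontr)
    assume D: "\<exists>\<^sub>F u in nz S y. D u" and "g y \<noteq> 0"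
    then have "eventually (\<lambda>u. g u \<noteq> 0) (nz S y)" using elim by (intro reg_nonzero)
    with elim(2) have "eventually (\<lambda>u. \<not> D u) (nz S y)" by eventually_elim auto
    with D show False by (simp add: frequently_def)
  qed
qed

lemma vanishes_if_dense:
  assumes "reg S x g" "eventually (\<lambda>y. D y \<longrightarrow> g y = 0) (nz S x)" "\<And>y. y \<in> S \<Longrightarrow> \<exists>\<^sub>F u in nz S y. D u"
  shows "eventually (\<lambda>y. g y = 0) (nz S x)"
  using vanishes_on_closure[OF assms(1,2)] eventually_nz_self
  by eventually_elim (use assms(3) in auto)

text \<open>If \<open>\<rho>\<close> is the identity modulo the ideal of the \<open>z k\<close> and maps \<open>D\<close> into \<open>T\<close>, then every
  function vanishing on \<open>T\<close> lies in that ideal, being congruent to its pullback along \<open>\<rho>\<close>.\<close>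

lemma ideal_at_polynomial_diff:
  assumes "p \<in> polynomials \<Phi>" "\<And>\<phi>. \<phi> \<in> \<Phi> \<Longrightarrow> ideal_at S x I z (\<lambda>y. \<phi> (\<rho> y) - \<phi> y)"
    and "\<And>\<phi>. \<phi> \<in> \<Phi> \<Longrightarrow> reg S x \<phi>" "\<And>\<phi>. \<phi> \<in> \<Phi> \<Longrightarrow> reg S x (\<lambda>y. \<phi> (\<rho> y))"
  shows "ideal_at S x I z (\<lambda>y. p (\<rho> y) - p y)"
  using assms(1)
proof induction
  case (const c)
  then show ?case by (simp add: ideal_at_zero)
next
  case (coord \<phi>)
  then show ?case by (rule assms(2))
next
  case (add p q)
  have "ideal_at S x I z (\<lambda>y. (p (\<rho> y) - p y) + (q (\<rho> y) - q y))"
    using add by (intro ideal_at_add)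
  then show ?case by (rule ideal_at_cong) simp
next
  case (mult p q)
  have "reg S x (\<lambda>y. p (\<rho> y))" "reg S x q"
    using reg_polynomials[OF mult(1) assms(4)] reg_polynomials[OF mult(2), of S x "\<lambda>y. y"] assms(3) by auto
  then have "ideal_at S x I z (\<lambda>y. p (\<rho> y) * (q (\<rho> y) - q y) + q y * (p (\<rho> y) - p y))"
    using mult by (intro ideal_at_add ideal_at_mult)
  then show ?case by (rule ideal_at_cong) (simp add: algebra_simps)
qed

lemma ideal_at_retraction:
  assumes c: "(V, \<Phi>) \<in> charts" "x \<in> V" and S: "x \<in> S" and \<rho>: "mor S x \<rho>" "\<rho> x = x"
    and I: "\<And>\<phi>. \<phi> \<in> \<Phi> \<Longrightarrow> ideal_at S x I z (\<lambda>y. \<phi> (\<rho> y) - \<phi> y)"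
  shows "p \<in> polynomials \<Phi> \<Longrightarrow> ideal_at S x I z (\<lambda>y. p (\<rho> y) - p y)"
    and "reg S x g \<Longrightarrow> eventually (\<lambda>y. \<rho> y \<in> S) (nz S x) \<Longrightarrow> ideal_at S x I z (\<lambda>y. g (\<rho> y) - g y)"
    and "reg S x g \<Longrightarrow> eventually (\<lambda>y. y \<in> T \<longrightarrow> g y = 0) (nz S x) \<Longrightarrow>
      (\<And>y. y \<in> S \<Longrightarrow> \<exists>\<^sub>F u in nz S y. D u) \<Longrightarrow>
      eventually (\<lambda>y. D y \<longrightarrow> \<rho> y \<in> S \<inter> T) (nz S x) \<Longrightarrow> ideal_at S x I z g"
proof -
  have r: "reg S x p" "reg S x (\<lambda>y. p (\<rho> y))" if "p \<in> polynomials \<Phi>" for p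
    using reg_polynomial[OF c that] reg_polynomials[OF that mor_chart(2)[OF \<rho>(1) S c(1)]] c(2) \<rho>(2) by auto
  show P: "ideal_at S x I z (\<lambda>y. p (\<rho> y) - p y)" if "p \<in> polynomials \<Phi>" for p
    by (rule ideal_at_polynomial_diff[OF that I]) (use r polynomials.coord in blast)+
  {
    assume g: "reg S x g"
    then obtain p q where pq: "p \<in> polynomials \<Phi>" "q \<in> polynomials \<Phi>" "q x \<noteq> 0"
      and ev: "eventually (\<lambda>y. q y \<noteq> 0 \<and> g y = p y / q y) (nz S x)"
      unfolding reg_chart[OF c] by blast
    have ev\<rho>: "eventually (\<lambda>y. \<rho> y \<in> S \<longrightarrow> q (\<rho> y) \<noteq> 0 \<and> g (\<rho> y) = p (\<rho> y) / q (\<rho> y)) (nz S x)"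
      using mor_eventually[OF \<rho>(1) S, of _ S] ev \<rho>(2) by simp
    show "ideal_at S x I z (\<lambda>y. g (\<rho> y) - g y)" if "eventually (\<lambda>y. \<rho> y \<in> S) (nz S x)"
    proof (rule ideal_at_cong)
      show "ideal_at S x I z (\<lambda>y. p (\<rho> y) / q (\<rho> y) - p y / q y)"
        by (rule ideal_at_quotient_diff) (use P pq r S \<rho> in auto)
      show "eventually (\<lambda>y. g (\<rho> y) - g y = p (\<rho> y) / q (\<rho> y) - p y / q y) (nz S x)"
        using ev ev\<rho> that by eventually_elim auto
    qed
    assume T: "eventually (\<lambda>y. y \<in> T \<longrightarrow> g y = 0) (nz S x)"
      and D: "\<And>y. y \<in> S \<Longrightarrow> \<exists>\<^sub>F u in nz S y. D u" "eventually (\<lambda>y. D y \<longrightarrow> \<rho> y \<in> S \<inter> T) (nz S x)"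
    \<comment> \<open>Off \<open>D\<close> the image \<open>\<rho> y\<close> may leave
      \<open>S\<close>, where nothing is known about \<open>g\<close>. Its numerator
      \<open>p\<close> is a polynomial of the chart and can be followed there; it vanishes along
      \<open>\<rho>\<close> on the dense set \<open>D\<close>, hence near \<open>x\<close>.\<close>
    have "eventually (\<lambda>y. \<rho> y \<in> S \<longrightarrow> \<rho> y \<in> T \<longrightarrow> g (\<rho> y) = 0) (nz S x)"
      using mor_eventually[OF \<rho>(1) S, of _ S] T \<rho>(2) by simp
    with ev\<rho> D(2) have "eventually (\<lambda>y. D y \<longrightarrow> p (\<rho> y) = 0) (nz S x)"
      by eventually_elim auto
    then have p0: "eventually (\<lambda>y. p (\<rho> y) = 0) (nz S x)"
      by (rule vanishes_if_dense[OF r(2)[OF pq(1)] _ D(1)])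
    have "ideal_at S x I z (\<lambda>y. (- 1 / q y) * (p (\<rho> y) - p y))"
      using P[OF pq(1)] r(1)[OF pq(2)] pq(3) S by (intro ideal_at_mult reg_divide) auto
    moreover from ev p0 have "eventually (\<lambda>y. g y = (- 1 / q y) * (p (\<rho> y) - p y)) (nz S x)"
      by eventually_elim auto
    ultimately show "ideal_at S x I z g" by (rule ideal_at_cong)
  }
qed

section \<open>Local structure of blow-ups\<close>

lemma in_zariski_closure_iff:
  assumes "G \<subseteq> S"
  shows "y \<in> zariski_on S closure_of G \<longleftrightarrow> y \<in> S \<and> (\<exists>\<^sub>F u in nz S y. u \<in> G)"
proof -
  have "(\<exists>\<^sub>F u in nz S y. u \<in> G) \<longleftrightarrow> (\<forall>W. openin zariski W \<and> y \<in> W \<longrightarrow> (\<exists>u\<in>W \<inter> S. u \<in> G))"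
    unfolding frequently_def eventually_nz by blast
  then show ?thesis unfolding in_closure_of openin_subtopology using assms by auto
qed

lemma eventually_fst:
  assumes "eventually P (nz X (fst b))" "b \<in> B" "fst ` B \<subseteq> X"
  shows "eventually (\<lambda>y. P (fst y)) (nz B b)"
  using mor_eventually[OF mor_fst_id assms(2,1)] eventually_nz_self[of B b]
  by eventually_elim (use assms(3) in auto)

lemma reg_fst:
  assumes "reg X (fst b) g" "b \<in> B" "fst ` B \<subseteq> X"
  shows "reg B b (\<lambda>y. g (fst y))"
  by (rule mor_reg[OF mor_fst_id assms(2,1)]) (rule eventually_mono[OF eventually_nz_self], use assms(3) in auto)

lemma ideal_at_fst:
  assumes "ideal_at X (fst b) I z g" "b \<in> B" "fst ` B \<subseteq> X"
  shows "ideal_at B b I (\<lambda>k y. z k (fst y)) (\<lambda>y. g (fst y))"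
  by (rule ideal_at_pullback[OF mor_fst_id assms(2) _ assms(1)]) (rule eventually_mono[OF eventually_nz_self], use assms(3) in auto)

lemma eq_abs_proj_if_proportional:
  assumes "coord_nonzero j P" "\<And>i. c i = coord_ratio i j P * c j" "c k \<noteq> 0"
  shows "P = abs_proj (\<chi> i. c i)"
proof -
  obtain v where v: "v \<noteq> 0" "P = abs_proj v" using proj_cases by blast
  have vj: "v $ j \<noteq> 0" using assms(1) v by (simp add: coord_nonzero_abs_proj)
  have c: "c i = v $ i / v $ j * c j" for i using assms(2)[of i] v by (simp add: coord_ratio_abs_proj)
  have "c j \<noteq> 0" using c[of k] assms(3) by auto
  moreover have "(\<chi> i. c i) = (c j / v $ j) *s v" using vj c by (auto simp: vec_eq_iff field_simps)
  moreover have "(\<chi> i. c i) \<noteq> 0" using assms(3) by (auto simp: vec_eq_iff)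
  ultimately show ?thesis unfolding v(2) using v(1) vj by (subst abs_proj_eq_iff) auto
qed

lemma blow_up_fst: "is_blow_up X Z B \<Longrightarrow> fst ` B \<subseteq> X"
  by (simp add: is_blow_up_def)

lemma blow_up_center_closed:
  assumes "is_blow_up X Z B" "x \<in> X" "x \<notin> Z"
  shows "eventually (\<lambda>u. u \<notin> Z) (nz X x)"
proof -
  have "closedin (zariski_on X) Z" using assms(1) by (simp add: is_blow_up_def)
  then have "openin (zariski_on X) (X - Z)" by (simp add: closedin_def)
  then have "eventually (\<lambda>u. u \<in> X - Z) (nz X x)" using assms unfolding openin_zariski_on_iff by blast
  then show ?thesis by eventually_elim simp
qed

lemma generates_ideal_sheaf_at:
  assumes U: "openin (zariski_on X) U" "u \<in> U" and gen: "generates_ideal_sheaf U Z f"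
  shows "generates_at X Z u UNIV f"
proof -
  have UX: "U \<subseteq> X" using U(1) by (rule openin_zariski_on_subset)
  have nzU: "nz U v = nz X v" if "v \<in> U" for v using U(1) that by (rule openin_zariski_on_nz)
  have evU: "eventually (\<lambda>y. y \<in> U) (nz X u)" using U unfolding openin_zariski_on_iff by blast
  show ?thesis unfolding generates_at_def
  proof (intro conjI ballI allI impI)
    fix i
    have "reg U u (f i)" using gen U(2) unfolding generates_ideal_sheaf_def regular_on_iff_reg by blast
    then show "reg X u (f i)" unfolding reg_def nzU[OF U(2)] .
    show "eventually (\<lambda>y. y \<in> Z \<longrightarrow> f i y = 0) (nz X u)"
      using evU by eventually_elim (use gen in \<open>auto simp: generates_ideal_sheaf_def\<close>)
  next
    fix g assume g: "reg X u g" "eventually (\<lambda>y. y \<in> Z \<longrightarrow> g y = 0) (nz X u)"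
    \<comment> \<open>The properties of the germ \<open>g\<close> are spread over an open set
      \<open>W\<close>, since \<open>generates_ideal_sheaf\<close> speaks of functions on open
      sets.\<close>
    have "eventually (\<lambda>y. y \<in> U \<and> reg X y g \<and> (y \<in> Z \<longrightarrow> g y = 0)) (nz X u)"
      using evU reg_eventually[OF g(1)] g(2) by eventually_elim simp
    then obtain W where W: "openin (zariski_on X) W" "u \<in> W" "\<And>y. y \<in> W \<Longrightarrow> y \<in> U \<and> reg X y g \<and> (y \<in> Z \<longrightarrow> g y = 0)"
      using U(2) UX by (auto elim: eventually_nz_open)
    have "openin (zariski_on U) W"
      using W nzU unfolding openin_zariski_on_iff by (metis subsetI)
    moreover have "regular_on W g" unfolding regular_on_iff_reg
      using W UX by (blast intro: reg_subset)
    moreover have "\<forall>x\<in>W \<inter> Z. g x = 0" using W by blast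
    ultimately obtain W' a where a: "openin (zariski_on W) W'" "u \<in> W'" "\<forall>i. regular_on W' (a i)"
      "\<forall>y\<in>W'. g y = (\<Sum>i\<in>UNIV. a i y * f i y)"
      using gen[unfolded generates_ideal_sheaf_def, THEN conjunct2, rule_format, of W g u] W(2) by blast
    have e: "nz W' u = nz X u"
      using openin_zariski_on_nz[OF a(1,2)] openin_zariski_on_nz[OF W(1,2)] by simp
    have "reg W' u (a i)" for i
      using a(2,3) unfolding regular_on_iff_reg by blast
    then have "reg X u (a i)" for i unfolding reg_def e .
    moreover have "eventually (\<lambda>y. g y = (\<Sum>i\<in>UNIV. a i y * f i y)) (nz X u)"
      unfolding e[symmetric] by (rule eventually_mono[OF eventually_nz_self]) (use a(4) in blast)
    ultimately show "ideal_at X u UNIV f g" unfolding ideal_at_def by blast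
  qed
qed

text \<open>The description of a blow-up used from here on, at one point and without its open cover:
  the generators are proportional to the second component, graph points off the centre accumulate at
  \<open>b\<close>, and the graph over nearby points off the centre belongs to
  \<open>B\<close>.\<close>

lemma blow_up_local:
  fixes B :: "('a::charted_space \<times> 'r::finite proj) set"
  assumes bu: "is_blow_up X Z B" and b: "b \<in> B"
  obtains f :: "'r \<Rightarrow> 'a \<Rightarrow> complex" where
    "generates_at X Z (fst b) UNIV f"
    "eventually (\<lambda>y. \<forall>i j. coord_nonzero j (snd y) \<longrightarrow>
       f i (fst y) = coord_ratio i j (snd y) * f j (fst y)) (nz B b)"
    "\<exists>\<^sub>F y in nz B b. fst y \<notin> Z \<and> (\<exists>i. f i (fst y) \<noteq> 0) \<and> snd y = abs_proj (\<chi> i. f i (fst y))"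
    "eventually (\<lambda>u. u \<notin> Z \<longrightarrow> (\<exists>i. f i u \<noteq> 0) \<and> (u, abs_proj (\<chi> i. f i u)) \<in> B) (nz X (fst b))"
proof -
  have x: "fst b \<in> X" using blow_up_fst[OF bu] b by auto
  then obtain U and f :: "'r \<Rightarrow> 'a \<Rightarrow> complex" where U: "openin (zariski_on X) U" "fst b \<in> U"
    and gen: "generates_ideal_sheaf U Z f"
    and cl: "{b \<in> B. fst b \<in> U} =
          zariski_on (U \<times> UNIV) closure_of {(u, abs_proj (\<chi> i. f i u)) | u. u \<in> U - Z}"
    using bu unfolding is_blow_up_def by blast
  define G where "G = {(u, abs_proj (\<chi> i. f i u)) | u. u \<in> U - Z}"
  have GU: "G \<subseteq> U \<times> UNIV" unfolding G_def by auto
  have cl': "y \<in> B \<and> fst y \<in> U \<longleftrightarrow> y \<in> U \<times> UNIV \<and> (\<exists>\<^sub>F u in nz (U \<times> UNIV) y. u \<in> G)" for y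
    using cl in_zariski_closure_iff[OF GU, of y] unfolding G_def by auto
  have GB: "G \<subseteq> B"
    using closure_of_subset[of G "zariski_on (U \<times> UNIV)"] GU cl unfolding G_def by auto
  note at = generates_ideal_sheaf_at[OF U(1) _ gen]
  have UX: "U \<subseteq> X" using U(1) by (rule openin_zariski_on_subset)
  have evU: "eventually (\<lambda>y. y \<in> U) (nz X (fst b))" using U unfolding openin_zariski_on_iff by blast
  \<comment> \<open>Near \<open>u\<close> there are no points of \<open>Z\<close>, so the constant 1
    vanishes on \<open>Z\<close> there and is a combination of the \<open>f i\<close>, which thus
    have no common zero.\<close>
  have ne: "\<exists>i. f i u \<noteq> 0" if u: "u \<in> U" "u \<notin> Z" for u
  proof (rule ccontr)
    assume 0: "\<not> ?thesis"
    have "eventually (\<lambda>y. y \<in> Z \<longrightarrow> (1::complex) = 0) (nz X u)"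
      using blow_up_center_closed[OF bu _ u(2)] u(1) UX by (auto elim!: eventually_mono)
    then have "ideal_at X u UNIV f (\<lambda>_. 1)" using at[OF u(1)] unfolding generates_at_def by simp
    then obtain a where "eventually (\<lambda>y. (1::complex) = (\<Sum>k\<in>UNIV. a k y * f k y)) (nz X u)"
      unfolding ideal_at_def by blast
    then have "(1::complex) = (\<Sum>k\<in>UNIV. a k u * f k u)" using u(1) UX by (auto dest: eventually_nz_at)
    with 0 show False by simp
  qed
  show ?thesis
  proof
    show "generates_at X Z (fst b) UNIV f" using at U(2) .
    have "eventually (\<lambda>y. fst y \<in> U \<and> y \<in> B) (nz B b)"
      using eventually_fst[OF evU b blow_up_fst[OF bu]] eventually_nz_self by eventually_elim simp
    then show "eventually (\<lambda>y. \<forall>i j. coord_nonzero j (snd y) \<longrightarrow>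
       f i (fst y) = coord_ratio i j (snd y) * f j (fst y)) (nz B b)"
    proof (rule eventually_mono, intro allI impI)
      fix y i j assume y: "fst y \<in> U \<and> y \<in> B" and j: "coord_nonzero j (snd y)"
      then have yU: "y \<in> U \<times> UNIV" and fr: "\<exists>\<^sub>F u in nz (U \<times> UNIV) y. u \<in> G"
        using cl'[of y] by simp_all
      \<comment> \<open>The proportionality holds on the graph and, being an equation between
        regular functions, on its closure.\<close>
      define D where "D y = f i (fst y) - coord_ratio i j (snd y) * f j (fst y)" for y
      have reg_f: "reg (U \<times> UNIV) y (\<lambda>y. f i (fst y))" for i
        using at[of "fst y"] y by (intro reg_fst[of U] reg_subset[OF _ UX]) (auto simp: generates_at_def yU)
      note sn = reg_coord_ratio[OF mor_snd_id yU j]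
      have "reg (U \<times> UNIV) y D" unfolding D_def by (intro reg_diff reg_mult reg_f sn(1))
      moreover have "eventually (\<lambda>u. u \<in> G \<longrightarrow> D u = 0) (nz (U \<times> UNIV) y)"
        using sn(2)
      proof eventually_elim
        case (elim u)
        show ?case
        proof
          assume "u \<in> G"
          then obtain u' where u: "u = (u', abs_proj (\<chi> i. f i u'))" "u' \<in> U" "u' \<notin> Z" unfolding G_def by blast
          have "(\<chi> i. f i u') \<noteq> 0" using ne[OF u(2,3)] by (auto simp: vec_eq_iff)
          then show "D u = 0" using elim u(1) by (simp add: D_def coord_ratio_abs_proj coord_nonzero_abs_proj)
        qed
      qed
      ultimately have "eventually (\<lambda>y. (\<exists>\<^sub>F u in nz (U \<times> UNIV) y. u \<in> G) \<longrightarrow> D y = 0) (nz (U \<times> UNIV) y)"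
        by (rule vanishes_on_closure)
      then have "D y = 0" using fr yU by (auto dest: eventually_nz_at)
      then show "f i (fst y) = coord_ratio i j (snd y) * f j (fst y)" by (simp add: D_def)
    qed
    have "\<exists>\<^sub>F u in nz (U \<times> UNIV) b. u \<in> G" using cl' b U(2) by blast
    then have "\<exists>\<^sub>F u in nz B b. u \<in> G"
      unfolding frequently_def eventually_nz using GU GB by blast
    then show "\<exists>\<^sub>F y in nz B b. fst y \<notin> Z \<and> (\<exists>i. f i (fst y) \<noteq> 0) \<and> snd y = abs_proj (\<chi> i. f i (fst y))"
      by (rule frequently_elim1) (use ne in \<open>auto simp: G_def\<close>)
    show "eventually (\<lambda>u. u \<notin> Z \<longrightarrow> (\<exists>i. f i u \<noteq> 0) \<and> (u, abs_proj (\<chi> i. f i u)) \<in> B) (nz X (fst b))"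
      using evU by eventually_elim (use ne GB in \<open>auto simp: G_def\<close>)
  qed
qed

lemma reg_not_frequently_zero:
  assumes "reg S x g" "x \<in> S" "\<exists>\<^sub>F y in nz S x. g y = 0"
  shows "g x = 0"
  using reg_nonzero[OF assms(1,2)] assms(3) unfolding frequently_def by auto

text \<open>Both \<open>f\<close> and \<open>z\<close> generate the ideal of the centre. If the
  projective coordinate \<open>j\<close> is nonzero at \<open>b\<close>, then \<open>f j\<close>
  divides every \<open>f i\<close> on the blow-up, so \<open>z k = f j * G k\<close>, while
  \<open>f j\<close> is a combination of the \<open>z k\<close>. Cancelling \<open>f j\<close> shows
  that the \<open>G k\<close> have no common zero at \<open>b\<close>, and a \<open>z k0\<close>
  with \<open>G k0\<close> nonzero can replace \<open>f j\<close> as generator.\<close>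

lemma blow_up_principal:
  fixes B :: "('a::charted_space \<times> 'r::finite proj) set"
  assumes bu: "is_blow_up X Z B" and b: "b \<in> B" and gz: "generates_at X Z (fst b) I z" and I: "finite I"
  obtains k0 r where "k0 \<in> I" "r k0 = (\<lambda>_. 1)" "\<forall>k\<in>I. reg B b (r k)"
    "eventually (\<lambda>y. \<forall>k\<in>I. z k (fst y) = z k0 (fst y) * r k y) (nz B b)"
proof -
  note BX = blow_up_fst[OF bu]
  obtain f :: "'r \<Rightarrow> 'a \<Rightarrow> complex" where gf: "generates_at X Z (fst b) UNIV f"
    and rel: "eventually (\<lambda>y. \<forall>i j. coord_nonzero j (snd y) \<longrightarrow>
       f i (fst y) = coord_ratio i j (snd y) * f j (fst y)) (nz B b)"
    and fr: "\<exists>\<^sub>F y in nz B b. fst y \<notin> Z \<and> (\<exists>i. f i (fst y) \<noteq> 0) \<and> snd y = abs_proj (\<chi> i. f i (fst y))"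
    and gr: "eventually (\<lambda>u. u \<notin> Z \<longrightarrow> (\<exists>i. f i u \<noteq> 0) \<and> (u, abs_proj (\<chi> i. f i u)) \<in> B) (nz X (fst b))"
    by (rule blow_up_local[OF bu b])
  obtain j where j: "coord_nonzero j (snd b)" using coord_nonzero_exists by blast
  note sn = reg_coord_ratio[OF mor_snd_id b j]
  have rel': "eventually (\<lambda>y. \<forall>i. f i (fst y) = coord_ratio i j (snd y) * f j (fst y)) (nz B b)"
    using rel sn(2) by eventually_elim blast
  have regf: "reg B b (\<lambda>y. f i (fst y))" for i
    using gf by (intro reg_fst[OF _ b BX]) (simp add: generates_at_def)
  have "\<forall>k\<in>I. ideal_at X (fst b) UNIV f (z k)" using gz gf unfolding generates_at_def by blast
  then have "\<forall>k\<in>I. ideal_at B b UNIV (\<lambda>k y. f k (fst y)) (\<lambda>y. z k (fst y))"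
    using ideal_at_fst[OF _ b BX] by blast
  then have "\<forall>k\<in>I. \<exists>c. (\<forall>i. reg B b (c i)) \<and> eventually (\<lambda>y. z k (fst y) = (\<Sum>i\<in>UNIV. c i y * f i (fst y))) (nz B b)"
    unfolding ideal_at_def by simp
  then obtain c where c: "\<And>k i. k \<in> I \<Longrightarrow> reg B b (c k i)"
    "\<And>k. k \<in> I \<Longrightarrow> eventually (\<lambda>y. z k (fst y) = (\<Sum>i\<in>UNIV. c k i y * f i (fst y))) (nz B b)"
    by (auto simp: bchoice_iff)
  define G where "G k y = (\<Sum>i\<in>UNIV. c k i y * coord_ratio i j (snd y))" for k y
  have regG: "reg B b (G k)" if "k \<in> I" for k
    unfolding G_def by (intro reg_sum reg_mult c that sn(1))
  have zG: "eventually (\<lambda>y. z k (fst y) = f j (fst y) * G k y) (nz B b)" if "k \<in> I" for k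
    using c(2)[OF that] rel'
  proof eventually_elim
    case (elim y)
    have "z k (fst y) = (\<Sum>i\<in>UNIV. c k i y * (coord_ratio i j (snd y) * f j (fst y)))"
      unfolding elim(1) using elim(2) by (intro sum.cong refl arg_cong2[where f = "(*)"]) blast
    then show ?case by (simp add: G_def sum_distrib_left mult_ac)
  qed
  have zG': "eventually (\<lambda>y. \<forall>k\<in>I. z k (fst y) = f j (fst y) * G k y) (nz B b)"
    using zG I by (simp add: eventually_ball_finite_distrib)
  have "ideal_at X (fst b) I z (f j)" using gz gf unfolding generates_at_def by simp
  then obtain a where a: "\<forall>k\<in>I. reg B b (a k)" "eventually (\<lambda>y. f j (fst y) = (\<Sum>k\<in>I. a k y * z k (fst y))) (nz B b)"
    using ideal_at_fst[OF _ b BX, of I z "f j"] unfolding ideal_at_def by auto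
  define H where "H y = (\<Sum>k\<in>I. a k y * G k y) - 1" for y
  have regH: "reg B b H" unfolding H_def using a(1) regG by (intro reg_diff reg_sum reg_mult reg_const) auto
  have "eventually (\<lambda>y. f j (fst y) * H y = 0) (nz B b)"
    using a(2) zG'
  proof eventually_elim
    case (elim y)
    have "f j (fst y) = (\<Sum>k\<in>I. a k y * (f j (fst y) * G k y))"
      using elim by (subst elim(1)) (auto intro!: sum.cong)
    then show ?case by (simp add: H_def algebra_simps sum_distrib_left)
  qed
  \<comment> \<open>The cancellation is carried out at graph points: where some \<open>f i\<close>
    is nonzero, so is \<open>f j\<close>. As these points accumulate at \<open>b\<close> and
    \<open>H\<close> is regular, \<open>H b = 0\<close> follows.\<close>
  with rel' have "eventually (\<lambda>y. (\<exists>i. f i (fst y) \<noteq> 0) \<longrightarrow> H y = 0) (nz B b)"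
    by eventually_elim (metis mult_eq_0_iff)
  moreover from fr have "\<exists>\<^sub>F y in nz B b. \<exists>i. f i (fst y) \<noteq> 0" by (rule frequently_elim1) blast
  ultimately have "\<exists>\<^sub>F y in nz B b. H y = 0"
    by (rule frequently_mp[where P = "\<lambda>y. \<exists>i. f i (fst y) \<noteq> 0"])
  with regH b have "H b = 0" by (rule reg_not_frequently_zero)
  have "\<exists>k0\<in>I. G k0 b \<noteq> 0"
  proof (rule ccontr)
    assume "\<not> ?thesis"
    then have "H b = - 1" by (simp add: H_def)
    with \<open>H b = 0\<close> show False by simp
  qed
  then obtain k0 where k0: "k0 \<in> I" "G k0 b \<noteq> 0" by blast
  define r where "r = (\<lambda>k y. G k y / G k0 y)(k0 := \<lambda>_. 1)"
  have nzG: "eventually (\<lambda>y. G k0 y \<noteq> 0) (nz B b)" using regG k0 b by (intro reg_nonzero)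
  show ?thesis
  proof
    show "k0 \<in> I" "r k0 = (\<lambda>_. 1)" using k0 by (simp_all add: r_def)
    show "\<forall>k\<in>I. reg B b (r k)"
      using regG regG[OF k0(1)] b k0(2) by (auto simp: r_def intro: reg_divide)
    show "eventually (\<lambda>y. \<forall>k\<in>I. z k (fst y) = z k0 (fst y) * r k y) (nz B b)"
      using zG' nzG by eventually_elim (use k0 in \<open>auto simp: r_def\<close>)
  qed
qed

text \<open>Preimages of dense sets need an argument, because \<open>b\<close> may lie over the
  centre. Near \<open>b\<close> there is a graph point \<open>y\<close> off the centre, and there
  \<open>\<sigma>\<close> is a local section of the blow-down through \<open>y\<close>. If
  \<open>D\<close> were absent near \<open>b\<close>, it would be absent near \<open>y\<close> and,
  by the section, near \<open>fst y\<close>.\<close>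

lemma blow_up_dense:
  fixes B :: "('a::charted_space \<times> 'r::finite proj) set"
  assumes bu: "is_blow_up X Z B" and D: "\<And>x. x \<in> X \<Longrightarrow> \<exists>\<^sub>F u in nz X x. D u" and b: "b \<in> B"
  shows "\<exists>\<^sub>F y in nz B b. D (fst y)"
proof (rule ccontr)
  note BX = blow_up_fst[OF bu]
  assume "\<not> ?thesis"
  then have nD: "eventually (\<lambda>y. \<not> D (fst y)) (nz B b)" by (simp add: frequently_def)
  obtain f :: "'r \<Rightarrow> 'a \<Rightarrow> complex" where gf: "generates_at X Z (fst b) UNIV f"
    and rel: "eventually (\<lambda>y. \<forall>i j. coord_nonzero j (snd y) \<longrightarrow>
       f i (fst y) = coord_ratio i j (snd y) * f j (fst y)) (nz B b)"
    and fr: "\<exists>\<^sub>F y in nz B b. fst y \<notin> Z \<and> (\<exists>i. f i (fst y) \<noteq> 0) \<and> snd y = abs_proj (\<chi> i. f i (fst y))"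
    and gr: "eventually (\<lambda>u. u \<notin> Z \<longrightarrow> (\<exists>i. f i u \<noteq> 0) \<and> (u, abs_proj (\<chi> i. f i u)) \<in> B) (nz X (fst b))"
    by (rule blow_up_local[OF bu b])
  have "\<forall>i. eventually (\<lambda>u. reg X u (f i)) (nz X (fst b))"
    using gf unfolding generates_at_def by (auto intro: reg_eventually)
  then have "eventually (\<lambda>u. \<forall>i. reg X u (f i)) (nz X (fst b))" by (simp add: eventually_all_finite)
  from eventually_fst[OF this b BX] eventually_fst[OF eventually_nz_iterate[OF gr] b BX]
    eventually_nz_iterate[OF nD] eventually_nz_self
  have "eventually (\<lambda>y. (\<forall>i. reg X (fst y) (f i)) \<and>
     eventually (\<lambda>u. u \<notin> Z \<longrightarrow> (\<exists>i. f i u \<noteq> 0) \<and> (u, abs_proj (\<chi> i. f i u)) \<in> B) (nz X (fst y)) \<and>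
     eventually (\<lambda>y. \<not> D (fst y)) (nz B y) \<and> y \<in> B) (nz B b)"
    by eventually_elim simp
  with fr have "\<exists>\<^sub>F y in nz B b. (fst y \<notin> Z \<and> (\<exists>i. f i (fst y) \<noteq> 0) \<and> snd y = abs_proj (\<chi> i. f i (fst y))) \<and>
    (\<forall>i. reg X (fst y) (f i)) \<and>
     eventually (\<lambda>u. u \<notin> Z \<longrightarrow> (\<exists>i. f i u \<noteq> 0) \<and> (u, abs_proj (\<chi> i. f i u)) \<in> B) (nz X (fst y)) \<and>
     eventually (\<lambda>y. \<not> D (fst y)) (nz B y) \<and> y \<in> B"
    by (rule frequently_eventually_frequently)
  then obtain y where y: "fst y \<notin> Z" "\<exists>i. f i (fst y) \<noteq> 0" "snd y = abs_proj (\<chi> i. f i (fst y))"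
    "\<And>i. reg X (fst y) (f i)"
    "eventually (\<lambda>u. u \<notin> Z \<longrightarrow> (\<exists>i. f i u \<noteq> 0) \<and> (u, abs_proj (\<chi> i. f i u)) \<in> B) (nz X (fst y))"
    "eventually (\<lambda>y. \<not> D (fst y)) (nz B y)" "y \<in> B"
    by (auto dest!: frequently_ex)
  define \<sigma> where "\<sigma> u = (u, abs_proj (\<chi> i. f i u))" for u
  have yX: "fst y \<in> X" using y(7) BX by auto
  have \<sigma>y: "\<sigma> (fst y) = y" using y(3) by (simp add: \<sigma>_def prod_eq_iff)
  obtain j where j: "f j (fst y) \<noteq> 0" using y(2) by blast
  have "mor X (fst y) \<sigma>" unfolding \<sigma>_def using y(4) yX j by (intro mor_Pair mor_id mor_abs_proj)
  from mor_eventually[OF this yX, of _ B] y(6) \<sigma>y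
  have "eventually (\<lambda>u. \<sigma> u \<in> B \<longrightarrow> \<not> D (fst (\<sigma> u))) (nz X (fst y))" by simp
  with y(5) blow_up_center_closed[OF bu yX y(1)] have "eventually (\<lambda>u. \<not> D u) (nz X (fst y))"
    by eventually_elim (auto simp: \<sigma>_def)
  with D[OF yX] show False by (simp add: frequently_def)
qed

section \<open>Proper transforms and their ideals\<close>

lemma proper_transform_iff:
  fixes B :: "('a::charted_space \<times> 'r::finite proj) set"
  shows "b \<in> proper_transform Z B Y \<longleftrightarrow> b \<in> B \<and> (\<exists>\<^sub>F y in nz B b. fst y \<in> Y - Z)"
proof -
  have "(\<exists>\<^sub>F y in nz B b. y \<in> {b \<in> B. fst b \<in> Y - Z}) \<longleftrightarrow> (\<exists>\<^sub>F y in nz B b. fst y \<in> Y - Z)"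
    unfolding frequently_def eventually_nz by blast
  then show ?thesis unfolding proper_transform_def by (subst in_zariski_closure_iff) auto
qed

lemma proper_transform_I:
  fixes B :: "('a::charted_space \<times> 'r::finite proj) set"
  shows "b \<in> B \<Longrightarrow> fst b \<in> Y \<Longrightarrow> fst b \<notin> Z \<Longrightarrow> b \<in> proper_transform Z B Y"
  unfolding proper_transform_iff frequently_def using eventually_nz_at[of _ B b] by blast

lemma vanishes_on_proper_transform:
  fixes B :: "('a::charted_space \<times> 'r::finite proj) set"
  assumes "reg B b g" "eventually (\<lambda>y. fst y \<in> Y \<longrightarrow> fst y \<notin> Z \<longrightarrow> g y = 0) (nz B b)"
  shows "eventually (\<lambda>y. y \<in> proper_transform Z B Y \<longrightarrow> g y = 0) (nz B b)"
proof -
  have "eventually (\<lambda>y. (\<exists>\<^sub>F u in nz B y. fst u \<in> Y - Z) \<longrightarrow> g y = 0) (nz B b)"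
    by (rule vanishes_on_closure[OF assms(1)]) (use assms(2) in \<open>auto elim!: eventually_mono\<close>)
  then show ?thesis by eventually_elim (simp add: proper_transform_iff)
qed

text \<open>Away from the centre the blow-down has the local inverse \<open>\<lambda>u. (u, [f u])\<close>.\<close>

lemma generates_at_proper_transform_away:
  fixes B :: "('a::charted_space \<times> 'r::finite proj) set"
  assumes bu: "is_blow_up X Z B" and b: "b \<in> B" and bZ: "fst b \<notin> Z" and gz: "generates_at X Y (fst b) I z"
  shows "generates_at B (proper_transform Z B Y) b I (\<lambda>k y. z k (fst y))"
proof -
  note BX = blow_up_fst[OF bu]
  have x: "fst b \<in> X" using b BX by auto
  obtain f :: "'r \<Rightarrow> 'a \<Rightarrow> complex" where gf: "generates_at X Z (fst b) UNIV f"
    and rel: "eventually (\<lambda>y. \<forall>i j. coord_nonzero j (snd y) \<longrightarrow>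
       f i (fst y) = coord_ratio i j (snd y) * f j (fst y)) (nz B b)"
    and fr: "\<exists>\<^sub>F y in nz B b. fst y \<notin> Z \<and> (\<exists>i. f i (fst y) \<noteq> 0) \<and> snd y = abs_proj (\<chi> i. f i (fst y))"
    and gr: "eventually (\<lambda>u. u \<notin> Z \<longrightarrow> (\<exists>i. f i u \<noteq> 0) \<and> (u, abs_proj (\<chi> i. f i u)) \<in> B) (nz X (fst b))"
    by (rule blow_up_local[OF bu b])
  define \<sigma> where "\<sigma> u = (u, abs_proj (\<chi> i. f i u))" for u
  have nZ: "eventually (\<lambda>u. u \<notin> Z) (nz X (fst b))" using bu x bZ by (rule blow_up_center_closed)
  have \<sigma>B: "eventually (\<lambda>u. \<sigma> u \<in> B) (nz X (fst b))"
    using gr nZ by eventually_elim (auto simp: \<sigma>_def)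
  have ev: "eventually (\<lambda>y. y = \<sigma> (fst y)) (nz B b)"
    using rel eventually_fst[OF gr b BX] eventually_fst[OF nZ b BX]
  proof eventually_elim
    case (elim y)
    obtain j where "coord_nonzero j (snd y)" using coord_nonzero_exists by blast
    moreover obtain k where "f k (fst y) \<noteq> 0" using elim by blast
    ultimately have "snd y = abs_proj (\<chi> i. f i (fst y))"
      using elim(1) eq_abs_proj_if_proportional[of j "snd y" "\<lambda>i. f i (fst y)"] by blast
    then show ?case by (simp add: \<sigma>_def prod_eq_iff)
  qed
  then have \<sigma>b: "\<sigma> (fst b) = b" using eventually_nz_at[OF ev b] by simp
  obtain j where j: "f j (fst b) \<noteq> 0" using eventually_nz_at[OF gr x] bZ by blast
  have m: "mor X (fst b) \<sigma>" unfolding \<sigma>_def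
    using gf x j by (intro mor_Pair mor_id mor_abs_proj) (auto simp: generates_at_def)
  show ?thesis unfolding generates_at_def
  proof (intro conjI ballI allI impI)
    fix k assume k: "k \<in> I"
    show r: "reg B b (\<lambda>y. z k (fst y))"
      using gz k by (intro reg_fst[OF _ b BX]) (auto simp: generates_at_def)
    have "eventually (\<lambda>u. u \<in> Y \<longrightarrow> z k u = 0) (nz X (fst b))" using gz k by (auto simp: generates_at_def)
    from eventually_fst[OF this b BX]
    show "eventually (\<lambda>y. y \<in> proper_transform Z B Y \<longrightarrow> z k (fst y) = 0) (nz B b)"
      by (intro vanishes_on_proper_transform[OF r]) (auto elim!: eventually_mono)
  next
    fix g assume g: "reg B b g" "eventually (\<lambda>y. y \<in> proper_transform Z B Y \<longrightarrow> g y = 0) (nz B b)"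
    have "eventually (\<lambda>u. \<sigma> u \<in> B \<longrightarrow> \<sigma> u \<in> proper_transform Z B Y \<longrightarrow> g (\<sigma> u) = 0) (nz X (fst b))"
      using mor_eventually[OF m x, of _ B] g(2) \<sigma>b by simp
    with \<sigma>B nZ have "eventually (\<lambda>u. u \<in> Y \<longrightarrow> g (\<sigma> u) = 0) (nz X (fst b))"
      by eventually_elim (auto simp: \<sigma>_def intro: proper_transform_I)
    moreover have "reg X (fst b) (\<lambda>u. g (\<sigma> u))"
      by (rule mor_reg[OF m x _ \<sigma>B]) (use g(1) \<sigma>b in simp)
    ultimately have "ideal_at X (fst b) I z (\<lambda>u. g (\<sigma> u))" using gz unfolding generates_at_def by blast
    moreover have "eventually (\<lambda>y. g y = g (\<sigma> (fst y))) (nz B b)"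
      using ev by eventually_elim metis
    ultimately show "ideal_at B b I (\<lambda>k y. z k (fst y)) g"
      using ideal_at_cong[OF ideal_at_fst[OF _ b BX]] by blast
  qed
qed

text \<open>Over a point of the centre, in the chart where the proper transform is cut out by the quotients
  \<open>r k = z k / z w\<close>: the retraction \<open>\<rho>\<close> of the base onto \<open>{z k = 0}\<close> lifts to the blow-up.\<close>

lemma generates_at_proper_transform_exceptional:
  fixes B :: "('a::charted_space \<times> 'r::finite proj) set"
  assumes bu: "is_blow_up X Z B" and b: "b \<in> B" and I: "finite I" "w \<notin> I"
    and gz: "generates_at X Z (fst b) (insert w I) z"
    and r: "\<And>k. k \<in> I \<Longrightarrow> reg B b (r k)" "\<And>k. k \<in> I \<Longrightarrow> r k b = 0"
      "\<And>k. k \<in> I \<Longrightarrow> eventually (\<lambda>y. z k (fst y) = z w (fst y) * r k y) (nz B b)"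
    and D: "\<And>x. x \<in> X \<Longrightarrow> \<exists>\<^sub>F u in nz X x. D u"
      "eventually (\<lambda>u. D u \<longrightarrow> z w u \<noteq> 0) (nz X (fst b))"
    and \<rho>: "mor X (fst b) \<rho>" "\<rho> (fst b) = fst b" "eventually (\<lambda>u. \<rho> u \<in> X) (nz X (fst b))"
      "\<And>V \<Phi> \<phi>. (V, \<Phi>) \<in> charts \<Longrightarrow> fst b \<in> V \<Longrightarrow> \<phi> \<in> \<Phi> \<Longrightarrow>
        ideal_at X (fst b) I z (\<lambda>u. \<phi> (\<rho> u) - \<phi> u)"
      "eventually (\<lambda>u. \<forall>k\<in>I. z k (\<rho> u) = 0) (nz X (fst b))"
      "eventually (\<lambda>u. z w (\<rho> u) = z w u) (nz X (fst b))"
      "eventually (\<lambda>u. D u \<longrightarrow> \<rho> u \<in> Y) (nz X (fst b))"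
    and Y: "eventually (\<lambda>u. u \<in> Y \<longrightarrow> z w u = 0 \<or> (\<forall>k\<in>I. z k u = 0)) (nz X (fst b))"
    and Z: "eventually (\<lambda>u. (\<forall>k\<in>insert w I. z k u = 0) \<longrightarrow> u \<in> Z) (nz X (fst b))"
  shows "generates_at B (proper_transform Z B Y) b I r"
proof -
  note BX = blow_up_fst[OF bu]
  have x: "fst b \<in> X" using b BX by auto
  have dense: "\<exists>\<^sub>F u in nz B y. D (fst u)" if "y \<in> B" for y
    by (rule blow_up_dense[OF bu _ that]) (rule D(1))
  have Dw: "eventually (\<lambda>y. D (fst y) \<longrightarrow> z w (fst y) \<noteq> 0) (nz B b)"
    by (rule eventually_fst[OF D(2) b BX])
  have r': "eventually (\<lambda>y. \<forall>k\<in>I. z k (fst y) = z w (fst y) * r k y) (nz B b)"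
    using r(3) I(1) by (simp add: eventually_ball_finite_distrib)
  obtain f :: "'r \<Rightarrow> 'a \<Rightarrow> complex" where gf: "generates_at X Z (fst b) UNIV f"
    and rel: "eventually (\<lambda>y. \<forall>i j. coord_nonzero j (snd y) \<longrightarrow>
       f i (fst y) = coord_ratio i j (snd y) * f j (fst y)) (nz B b)"
    and fr: "\<exists>\<^sub>F y in nz B b. fst y \<notin> Z \<and> (\<exists>i. f i (fst y) \<noteq> 0) \<and> snd y = abs_proj (\<chi> i. f i (fst y))"
    and gr: "eventually (\<lambda>u. u \<notin> Z \<longrightarrow> (\<exists>i. f i u \<noteq> 0) \<and> (u, abs_proj (\<chi> i. f i u)) \<in> B) (nz X (fst b))"
    by (rule blow_up_local[OF bu b])
  obtain j where j: "coord_nonzero j (snd b)" using coord_nonzero_exists by blast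
  note sn = reg_coord_ratio[OF mor_snd_id b j]
  have "\<forall>i. ideal_at X (fst b) (insert w I) z (f i)" using gz gf unfolding generates_at_def by simp
  then have "\<forall>i. \<exists>a. (\<forall>k\<in>insert w I. reg X (fst b) (a k)) \<and>
      eventually (\<lambda>u. f i u = (\<Sum>k\<in>insert w I. a k u * z k u)) (nz X (fst b))"
    unfolding ideal_at_def .
  then obtain a where a: "\<And>i k. k \<in> insert w I \<Longrightarrow> reg X (fst b) (a i k)"
    "\<And>i. eventually (\<lambda>u. f i u = (\<Sum>k\<in>insert w I. a i k u * z k u)) (nz X (fst b))"
    by (auto simp: choice_iff)
  have fa: "eventually (\<lambda>u. \<forall>i. f i u = a i w u * z w u + (\<Sum>k\<in>I. a i k u * z k u)) (nz X (fst b))"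
    using a(2) I by (simp add: eventually_all_finite)
  \<comment> \<open>The \<open>e i\<close> are the quotients \<open>f i / z w\<close>, written so
    that they are regular at \<open>b\<close>. They turn out to be homogeneous coordinates of the
    second component near \<open>b\<close>.\<close>
  define e where "e i y = a i w (fst y) + (\<Sum>k\<in>I. a i k (fst y) * r k y)" for i y
  have rega: "reg B b (\<lambda>y. a i k (fst y))" if "k \<in> insert w I" for i k
    using reg_fst[OF a(1)[OF that] b BX] .
  have rege: "reg B b (e i)" for i
    unfolding e_def using rega r(1) by (intro reg_add reg_sum reg_mult) auto
  have fe: "eventually (\<lambda>y. \<forall>i. f i (fst y) = z w (fst y) * e i y) (nz B b)"
    using eventually_fst[OF fa b BX] r'
    by eventually_elim (simp add: e_def sum_distrib_left algebra_simps)
  have e_ratio: "eventually (\<lambda>y. e i y = coord_ratio i j (snd y) * e j y) (nz B b)" for i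
  proof -
    \<comment> \<open>The factor \<open>z w\<close> is cancelled on the dense set where it has no
      zero.\<close>
    have "eventually (\<lambda>y. D (fst y) \<longrightarrow> e i y - coord_ratio i j (snd y) * e j y = 0) (nz B b)"
      using rel sn(2) fe Dw
    proof eventually_elim
      case (elim y)
      then have "z w (fst y) * e i y = coord_ratio i j (snd y) * (z w (fst y) * e j y)" by metis
      then have "z w (fst y) * (e i y - coord_ratio i j (snd y) * e j y) = 0" by (simp add: algebra_simps)
      with elim(4) show ?case by auto
    qed
    moreover have "reg B b (\<lambda>y. e i y - coord_ratio i j (snd y) * e j y)"
      by (intro reg_diff reg_mult rege sn(1))
    ultimately have "eventually (\<lambda>y. e i y - coord_ratio i j (snd y) * e j y = 0) (nz B b)"
      by (intro vanishes_if_dense[where D = "\<lambda>y. D (fst y)"] dense)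
    then show ?thesis by eventually_elim simp
  qed
  \<comment> \<open>The function \<open>z w\<close> is itself a combination of the
    \<open>f i\<close>; dividing by it gives 1 as a combination of the \<open>e i\<close>, so these
    cannot all vanish at \<open>b\<close>.\<close>
  have ej: "e j b \<noteq> 0"
  proof
    assume ej: "e j b = 0"
    have e0: "e i b = 0" for i using eventually_nz_at[OF e_ratio b, of i] ej by simp
    have "ideal_at X (fst b) UNIV f (z w)" using gz gf unfolding generates_at_def by simp
    from ideal_at_fst[OF this b BX] obtain c where c: "\<forall>i. reg B b (c i)"
      "eventually (\<lambda>y. z w (fst y) = (\<Sum>i\<in>UNIV. c i y * f i (fst y))) (nz B b)"
      unfolding ideal_at_def by auto
    have "eventually (\<lambda>y. D (fst y) \<longrightarrow> (\<Sum>i\<in>UNIV. c i y * e i y) - 1 = 0) (nz B b)"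
      using c(2) fe Dw
    proof eventually_elim
      case (elim y)
      have "z w (fst y) = (\<Sum>i\<in>UNIV. c i y * (z w (fst y) * e i y))"
        using elim(1) elim(2) by simp
      then have "z w (fst y) * ((\<Sum>i\<in>UNIV. c i y * e i y) - 1) = 0"
        by (simp add: sum_distrib_left algebra_simps)
      with elim(3) show ?case by auto
    qed
    moreover have "reg B b (\<lambda>y. (\<Sum>i\<in>UNIV. c i y * e i y) - 1)"
      using c(1) by (intro reg_diff reg_sum reg_mult rege reg_const) auto
    ultimately have "eventually (\<lambda>y. (\<Sum>i\<in>UNIV. c i y * e i y) - 1 = 0) (nz B b)"
      by (intro vanishes_if_dense[where D = "\<lambda>y. D (fst y)"] dense)
    from eventually_nz_at[OF this b] e0 show False by simp
  qed
  have eb: "e i b = a i w (fst b)" for i using r(2) by (simp add: e_def)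
  \<comment> \<open>Where the \<open>r k\<close> vanish, \<open>e i\<close> reduces to
    \<open>a i w\<close>. This dictates the second component of the lift, and it makes
    \<open>\<tau>\<close> send \<open>fst b\<close> to \<open>b\<close>.\<close>
  define \<tau> where "\<tau> u = (\<rho> u, abs_proj (\<chi> i. a i w (\<rho> u)))" for u
  have reg\<gamma>: "reg X (fst b) (\<lambda>u. a i w (\<rho> u))" for i
    using a(1) \<rho>(2) by (intro mor_reg[OF \<rho>(1) x _ \<rho>(3)]) simp
  have m: "mor X (fst b) \<tau>" unfolding \<tau>_def
    using \<rho>(1,2) x ej eb reg\<gamma> by (intro mor_Pair mor_abs_proj[of _ _ _ j]) auto
  have evX: "eventually (\<lambda>y. fst y \<in> X) (nz B b)"
    using eventually_nz_self by (rule eventually_mono) (use BX in auto)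
  have mB: "mor B b (\<lambda>y. \<tau> (fst y))" by (rule mor_compose[OF mor_fst_id b m evX])
  have \<tau>b: "\<tau> (fst b) = b"
  proof -
    have "snd b = abs_proj (\<chi> i. e i b)"
      using eq_abs_proj_if_proportional[of j "snd b" "\<lambda>i. e i b", OF j _ ej] eventually_nz_at[OF e_ratio b]
      by blast
    then show ?thesis by (simp add: \<tau>_def \<rho>(2) eb prod_eq_iff)
  qed
  obtain V and \<Phi> :: "('a \<Rightarrow> complex) set" where c: "(V, \<Phi>) \<in> charts" "fst b \<in> V"
    using chart_cover by blast
  define W where "W = V \<times> {P :: 'r proj. coord_nonzero j P}"
  define \<Psi> where "\<Psi> = (\<lambda>\<phi>. \<phi> \<circ> fst) ` \<Phi> \<union> (\<lambda>\<psi>. \<psi> \<circ> snd) ` range (\<lambda>i :: 'r. coord_ratio i j)"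
  have W: "(W, \<Psi>) \<in> charts" "b \<in> W"
    using c j unfolding W_def \<Psi>_def charts_prod_def charts_proj_def by (blast, simp add: mem_Times_iff)
  have zr: "ideal_at B b I r (\<lambda>y. z k (fst y))" if "k \<in> I" for k
  proof (rule ideal_at_cong[OF ideal_at_mult[OF _ ideal_at_generator[OF I(1) that]]])
    show "eventually (\<lambda>y. z k (fst y) = z w (fst y) * r k y) (nz B b)" using r(3) that .
    show "reg B b (\<lambda>y. z w (fst y))" using gz by (intro reg_fst[OF _ b BX]) (simp add: generates_at_def)
  qed
  have lift: "ideal_at B b I r (\<lambda>y. g (fst y))" if "ideal_at X (fst b) I z g" for g
    by (rule ideal_at_trans[OF ideal_at_fst[OF that b BX] zr])
  \<comment> \<open>The lift is the identity modulo the \<open>r k\<close>. On base coordinates this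
    holds since each \<open>z k\<close> is a multiple of \<open>r k\<close>; on projective ones,
    since the coordinates of the lift and the \<open>e i\<close> are both congruent to
    \<open>a i w\<close>.\<close>
  have chart_diff: "ideal_at B b I r (\<lambda>y. \<psi> (\<tau> (fst y)) - \<psi> y)" if "\<psi> \<in> \<Psi>" for \<psi>
  proof -
    from that consider \<phi> where "\<phi> \<in> \<Phi>" "\<psi> = \<phi> \<circ> fst" | i where "\<psi> = coord_ratio i j \<circ> snd"
      unfolding \<Psi>_def by blast
    then show ?thesis
    proof cases
      case 1
      from lift[OF \<rho>(4)[OF c 1(1)]] show ?thesis unfolding 1(2) by (simp add: \<tau>_def)
    next
      case 2
      have \<gamma>e: "ideal_at B b I r (\<lambda>y. a i w (\<rho> (fst y)) - e i y)" for i
      proof (rule ideal_at_cong)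
        have "ideal_at X (fst b) I z (\<lambda>u. a i w (\<rho> u) - a i w u)"
          by (rule ideal_at_retraction(2)[OF c x \<rho>(1,2)]) (erule \<rho>(4)[OF c], rule a(1), simp, rule \<rho>(3))
        from lift[OF this] show "ideal_at B b I r (\<lambda>y. (a i w (\<rho> (fst y)) - a i w (fst y)) - (\<Sum>k\<in>I. a i k (fst y) * r k y))"
          by (rule ideal_at_diff) (intro ideal_at_sum ideal_at_mult rega ideal_at_generator I(1), auto)
      qed (simp add: e_def)
      have reg\<gamma>B: "reg B b (\<lambda>y. a i w (\<rho> (fst y)))" for i
        using reg_fst[OF reg\<gamma> b BX] .
      have "ideal_at B b I r (\<lambda>y. a i w (\<rho> (fst y)) / a j w (\<rho> (fst y)) - e i y / e j y)"
        by (rule ideal_at_quotient_diff[OF \<gamma>e \<gamma>e rege rege reg\<gamma>B reg\<gamma>B b ej]) (use ej eb \<rho>(2) in simp)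
      moreover have "eventually (\<lambda>y. \<psi> (\<tau> (fst y)) - \<psi> y =
          a i w (\<rho> (fst y)) / a j w (\<rho> (fst y)) - e i y / e j y) (nz B b)"
      proof -
        have "a j w (\<rho> (fst b)) \<noteq> 0" using ej eb \<rho>(2) by simp
        from reg_nonzero[OF reg\<gamma>B b this] reg_nonzero[OF rege b ej] e_ratio[of i] show ?thesis
        proof eventually_elim
          case (elim y)
          have "(\<chi> i. a i w (\<rho> (fst y))) \<noteq> 0" using elim(1) by (auto simp: vec_eq_iff)
          with elim show ?case by (simp add: 2 \<tau>_def coord_ratio_abs_proj)
        qed
      qed
      ultimately show ?thesis by (rule ideal_at_cong)
    qed
  qed
  show ?thesis unfolding generates_at_def
  proof (intro conjI ballI allI impI)
    fix k assume k: "k \<in> I"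
    show "reg B b (r k)" using r(1) k .
    \<comment> \<open>At a point over \<open>Y\<close> and off the centre \<open>z w\<close> is
      nonzero, for otherwise its multiples \<open>z k\<close> would vanish too and the point would
      lie over \<open>Z\<close>. Hence the \<open>z k\<close> vanish there, and with them the
      \<open>r k\<close>.\<close>
    show "eventually (\<lambda>y. y \<in> proper_transform Z B Y \<longrightarrow> r k y = 0) (nz B b)"
    proof (rule vanishes_on_proper_transform[OF r(1)[OF k]])
      show "eventually (\<lambda>y. fst y \<in> Y \<longrightarrow> fst y \<notin> Z \<longrightarrow> r k y = 0) (nz B b)"
        using eventually_fst[OF Y b BX] eventually_fst[OF Z b BX] r'
        by eventually_elim (use k in auto)
    qed
  next
    fix g assume g: "reg B b g" "eventually (\<lambda>y. y \<in> proper_transform Z B Y \<longrightarrow> g y = 0) (nz B b)"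
    show "ideal_at B b I r g"
    proof -
      have zZ: "eventually (\<lambda>u. u \<in> Z \<longrightarrow> z w u = 0) (nz X (fst b))"
        using gz by (simp add: generates_at_def)
      have pull: "eventually (\<lambda>u. P (\<rho> u)) (nz X (fst b))" if "eventually P (nz X (fst b))" for P
        using mor_eventually[OF \<rho>(1) x, of P X] that \<rho>(2,3) by (auto elim: eventually_elim2)
      \<comment> \<open>For \<open>u\<close> in \<open>D\<close> the function \<open>z w\<close> is
        nonzero at \<open>\<rho> u\<close> while the \<open>z k\<close> vanish: the point lies off
        the centre, and \<open>\<tau> u\<close> is the graph point over it.\<close>
      have "eventually (\<lambda>u. D u \<longrightarrow> \<tau> u \<in> B \<inter> proper_transform Z B Y) (nz X (fst b))"
        using D(2) \<rho>(5,6,7) pull[OF zZ] pull[OF gr] pull[OF fa]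
      proof eventually_elim
        case (elim u)
        show ?case
        proof
          assume Du: "D u"
          have w: "z w (\<rho> u) \<noteq> 0" "\<rho> u \<in> Y" "\<rho> u \<notin> Z" using elim Du by auto
          obtain i0 where i0: "f i0 (\<rho> u) \<noteq> 0" and B: "(\<rho> u, abs_proj (\<chi> i. f i (\<rho> u))) \<in> B"
            using elim(6) w(3) by blast
          have f: "f i (\<rho> u) = z w (\<rho> u) * a i w (\<rho> u)" for i
            using elim(7) elim(2) by simp
          have "(\<chi> i. f i (\<rho> u)) = z w (\<rho> u) *s (\<chi> i. a i w (\<rho> u))"
            by (simp add: vec_eq_iff f)
          moreover have "(\<chi> i. a i w (\<rho> u)) $ i0 \<noteq> 0" "(\<chi> i. f i (\<rho> u)) $ i0 \<noteq> 0"
            using i0 f[of i0] by auto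
          then have "(\<chi> i. a i w (\<rho> u)) \<noteq> 0" "(\<chi> i. f i (\<rho> u)) \<noteq> 0"
            by (metis zero_index)+
          ultimately have "abs_proj (\<chi> i. a i w (\<rho> u)) = abs_proj (\<chi> i. f i (\<rho> u))"
            using w(1) by (subst abs_proj_eq_iff) blast+
          with B have "\<tau> u \<in> B" by (simp add: \<tau>_def)
          then show "\<tau> u \<in> B \<inter> proper_transform Z B Y"
            using w by (auto simp: \<tau>_def intro: proper_transform_I)
        qed
      qed
      from eventually_fst[OF this b BX] show ?thesis
        by (rule ideal_at_retraction(3)[OF W b mB \<tau>b, rotated -1, where D = "\<lambda>y. D (fst y)"])
          (erule chart_diff, rule g(1), rule g(2), erule dense)
    qed
  qed
qed

section \<open>Coordinates adapted to a conic\<close>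

text \<open>Bilinear, without complex conjugation.\<close>

definition dot :: "complex^3 \<Rightarrow> complex^3 \<Rightarrow> complex" where
  "dot v w = v $ 1 * w $ 1 + v $ 2 * w $ 2 + v $ 3 * w $ 3"

text \<open>The complex cross product: in homogeneous coordinates the join of two points and the
  meet of two lines.\<close>

definition crs :: "complex^3 \<Rightarrow> complex^3 \<Rightarrow> complex^3" where
  "crs v w = vector [v $ 2 * w $ 3 - v $ 3 * w $ 2, v $ 3 * w $ 1 - v $ 1 * w $ 3, v $ 1 * w $ 2 - v $ 2 * w $ 1]"

lemma dot_crs_self [simp]: "dot (crs v w) v = 0" "dot (crs v w) w = 0"
  by (simp_all add: dot_def crs_def algebra_simps)

lemma dot_commute: "dot v w = dot w v"
  by (simp add: dot_def mult.commute)

lemma dot_add: "dot v (w + w') = dot v w + dot v w'" "dot (w + w') v = dot w v + dot w' v"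
  by (simp_all add: dot_def algebra_simps)

lemma dot_scale: "dot v (c *s w) = c * dot v w" "dot (c *s v) w = c * dot v w"
  by (simp_all add: dot_def algebra_simps)

lemma dot_zero [simp]: "dot v 0 = 0" "dot 0 v = 0"
  by (simp_all add: dot_def)

lemma dot_crs_crs: "dot (crs a b) (crs c d) = dot a c * dot b d - dot a d * dot b c"
  by (simp add: dot_def crs_def algebra_simps)

lemma dot_matrix: "dot v (A *v w) = dot (transpose A *v v) w"
  by (simp add: dot_def matrix_vector_mult_def transpose_def sum_3 algebra_simps)

lemma nonzero_dot: "v \<noteq> 0 \<Longrightarrow> \<exists>w. dot v w \<noteq> 0"
proof -
  assume "v \<noteq> 0"
  then consider "v $ 1 \<noteq> 0" | "v $ 2 \<noteq> 0" | "v $ 3 \<noteq> 0" by (auto simp: vec_eq_iff forall_3)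
  then show ?thesis
    by cases (rule exI[of _ "vector [1, 0, 0]"] exI[of _ "vector [0, 1, 0]"] exI[of _ "vector [0, 0, 1]"], simp add: dot_def)+
qed

lemma proportional_crs:
  assumes "crs a b \<noteq> 0" "dot m a = 0" "dot m b = 0"
  shows "\<exists>k. m = k *s crs a b"
proof -
  define c where "c = crs a b"
  have e: "m $ i * c $ j = m $ j * c $ i" for i j
  proof -
    have m: "m $ 1 * a $ 1 + m $ 2 * a $ 2 + m $ 3 * a $ 3 = 0" "m $ 1 * b $ 1 + m $ 2 * b $ 2 + m $ 3 * b $ 3 = 0"
      using assms(2,3) by (simp_all add: dot_def)
    have "m $ 1 * c $ 2 = m $ 2 * c $ 1" "m $ 1 * c $ 3 = m $ 3 * c $ 1" "m $ 2 * c $ 3 = m $ 3 * c $ 2"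
      unfolding c_def crs_def vector_3 using m by algebra+
    then show ?thesis using exhaust_3[of i] exhaust_3[of j] by auto
  qed
  obtain j where j: "c $ j \<noteq> 0" using assms(1) by (auto simp: c_def vec_eq_iff)
  have "m = (m $ j / c $ j) *s c"
    using j e[of _ j] by (simp add: vec_eq_iff field_simps)
  then show ?thesis unfolding c_def by blast
qed

section \<open>Normal form of a nonsingular conic\<close>

definition bil :: "complex^3^3 \<Rightarrow> complex^3 \<Rightarrow> complex^3 \<Rightarrow> complex" where
  "bil A v w = dot v (A *v w)"

lemma bil_add: "bil A v (w + w') = bil A v w + bil A v w'" "bil A (w + w') v = bil A w v + bil A w' v"
  by (simp_all add: bil_def dot_add matrix_vector_right_distrib)

lemma bil_scale: "bil A v (c *s w) = c * bil A v w" "bil A (c *s v) w = c * bil A v w"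
  by (simp_all add: bil_def dot_scale vector_scalar_commute)

lemma bil_commute: "transpose A = A \<Longrightarrow> bil A v w = bil A w v"
  using dot_matrix[of v A w] dot_commute[of "A *v v" w] by (simp only: bil_def)

text \<open>Cross products transform by the cofactor matrix, so for symmetric \<open>A\<close>
  applying \<open>A\<close> to the cross product of \<open>A *v o1\<close> and \<open>A *v p\<close>
  gives \<open>det A *s crs o1 p\<close>. The rest is Lagrange's identity
  \<open>dot_crs_crs\<close>.\<close>

lemma bil_crs:
  assumes "transpose A = A"
  shows "bil A (crs (A *v o1) (A *v p)) (crs (A *v o1) (A *v p)) =
    det A * (bil A o1 o1 * bil A p p - bil A o1 p * bil A p o1)"
proof -
  have "transpose A $ i $ j = A $ j $ i" for i j by (simp add: transpose_def)
  then have s: "A $ 2 $ 1 = A $ 1 $ 2" "A $ 3 $ 1 = A $ 1 $ 3" "A $ 3 $ 2 = A $ 2 $ 3"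
    unfolding assms by metis+
  have "A *v crs (A *v o1) (A *v p) = det A *s crs o1 p"
    by (simp add: vec_eq_iff forall_3 crs_def matrix_vector_mult_def sum_3 det_3 s) (algebra)
  then show ?thesis
    by (simp add: bil_def dot_scale dot_crs_crs) (simp add: dot_commute)
qed

locale conic_frame =
  fixes K :: "point set" and N M :: "complex^3^3"
  assumes NM: "N ** M = mat 1" and MN: "M ** N = mat 1"
    and conic: "\<And>v. v \<noteq> 0 \<Longrightarrow> abs_proj v \<in> K \<longleftrightarrow> ((N *v v) $ 2)\<^sup>2 = (N *v v) $ 1 * (N *v v) $ 3"

text \<open>In a basis of two isotropic vectors \<open>p\<close>, \<open>o1\<close> and a vector
  \<open>n\<close> orthogonal to both, only the products of \<open>p\<close> with \<open>o1\<close>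
  and of \<open>n\<close> with itself survive. Scaling \<open>n\<close> matches the two.\<close>

lemma conic_frame_exists:
  assumes "nonsingular_conic K"
  shows "\<exists>N M. conic_frame K N M"
proof -
  obtain A :: "complex^3^3" where A: "transpose A = A" "det A \<noteq> 0" "K = {P. on_conic A P}"
    using assms unfolding nonsingular_conic_def by blast
  note sym = bil_commute[OF A(1)]
  \<comment> \<open>On the span of \<open>e1\<close> and \<open>e2\<close> the form is a binary
    quadratic form, which has a nontrivial zero over the complex numbers.\<close>
  have "\<exists>o1. o1 \<noteq> 0 \<and> bil A o1 o1 = 0"
  proof -
    define e1 e2 :: "complex^3" where "e1 = vector [1, 0, 0]" and "e2 = vector [0, 1, 0]"
    define a b c where "a = bil A e1 e1" "b = bil A e1 e2" "c = bil A e2 e2"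
    show ?thesis
    proof (cases "a = 0")
      case True
      then show ?thesis by (intro exI[of _ e1]) (auto simp: a_b_c_def e1_def vec_eq_iff forall_3)
    next
      case False
      define t where "t = (- b + csqrt (b\<^sup>2 - a * c)) / a"
      have "(a * t + b)\<^sup>2 = b\<^sup>2 - a * c" using False by (simp add: t_def)
      then have "a * (a * t\<^sup>2 + 2 * b * t + c) = 0" by (simp add: power2_eq_square algebra_simps)
      then have "a * t\<^sup>2 + 2 * b * t + c = 0" using False by simp
      then have "bil A (t *s e1 + e2) (t *s e1 + e2) = 0"
        using sym[of e2 e1] by (simp add: bil_add bil_scale a_b_c_def power2_eq_square algebra_simps)
      moreover have "t *s e1 + e2 \<noteq> 0" by (simp add: e1_def e2_def vec_eq_iff forall_3)
      ultimately show ?thesis by blast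
    qed
  qed
  then obtain o1 where o1: "o1 \<noteq> 0" "bil A o1 o1 = 0" by blast
  have "A *v o1 \<noteq> 0"
  proof
    assume "A *v o1 = 0"
    moreover obtain B where "B ** A = mat 1"
      using A(2) invertible_det_nz[of A] unfolding invertible_def by blast
    ultimately have "o1 = 0"
      by (metis matrix_vector_mul_assoc matrix_vector_mul_lid matrix_vector_mult_0_right)
    with o1 show False by simp
  qed
  then obtain y where "dot (A *v o1) y \<noteq> 0" using nonzero_dot by blast
  then have y: "bil A o1 y \<noteq> 0" using sym[of o1 y] by (simp add: bil_def dot_commute)
  \<comment> \<open>Since \<open>o1\<close> is isotropic, the form at \<open>y + c *s o1\<close> is
    linear in \<open>c\<close>; this value of \<open>c\<close> is its zero.\<close>
  define c where "c = - bil A y y / (2 * bil A o1 y)"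
  define p where "p = y + c *s o1"
  define k where "k = bil A o1 p"
  have k: "k \<noteq> 0" using y o1 by (simp add: k_def p_def bil_add bil_scale)
  have p: "bil A p p = 0"
    using y o1 sym[of y o1] by (simp add: p_def bil_add bil_scale) (simp add: c_def)
  define n0 where "n0 = crs (A *v o1) (A *v p)"
  have n0: "bil A n0 n0 = - det A * k\<^sup>2"
    using bil_crs[OF A(1), of o1 p] o1 p sym[of p o1] by (simp add: n0_def k_def power2_eq_square)
  define m where "m = bil A n0 n0"
  have m: "m \<noteq> 0" using n0 A(2) k by (simp add: m_def)
  \<comment> \<open>The factor turns the value \<open>m\<close> of the form at \<open>n0\<close>
    into \<open>- 2 * k\<close>, so that the form becomes
    \<open>2 * k * (w1 * w3 - w2^2)\<close>.\<close>
  define n where "n = csqrt (- 2 * k / m) *s n0"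
  have n: "bil A n n = - 2 * k"
  proof -
    have "bil A n n = (csqrt (- 2 * k / m))\<^sup>2 * m" by (simp add: n_def bil_scale m_def power2_eq_square)
    then show ?thesis using m by simp
  qed
  have no: "bil A n o1 = 0" "bil A n p = 0"
    by (simp_all add: n_def bil_scale n0_def) (simp_all add: bil_def)
  have bils: "bil A o1 o1 = 0" "bil A p p = 0" "bil A n n = - 2 * k" "bil A o1 p = k" "bil A p o1 = k"
    "bil A n o1 = 0" "bil A n p = 0" "bil A o1 n = 0" "bil A p n = 0"
    using o1 p n no sym[of p o1] sym[of n o1] sym[of n p] by (simp_all add: k_def)
  define M where "M = transpose (vector [p, n, o1] :: complex^3^3)"
  have M: "M *v w = w $ 1 *s p + w $ 2 *s n + w $ 3 *s o1" for w
    by (simp add: M_def matrix_vector_mult_def transpose_def sum_3 vec_eq_iff algebra_simps)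
  have "w = 0" if "M *v w = 0" for w
  proof -
    have 0: "bil A q (w $ 1 *s p + w $ 2 *s n + w $ 3 *s o1) = 0" for q
      using that M by (simp add: bil_def)
    show ?thesis using 0[of o1] 0[of n] 0[of p] k
      by (simp add: bil_add bil_scale bils vec_eq_iff forall_3)
  qed
  then have "\<exists>N. N ** M = mat 1"
    unfolding matrix_left_invertible_ker by blast
  then obtain N where N: "N ** M = mat 1" by blast
  then have MN: "M ** N = mat 1" using matrix_left_right_inverse by blast
  have "conic_frame K N M"
  proof
    fix v :: "complex^3" assume v: "v \<noteq> 0"
    have "bil A (M *v w) (M *v w) = 2 * k * (w $ 1 * w $ 3 - (w $ 2)\<^sup>2)" for w
      by (simp add: M bil_add bil_scale bils power2_eq_square algebra_simps)
    from this[of "N *v v"] have q: "bil A v v = 2 * k * ((N *v v) $ 1 * (N *v v) $ 3 - ((N *v v) $ 2)\<^sup>2)"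
      by (simp add: matrix_vector_mul_assoc MN)
    have "abs_proj v \<in> K \<longleftrightarrow> bil A v v = 0"
      using v by (simp add: A(3) on_conic.abs_eq same_line_refl bil_def dot_def sum_3)
    with q k show "abs_proj v \<in> K \<longleftrightarrow> ((N *v v) $ 2)\<^sup>2 = (N *v v) $ 1 * (N *v v) $ 3" by auto
  qed (fact N MN)+
  then show ?thesis by blast
qed

lift_definition affine_pt :: "complex^3^3 \<Rightarrow> point \<Rightarrow> bool" is "\<lambda>N v. (N *v v) $ 1 \<noteq> 0"
  unfolding same_line_def by (elim conjE exE) (simp add: vector_scalar_commute)

text \<open>The affine coordinate on the conic \<open>b\<^sup>2 = a c\<close>, inverse to \<open>t \<mapsto> (1, t, t\<^sup>2)\<close>.\<close>

lift_definition param :: "complex^3^3 \<Rightarrow> point \<Rightarrow> complex" is "\<lambda>N v. (N *v v) $ 2 / (N *v v) $ 1"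
  unfolding same_line_def by (elim conjE exE) (simp add: vector_scalar_commute)

lemma affine_pt_abs_proj: "v \<noteq> 0 \<Longrightarrow> affine_pt N (abs_proj v) \<longleftrightarrow> (N *v v) $ 1 \<noteq> 0"
  by (simp add: affine_pt.abs_eq same_line_refl)

lemma param_abs_proj: "v \<noteq> 0 \<Longrightarrow> param N (abs_proj v) = (N *v v) $ 2 / (N *v v) $ 1"
  by (simp add: param.abs_eq same_line_refl)

text \<open>A frame misses only the point where its first coordinate vanishes on the conic. If
  \<open>l\<close> is the parameter of none of the given points, the tangent at the parameter
  \<open>l\<close> avoids them all and can serve as the new line at infinity.\<close>

lemma conic_frame_affine:
  assumes "nonsingular_conic K" "finite S" "S \<subseteq> K"
  obtains N M where "conic_frame K N M" "\<And>P. P \<in> S \<Longrightarrow> affine_pt N P"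
proof -
  obtain N M where "conic_frame K N M" using conic_frame_exists assms(1) by blast
  then interpret conic_frame K N M .
  obtain l where l: "l \<notin> param N ` S"
    using ex_new_if_finite[of "param N ` S"] assms(2) infinite_UNIV_char_0[where 'a = complex] by auto
  \<comment> \<open>On the conic \<open>T\<close> is the change of parameter
    \<open>t \<mapsto> 1 / (t - l)\<close>, and \<open>T'\<close> is its inverse; the first row of
    \<open>T\<close> is the equation of the tangent.\<close>
  define T T' :: "complex^3^3" where "T = vector [vector [l\<^sup>2, - 2 * l, 1], vector [- l, 1, 0], vector [1, 0, 0]]"
    and "T' = vector [vector [0, 0, 1], vector [0, 1, l], vector [1, 2 * l, l\<^sup>2]]"
  have T: "(T *v w) $ 1 = l\<^sup>2 * w $ 1 - 2 * l * w $ 2 + w $ 3" "(T *v w) $ 2 = w $ 2 - l * w $ 1" "(T *v w) $ 3 = w $ 1" for w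
    by (simp_all add: T_def matrix_vector_mult_def sum_3)
  have TT: "T ** T' = mat 1"
    by (simp add: T_def T'_def matrix_matrix_mult_def mat_def sum_3 vec_eq_iff forall_3 power2_eq_square)
  then have T'T: "T' ** T = mat 1" using matrix_left_right_inverse by blast
  have Tv: "((T ** N) *v v) = T *v (N *v v)" for v by (simp add: matrix_vector_mul_assoc)
  show ?thesis
  proof
    show "conic_frame K (T ** N) (M ** T')"
    proof
      show "(T ** N) ** (M ** T') = mat 1"
        by (metis NM TT matrix_mul_assoc matrix_mul_lid)
      show "(M ** T') ** (T ** N) = mat 1"
        by (metis MN T'T matrix_mul_assoc matrix_mul_lid)
      fix v :: "complex^3" assume v: "v \<noteq> 0"
      show "abs_proj v \<in> K \<longleftrightarrow> (((T ** N) *v v) $ 2)\<^sup>2 = ((T ** N) *v v) $ 1 * ((T ** N) *v v) $ 3"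
        unfolding conic[OF v] Tv T by (auto simp: power2_eq_square algebra_simps)
    qed
    fix P assume P: "P \<in> S"
    obtain v where v: "v \<noteq> 0" "P = abs_proj v" using proj_cases by blast
    define w where "w = N *v v"
    have K: "(w $ 2)\<^sup>2 = w $ 1 * w $ 3" using conic[OF v(1)] P assms(3) v(2) by (auto simp: w_def)
    have w0: "w \<noteq> 0"
    proof
      assume "w = 0"
      then have "M *v (N *v v) = 0" by (simp add: w_def)
      then show False using v(1) by (simp add: matrix_vector_mul_assoc MN)
    qed
    have "param N P = w $ 2 / w $ 1" using v by (simp add: param_abs_proj w_def)
    then have l: "w $ 2 / w $ 1 \<noteq> l" using l P by force
    have "l\<^sup>2 * w $ 1 - 2 * l * w $ 2 + w $ 3 \<noteq> 0"
    proof (cases "w $ 1 = 0")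
      \<comment> \<open>The old point at infinity: its third coordinate is the only nonzero
        one.\<close>
      case True
      then show ?thesis using K w0 by (auto simp: vec_eq_iff forall_3)
    next
      case False
      have "w $ 1 * (l\<^sup>2 * w $ 1 - 2 * l * w $ 2 + w $ 3) = (w $ 2 - l * w $ 1)\<^sup>2"
        using K by (simp add: power2_eq_square algebra_simps)
      moreover have "w $ 2 - l * w $ 1 \<noteq> 0" using l False by (auto simp: field_simps)
      ultimately show ?thesis by auto
    qed
    then show "affine_pt (T ** N) P" unfolding v(2) affine_pt_abs_proj[OF v(1)] Tv T w_def .
  qed
qed

section \<open>Points, chords and lines in a conic frame\<close>

definition vand :: "complex \<Rightarrow> complex^3" where
  "vand t = vector [1, t, t\<^sup>2]"

text \<open>As a linear form it takes the value \<open>(z - s) * (z - t)\<close> at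
  \<open>vand z\<close>: the secant of two points of the conic, and the tangent for
  \<open>s = t\<close>.\<close>

definition chord :: "complex \<Rightarrow> complex \<Rightarrow> complex^3" where
  "chord s t = vector [s * t, - (s + t), 1]"

lemma vand_nonzero [simp]: "vand t \<noteq> 0"
  by (simp add: vand_def vec_eq_iff forall_3)

lemma chord_nonzero [simp]: "chord s t \<noteq> 0"
  by (simp add: chord_def vec_eq_iff forall_3)

lemma crs_vand: "crs (vand s) (vand t) = (t - s) *s chord s t"
  by (simp add: crs_def vand_def chord_def vec_eq_iff forall_3 power2_eq_square algebra_simps)

context conic_frame
begin

definition pt :: "complex^3 \<Rightarrow> point" where "pt p = abs_proj (M *v p)"

text \<open>Lines are transformed contragrediently to points, so that incidence remains the
  vanishing of \<open>dot\<close>.\<close>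

definition ln :: "complex^3 \<Rightarrow> line" where "ln m = abs_proj (m v* N)"

lemma NM_vec [simp]: "N *v (M *v w) = w" "M *v (N *v w) = w"
  by (simp_all add: matrix_vector_mul_assoc NM MN)

lemma NM_vec_left [simp]: "(w v* M) v* N = w" "(w v* N) v* M = w"
  by (simp_all add: vector_matrix_mul_assoc NM MN)

lemma M_nonzero: "p \<noteq> 0 \<Longrightarrow> M *v p \<noteq> 0"
  by (metis NM_vec(1) matrix_vector_mult_0_right)

lemma N_nonzero: "p \<noteq> 0 \<Longrightarrow> p v* N \<noteq> 0"
  by (metis NM_vec_left(2) vector_matrix_mult_0)

lemma pt_cases: obtains p where "p \<noteq> 0" "P = pt p"
proof -
  obtain v where "v \<noteq> 0" "P = abs_proj v" using proj_cases by blast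
  then show ?thesis using that[of "N *v v"]
    by (simp add: pt_def) (metis NM_vec(2) matrix_vector_mult_0_right)
qed

lemma ln_cases: obtains m where "m \<noteq> 0" "L = ln m"
proof -
  obtain v where "v \<noteq> 0" "L = abs_proj v" using proj_cases by blast
  then show ?thesis using that[of "v v* M"]
    by (simp add: ln_def) (metis NM_vec_left(1) vector_matrix_mult_0)
qed

lemma pt_scale: "c \<noteq> 0 \<Longrightarrow> p \<noteq> 0 \<Longrightarrow> pt (c *s p) = pt p"
  unfolding pt_def using M_nonzero[of p] M_nonzero[of "c *s p"]
  by (subst abs_proj_eq_iff) (auto simp: vector_scalar_commute vector_mul_eq_0 intro!: exI[of _ "inverse c"])

lemma ln_scale: "c \<noteq> 0 \<Longrightarrow> p \<noteq> 0 \<Longrightarrow> ln (c *s p) = ln p"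
  unfolding ln_def using N_nonzero[of p] N_nonzero[of "c *s p"]
  by (subst abs_proj_eq_iff) (auto simp: scalar_vector_matrix_assoc vector_mul_eq_0 intro!: exI[of _ "inverse c"])

lemma incident_iff: "p \<noteq> 0 \<Longrightarrow> m \<noteq> 0 \<Longrightarrow> incident (pt p) (ln m) \<longleftrightarrow> dot m p = 0"
  using dot_matrix[of m N "M *v p"] M_nonzero[of p] N_nonzero[of m]
  by (simp add: pt_def ln_def incident.abs_eq same_line_refl dot_def sum_3)

lemma crs_nonzero: "crs p q \<noteq> 0 \<Longrightarrow> p \<noteq> 0 \<and> q \<noteq> 0"
  by (auto simp: crs_def vec_eq_iff forall_3)

lemma join_pt:
  assumes "crs p q \<noteq> 0"
  shows "join (pt p) (pt q) = ln (crs p q)"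
  unfolding join_def
proof (rule the_equality)
  note nz = crs_nonzero[OF assms]
  show "incident (pt p) (ln (crs p q)) \<and> incident (pt q) (ln (crs p q))"
    using nz assms by (simp add: incident_iff)
  fix L assume L: "incident (pt p) L \<and> incident (pt q) L"
  obtain m where m: "m \<noteq> 0" "L = ln m" by (rule ln_cases)
  then obtain k where k: "m = k *s crs p q"
    using L nz proportional_crs[OF assms, of m] by (auto simp: incident_iff)
  with m(1) have "k \<noteq> 0" by auto
  then show "L = ln (crs p q)" unfolding m k using assms by (rule ln_scale)
qed

lemma meet_ln:
  assumes "crs m n \<noteq> 0"
  shows "meet (ln m) (ln n) = pt (crs m n)"
  unfolding meet_def
proof (rule the_equality)
  note nz = crs_nonzero[OF assms]
  show "incident (pt (crs m n)) (ln m) \<and> incident (pt (crs m n)) (ln n)"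
    using nz assms by (simp add: incident_iff dot_commute[of m] dot_commute[of n])
  fix P assume P: "incident P (ln m) \<and> incident P (ln n)"
  obtain p where p: "p \<noteq> 0" "P = pt p" by (rule pt_cases)
  then obtain k where k: "p = k *s crs m n"
    using P nz proportional_crs[OF assms, of p] by (auto simp: incident_iff dot_commute)
  with p(1) have "k \<noteq> 0" by auto
  then show "P = pt (crs m n)" unfolding p k using assms by (rule pt_scale)
qed

lemma join_vand: "s \<noteq> t \<Longrightarrow> join (pt (vand s)) (pt (vand t)) = ln (chord s t)"
  by (subst join_pt) (auto simp: crs_vand ln_scale vector_mul_eq_0 simp del: vector_sub_rdistrib)

lemma pt_vand_param:
  assumes "P \<in> K" "affine_pt N P"
  shows "P = pt (vand (param N P))"
proof -
  obtain p where p: "p \<noteq> 0" "P = pt p" by (rule pt_cases)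
  have e: "(p $ 2)\<^sup>2 = p $ 1 * p $ 3" using assms(1) conic[OF M_nonzero[OF p(1)]] by (simp add: p(2) pt_def)
  have p1: "p $ 1 \<noteq> 0" using assms(2) p M_nonzero[OF p(1)] by (simp add: pt_def affine_pt_abs_proj)
  have t: "param N P = p $ 2 / p $ 1" using p M_nonzero[OF p(1)] by (simp add: pt_def param_abs_proj)
  have "p = p $ 1 *s vand (p $ 2 / p $ 1)"
    using p1 e by (simp add: vand_def vec_eq_iff forall_3 power2_eq_square)
  then have "pt p = pt (vand (p $ 2 / p $ 1))" using pt_scale[OF p1 vand_nonzero] by metis
  then show ?thesis using p(2) t by simp
qed

lemma pt_vand: "pt (vand t) \<in> K" "affine_pt N (pt (vand t))" "param N (pt (vand t)) = t"
  using conic[OF M_nonzero[OF vand_nonzero[of t]]] M_nonzero[OF vand_nonzero[of t]]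
  by (simp_all add: pt_def affine_pt_abs_proj param_abs_proj) (simp_all add: vand_def power2_eq_square)

end

section \<open>The Pascal line as the axis of a projectivity\<close>

text \<open>The intersection points of the Pascal line with the conic are the fixed points of the
  projectivity \<open>x\<^sub>i \<mapsto> y\<^sub>i\<close>, hence the zeros in \<open>z\<close> of the \<open>4 \<times> 4\<close> determinant with rows
  \<open>(x\<^sub>i y\<^sub>i, x\<^sub>i, y\<^sub>i, 1)\<close> and \<open>(z\<^sup>2, z, z, 1)\<close>. \<open>axis\<close> is the vector of the coefficients of
  \<open>1\<close>, \<open>z\<close>, \<open>z\<^sup>2\<close> in such a determinant, for arbitrary first three rows.\<close>

definition det3 where
  "det3 a b c d e f g h i = a * (e * i - f * h) - b * (d * i - f * g) + c * (d * h - e * (g :: complex))"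

definition axis_rows :: "complex \<times> complex \<times> complex \<times> complex \<Rightarrow> complex \<times> complex \<times> complex \<times> complex \<Rightarrow>
    complex \<times> complex \<times> complex \<times> complex \<Rightarrow> complex^3" where
  "axis_rows = (\<lambda>(a0, b0, c0, d0) (a1, b1, c1, d1) (a2, b2, c2, d2). vector
    [det3 a0 b0 c0 a1 b1 c1 a2 b2 c2,
     det3 a0 (c0 - b0) d0 a1 (c1 - b1) d1 a2 (c2 - b2) d2,
     - det3 b0 c0 d0 b1 c1 d1 b2 c2 d2])"

definition axis3 :: "complex \<Rightarrow> complex \<Rightarrow> complex \<Rightarrow> complex \<Rightarrow> complex \<Rightarrow> complex \<Rightarrow> complex^3" where
  "axis3 x0 x1 x2 y0 y1 y2 =
     axis_rows (x0 * y0, x0, y0, 1) (x1 * y1, x1, y1, 1) (x2 * y2, x2, y2, 1)"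

lemmas axis_defs = axis3_def axis_rows_def det3_def

text \<open>For \<open>z = x0\<close> the row of \<open>z\<close> minus the row of
  \<open>x0\<close>, \<open>y0\<close> is \<open>(x0 - y0)\<close> times
  \<open>(x0, 0, 1, 0)\<close>, and the remaining determinant splits into differences as well. If
  the axis vanishes, all six products do; the base locus is extracted from this.\<close>

lemma axis3_vand:
  "dot (axis3 x0 x1 x2 y0 y1 y2) (vand x0) = - ((x0 - y0) * (x1 - x0) * (x2 - x0) * (y1 - y2))"
  "dot (axis3 x0 x1 x2 y0 y1 y2) (vand x1) = - ((x1 - y1) * (x2 - x1) * (x0 - x1) * (y2 - y0))"
  "dot (axis3 x0 x1 x2 y0 y1 y2) (vand x2) = - ((x2 - y2) * (x0 - x2) * (x1 - x2) * (y0 - y1))"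
  "dot (axis3 x0 x1 x2 y0 y1 y2) (vand y0) = - ((x0 - y0) * (y1 - y0) * (y2 - y0) * (x1 - x2))"
  "dot (axis3 x0 x1 x2 y0 y1 y2) (vand y1) = - ((x1 - y1) * (y2 - y1) * (y0 - y1) * (x2 - x0))"
  "dot (axis3 x0 x1 x2 y0 y1 y2) (vand y2) = - ((x2 - y2) * (y0 - y2) * (y1 - y2) * (x0 - x1))"
  unfolding axis_defs dot_def vand_def power2_eq_square prod.case vector_3
  by (simp_all only: ring_distribs mult_minus_left mult_minus_right) (simp_all add: algebra_simps)

lemma crs_chord_nonzero:
  assumes "a \<noteq> c" "a \<noteq> d"
  shows "crs (chord a b) (chord c d) \<noteq> 0"
proof
  assume "crs (chord a b) (chord c d) = 0"
  then have "c + d = a + b" "a * b = c * d"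
    by (auto simp: crs_def chord_def vec_eq_iff forall_3 algebra_simps)
  then have "(a - c) * (a - d) = 0" by algebra
  with assms show False by simp
qed

lemma axis3_incident:
  "dot (axis3 x0 x1 x2 y0 y1 y2) (crs (chord x0 y1) (chord x1 y0)) = 0"
  "dot (axis3 x0 x1 x2 y0 y1 y2) (crs (chord x0 y2) (chord x2 y0)) = 0"
  "dot (axis3 x0 x1 x2 y0 y1 y2) (crs (chord x1 y2) (chord x2 y1)) = 0"
  unfolding axis_defs dot_def crs_def chord_def prod.case vector_3
  by (simp_all add: algebra_simps)

lemma crs_uminus: "crs w v = - crs v w"
  by (simp add: crs_def vec_eq_iff forall_3)

lemma dot_uminus: "dot v (- w) = - dot v w"
  by (simp add: dot_def)

text \<open>Identifies the axis with the line through two of Pascal's points; the factor is nonzero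
  for injective sextuples.\<close>

lemma crs_crs_chord: "crs (crs (chord x0 y1) (chord x1 y0)) (crs (chord x0 y2) (chord x2 y0)) =
    (x0 - y0) *s axis3 x0 x1 x2 y0 y1 y2"
  by (simp add: axis_defs crs_def chord_def vec_eq_iff forall_3) (algebra)

lemma index_3_cases:
  fixes i j k a :: 3
  assumes "i \<noteq> j" "i \<noteq> k" "j \<noteq> k"
  shows "a = i \<or> a = j \<or> a = k"
  using assms exhaust_3[of i] exhaust_3[of j] exhaust_3[of k] exhaust_3[of a] by auto

text \<open>The three Pascal points lie on the axis by \<open>axis3_incident\<close>, and two of
  them already determine it. The columns come in an arbitrary order \<open>i\<close>,
  \<open>j\<close>, \<open>k\<close>, so that later a coincidence can be moved to the first
  columns.\<close>

lemma (in conic_frame) pascal_line_eq: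
  fixes x y :: "3 \<Rightarrow> letter" and h :: sextuple
  assumes s: "s = array_class x y" and ijk: "i \<noteq> j" "i \<noteq> k" "j \<noteq> k"
    and dist: "distinct [x i, x j, x k, y i, y j, y k]"
    and t: "inj t" "\<And>a. h a = pt (vand (t a))"
  shows "pascal_line s h = ln (axis3 (t (x i)) (t (x j)) (t (x k)) (t (y i)) (t (y j)) (t (y k)))"
    and "axis3 (t (x i)) (t (x j)) (t (x k)) (t (y i)) (t (y j)) (t (y k)) \<noteq> 0"
proof -
  define X Y where "X = t \<circ> x" and "Y = t \<circ> y"
  define l where "l = axis3 (X i) (X j) (X k) (Y i) (Y j) (Y k)"
  have d: "distinct [X i, X j, X k, Y i, Y j, Y k]"
    using dist t(1) by (auto simp: X_def Y_def dest: injD)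
  have "dot l (vand (X i)) \<noteq> 0" unfolding l_def axis3_vand using d by auto
  then have l0: "l \<noteq> 0" by auto
  define pq where "pq a b = crs (chord (X a) (Y b)) (chord (X b) (Y a))" for a b
  have XY: "X a \<noteq> X b" "X a \<noteq> Y b" "Y a \<noteq> Y b" "X a \<noteq> Y a" if "a \<noteq> b" for a b
    using d that index_3_cases[OF ijk, of a] index_3_cases[OF ijk, of b] by auto
  have pq0: "pq a b \<noteq> 0" if "a \<noteq> b" for a b
    unfolding pq_def using XY[of a b] that by (intro crs_chord_nonzero) auto
  have meet_pq: "meet (join (h (x a)) (h (y b))) (join (h (x b)) (h (y a))) = pt (pq a b)" if "a \<noteq> b" for a b
  proof -
    have "join (h (x a)) (h (y b)) = ln (chord (X a) (Y b))" "join (h (x b)) (h (y a)) = ln (chord (X b) (Y a))"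
      using XY(2)[of a b] XY(2)[of b a] that by (simp_all add: t(2) join_vand X_def Y_def)
    then show ?thesis using pq0[OF that] by (simp add: meet_ln pq_def)
  qed
  have pq_swap: "pq b a = - pq a b" for a b unfolding pq_def by (rule crs_uminus)
  have l_pq: "dot l (pq a b) = 0" if "a \<noteq> b" for a b
    using that index_3_cases[OF ijk, of a] index_3_cases[OF ijk, of b]
      axis3_incident[of "X i" "X j" "X k" "Y i" "Y j" "Y k"] pq_swap[of i j] pq_swap[of i k] pq_swap[of j k]
    by (auto simp: l_def pq_def[symmetric] dot_uminus)
  have inc: "incident (meet (join (h (x' i')) (h (y' j'))) (join (h (x' j')) (h (y' i')))) (ln l)"
    if s': "(x', y') \<in> s" and ij: "i' \<noteq> j'" for x' y' i' j'
  proof -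
    have inc: "incident (meet (join (h (x a)) (h (y b))) (join (h (x b)) (h (y a)))) (ln l)"
      and inc': "incident (meet (join (h (y a)) (h (x b))) (join (h (y b)) (h (x a)))) (ln l)" if "a \<noteq> b" for a b
    proof -
      show "incident (meet (join (h (x a)) (h (y b))) (join (h (x b)) (h (y a)))) (ln l)"
        using that l0 pq0 l_pq by (simp add: meet_pq incident_iff)
      \<comment> \<open>A symbol contains its arrays with the rows exchanged; this only exchanges
        the two lines that are intersected.\<close>
      have "join P Q = join Q P" "meet m n = meet n m" for P Q m n
        by (simp_all add: join_def meet_def conj_commute)
      then have "meet (join (h (y a)) (h (x b))) (join (h (y b)) (h (x a))) = pt (pq a b)"
        using meet_pq[OF that] by metis
      then show "incident (meet (join (h (y a)) (h (x b))) (join (h (y b)) (h (x a)))) (ln l)"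
        using that l0 pq0 l_pq by (simp add: incident_iff)
    qed
    from s' consider \<sigma> where "bij \<sigma>" "x' = x \<circ> \<sigma>" "y' = y \<circ> \<sigma>" | \<sigma> where "bij \<sigma>" "x' = y \<circ> \<sigma>" "y' = x \<circ> \<sigma>"
      unfolding s array_class_def by blast
    then show ?thesis
    proof cases
      case 1
      then have "\<sigma> i' \<noteq> \<sigma> j'" using ij by (auto dest: bij_is_inj injD)
      from inc[OF this] show ?thesis by (simp add: 1)
    next
      case 2
      then have "\<sigma> i' \<noteq> \<sigma> j'" using ij by (auto dest: bij_is_inj injD)
      from inc'[OF this] show ?thesis by (simp add: 2)
    qed
  qed
  have xy: "(x, y) \<in> s" unfolding s array_class_def by (force intro: exI[of _ id])
  have "pascal_line s h = ln l" unfolding pascal_line_def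
  proof (rule the_equality)
    show "\<forall>(x, y)\<in>s. \<forall>i j. i < j \<longrightarrow> incident (meet (join (h (x i)) (h (y j))) (join (h (x j)) (h (y i)))) (ln l)"
      using inc by auto
    fix L assume L: "\<forall>(x, y)\<in>s. \<forall>i j. i < j \<longrightarrow> incident (meet (join (h (x i)) (h (y j))) (join (h (x j)) (h (y i)))) L"
    obtain m where m: "m \<noteq> 0" "L = ln m" by (rule ln_cases)
    have mpq: "dot m (pq a b) = 0" if "a < b" for a b
      using L xy that m pq0[of a b] by (force simp: meet_pq incident_iff)
    have mpq: "dot m (pq a b) = 0" if "a \<noteq> b" for a b
      using mpq[of a b] mpq[of b a] pq_swap[of a b] that by (auto simp: neq_iff dot_uminus)
    have c: "crs (pq i j) (pq i k) = (X i - Y i) *s l" unfolding pq_def l_def by (rule crs_crs_chord)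
    have "X i - Y i \<noteq> 0" using d by auto
    then have c0: "crs (pq i j) (pq i k) \<noteq> 0" using l0 unfolding c by (simp add: vector_mul_eq_0)
    obtain r where r: "m = r *s ((X i - Y i) *s l)"
      using proportional_crs[OF c0, of m] mpq ijk unfolding c by blast
    then have "m = (r * (X i - Y i)) *s l" by (simp add: vec_eq_iff mult.assoc algebra_simps)
    moreover from this m(1) have "r * (X i - Y i) \<noteq> 0" by auto
    ultimately show "L = ln l" unfolding m(2) using l0 by (simp add: ln_scale)
  qed
  then show "pascal_line s h = ln (axis3 (t (x i)) (t (x j)) (t (x k)) (t (y i)) (t (y j)) (t (y k)))"
    "axis3 (t (x i)) (t (x j)) (t (x k)) (t (y i)) (t (y j)) (t (y k)) \<noteq> 0"
    using l0 by (simp_all add: l_def X_def Y_def)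
qed

section \<open>Sextuples in affine coordinates\<close>

lemma reg_param:
  assumes "mor S x f" "x \<in> S" "affine_pt N (f x)"
  shows "reg S x (\<lambda>y. param N (f y))" "eventually (\<lambda>y. affine_pt N (f y)) (nz S x)"
proof -
  obtain j where j: "coord_nonzero j (f x)" using coord_nonzero_exists by blast
  note c = reg_coord_ratio[OF assms(1,2) j]
  define l where "l k y = (\<Sum>i\<in>UNIV. N $ k $ i * coord_ratio i j (f y))" for k y
  have regl: "reg S x (l k)" for k unfolding l_def by (intro reg_sum reg_mult reg_const c(1))
  have l: "affine_pt N (f y) \<longleftrightarrow> l 1 y \<noteq> 0" "param N (f y) = l 2 y / l 1 y" if "coord_nonzero j (f y)" for y
  proof -
    obtain v where v: "v \<noteq> 0" "f y = abs_proj v" using proj_cases by blast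
    have vj: "v $ j \<noteq> 0" using that v by (simp add: coord_nonzero_abs_proj)
    have "l k y = (N *v v) $ k / v $ j" for k
      using v by (simp add: l_def coord_ratio_abs_proj matrix_vector_mult_def sum_divide_distrib)
    then show "affine_pt N (f y) \<longleftrightarrow> l 1 y \<noteq> 0" "param N (f y) = l 2 y / l 1 y"
      using v vj by (simp_all add: affine_pt_abs_proj param_abs_proj)
  qed
  have l1: "l 1 x \<noteq> 0" using l(1)[OF j] assms(3) by simp
  have e: "eventually (\<lambda>y. param N (f y) = l 2 y / l 1 y) (nz S x)" using c(2) by eventually_elim (rule l(2))
  show "reg S x (\<lambda>y. param N (f y))"
    by (rule reg_eq_cong[OF reg_divide[OF regl regl assms(2) l1] e])
  show "eventually (\<lambda>y. affine_pt N (f y)) (nz S x)"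
    using c(2) reg_nonzero[OF regl assms(2) l1] by eventually_elim (simp add: l)
qed

definition affine_at :: "complex^3^3 \<Rightarrow> sextuple \<Rightarrow> bool" where
  "affine_at N h \<longleftrightarrow> (\<forall>a. affine_pt N (h a))"

text \<open>On the affine part of the conic this is the equation of the diagonal of two
  letters.\<close>

definition gap :: "complex^3^3 \<Rightarrow> letter \<times> letter \<Rightarrow> sextuple \<Rightarrow> complex" where
  "gap N k h = param N (h (fst k)) - param N (h (snd k))"

lemma eventually_affine_at:
  assumes "\<And>a. mor S x (\<lambda>y. f y a)" "x \<in> S" "affine_at N (f x)"
  shows "eventually (\<lambda>y. affine_at N (f y)) (nz S x)"
  unfolding affine_at_def using reg_param(2)[OF assms(1,2)] assms(3)
  by (simp add: eventually_all_finite affine_at_def)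

lemma mor_comp_right: "mor S h (\<lambda>u. u \<circ> \<theta>)"
  unfolding o_def by (intro mor_fun mor_eval_id)

lemma reg_gap: "h \<in> S \<Longrightarrow> affine_at N h \<Longrightarrow> reg S h (gap N k)"
  unfolding gap_def affine_at_def by (intro reg_diff reg_param(1) mor_eval_id) auto

text \<open>Distinctness is an open condition: no new coincidences appear near
  \<open>h\<close>.\<close>

lemma eventually_neq:
  fixes h :: sextuple
  assumes "h \<in> S"
  shows "eventually (\<lambda>u. \<forall>a b. u a = u b \<longrightarrow> h a = h b) (nz S h)"
proof -
  have "eventually (\<lambda>u. u a = u b \<longrightarrow> h a = h b) (nz S h)" for a b
  proof (cases "h a = h b")
    case False
    from mor_proj_separated[of S h "\<lambda>u. u a" "\<lambda>u. u b", OF mor_eval_id mor_eval_id assms False] show ?thesis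
      by eventually_elim simp
  qed simp
  then show ?thesis by (simp add: eventually_all_finite)
qed

section \<open>Ideals of polydiagonals in a conic frame\<close>

context conic_frame
begin

lemma param_eq_iff:
  assumes "P \<in> K" "affine_pt N P" "Q \<in> K" "affine_pt N Q"
  shows "param N P = param N Q \<longleftrightarrow> P = Q"
  using pt_vand_param[OF assms(1,2)] pt_vand_param[OF assms(3,4)] by metis

lemma gap_eq_0_iff:
  assumes "h \<in> sextuples K" "affine_at N h"
  shows "gap N (a, b) h = 0 \<longleftrightarrow> h a = h b"
  using param_eq_iff[of "h a" "h b"] assms by (auto simp: gap_def affine_at_def sextuples_def)

text \<open>On the conic a coordinate ratio is a quotient of quadratic polynomials in the parameter,
  whose differences at \<open>s\<close> and \<open>t\<close> are divisible by \<open>s - t\<close>.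
  Congruences of parameters thus pass to the coordinates of the standard charts.\<close>

lemma ideal_at_coord_ratio_diff:
  assumes fg: "mor S x f" "mor S x g" and x: "x \<in> S" and eq: "f x = g x"
    and aff: "affine_pt N (f x)" and K: "eventually (\<lambda>y. f y \<in> K \<and> g y \<in> K) (nz S x)"
    and I: "ideal_at S x I z (\<lambda>y. param N (f y) - param N (g y))" and j: "coord_nonzero j (f x)"
  shows "ideal_at S x I z (\<lambda>y. coord_ratio i j (f y) - coord_ratio i j (g y))"
proof -
  define s where "s y = param N (f y)" for y
  define t where "t y = param N (g y)" for y
  have st: "reg S x s" "reg S x t"
    unfolding s_def t_def using reg_param(1)[OF fg(1) x aff] reg_param(1)[OF fg(2) x] aff eq by auto
  define c where "c k r = (M *v vand r) $ k" for k r
  have c: "c k r = M $ k $ 1 + M $ k $ 2 * r + M $ k $ 3 * r\<^sup>2" for k r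
    by (simp add: c_def matrix_vector_mult_def vand_def sum_3)
  have regc: "reg S x (\<lambda>y. c k (s y))" "reg S x (\<lambda>y. c k (t y))" for k
    unfolding c by (intro reg_intros st)+
  have ratio: "coord_ratio i j P = c i (param N P) / c j (param N P)" "coord_nonzero j P \<longleftrightarrow> c j (param N P) \<noteq> 0"
    if "P \<in> K" "affine_pt N P" for P
  proof -
    have P: "P = abs_proj (M *v vand (param N P))" using pt_vand_param[OF that] by (simp add: pt_def)
    have nz: "M *v vand (param N P) \<noteq> 0" by (intro M_nonzero vand_nonzero)
    show "coord_ratio i j P = c i (param N P) / c j (param N P)"
      by (subst P, subst coord_ratio_abs_proj[OF nz]) (simp add: c_def)
    show "coord_nonzero j P \<longleftrightarrow> c j (param N P) \<noteq> 0"
      by (subst P, subst coord_nonzero_abs_proj[OF nz]) (simp add: c_def)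
  qed
  have diff: "ideal_at S x I z (\<lambda>y. c k (s y) - c k (t y))" for k
  proof (rule ideal_at_cong)
    show "ideal_at S x I z (\<lambda>y. (M $ k $ 2 + M $ k $ 3 * (s y + t y)) * (s y - t y))"
      using I unfolding s_def[symmetric] t_def[symmetric] by (intro ideal_at_mult reg_intros st)
  qed (simp add: c power2_eq_square algebra_simps)
  have cj: "c j (s x) \<noteq> 0" "c j (t x) \<noteq> 0"
    using ratio(2)[of "f x"] eventually_nz_at[OF K x] aff j eq by (simp_all add: s_def t_def)
  have "ideal_at S x I z (\<lambda>y. c i (s y) / c j (s y) - c i (t y) / c j (t y))"
    by (rule ideal_at_quotient_diff[OF diff diff regc(2) regc(2) regc(1) regc(1) x cj(2,1)])
  moreover have "eventually (\<lambda>y. coord_ratio i j (f y) - coord_ratio i j (g y) =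
      c i (s y) / c j (s y) - c i (t y) / c j (t y)) (nz S x)"
    using K reg_param(2)[OF fg(1) x aff] reg_param(2)[OF fg(2) x aff[unfolded eq]]
    by eventually_elim (simp add: ratio(1) s_def t_def)
  ultimately show ?thesis by (rule ideal_at_cong)
qed

lemma ideal_at_chart_diff:
  assumes S: "S \<subseteq> sextuples K" "h \<in> S" and aff: "affine_at N h" and \<theta>: "h \<circ> \<theta> = h"
    and I: "\<And>a. ideal_at S h I z (\<lambda>u. param N (u (\<theta> a)) - param N (u a))"
    and c: "(V, \<Phi>) \<in> charts" "h \<in> V" "\<phi> \<in> \<Phi>"
  shows "ideal_at S h I z (\<lambda>u. \<phi> (u \<circ> \<theta>) - \<phi> u)"
proof -
  obtain V0 and \<Phi>0 :: "letter \<Rightarrow> (point \<Rightarrow> complex) set" where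
    d: "V = {h. \<forall>a. h a \<in> V0 a}" "\<Phi> = {\<lambda>h. \<phi> (h a) | a \<phi>. \<phi> \<in> \<Phi>0 a}" "\<And>a. (V0 a, \<Phi>0 a) \<in> charts"
    using c(1) by (auto simp: charts_fun_def)
  obtain a \<psi> where a: "\<phi> = (\<lambda>h. \<psi> (h a))" "\<psi> \<in> \<Phi>0 a" using c(3) d(2) by auto
  obtain j where j: "V0 a = {P. coord_nonzero j P}" "\<Phi>0 a = range (\<lambda>i. coord_ratio i j)"
    using d(3)[of a] by (auto simp: charts_proj_def)
  obtain i where i: "\<psi> = coord_ratio i j" using a j by auto
  have ha: "h (\<theta> a) = h a" using \<theta> by (metis comp_apply)
  have hj: "coord_nonzero j (h a)" using c(2) d(1) j(1) by auto
  have "ideal_at S h I z (\<lambda>u. coord_ratio i j (u (\<theta> a)) - coord_ratio i j (u a))"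
  proof (rule ideal_at_coord_ratio_diff[OF mor_eval_id mor_eval_id S(2) ha _ _ I])
    show "affine_pt N (h (\<theta> a))" using aff by (simp add: affine_at_def)
    show "eventually (\<lambda>u. u (\<theta> a) \<in> K \<and> u a \<in> K) (nz S h)"
      by (rule eventually_mono[OF eventually_nz_self]) (use S(1) in \<open>auto simp: sextuples_def\<close>)
    show "coord_nonzero j (h (\<theta> a))" using hj ha by simp
  qed
  then show ?thesis by (simp add: a i)
qed

text \<open>The map \<open>u \<mapsto> u \<circ> \<theta>\<close> retracts a neighbourhood of
  \<open>h\<close> onto the polydiagonal and changes each parameter by zero or by one of the gaps in
  \<open>I\<close>.\<close>

lemma generates_at_diagonal:
  assumes S: "S \<subseteq> sextuples K" "h \<in> S" and aff: "affine_at N h" and I: "finite I"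
    and \<theta>: "h \<circ> \<theta> = h" "\<And>a. \<theta> a = a \<or> (\<theta> a, a) \<in> I" "eventually (\<lambda>u. u \<circ> \<theta> \<in> S \<inter> T) (nz S h)"
    and T: "eventually (\<lambda>u. u \<in> T \<longrightarrow> (\<forall>(a, b)\<in>I. u a = u b)) (nz S h)"
  shows "generates_at S T h I (gap N)"
  unfolding generates_at_def
proof (intro conjI ballI allI impI)
  fix k assume k: "k \<in> I"
  show "reg S h (gap N k)" using S(2) aff by (rule reg_gap)
  show "eventually (\<lambda>u. u \<in> T \<longrightarrow> gap N k u = 0) (nz S h)"
    using T by eventually_elim (use k in \<open>auto simp: gap_def\<close>)
next
  fix g assume g: "reg S h g" "eventually (\<lambda>u. u \<in> T \<longrightarrow> g u = 0) (nz S h)"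
  have "ideal_at S h I (gap N) (\<lambda>u. param N (u (\<theta> a)) - param N (u a))" for a
  proof (cases "\<theta> a = a")
    case True
    then show ?thesis by (simp add: ideal_at_zero)
  next
    case False
    then show ?thesis using ideal_at_generator[OF I, of "(\<theta> a, a)" S h "gap N"] \<theta>(2)[of a]
      by (simp add: gap_def[abs_def])
  qed
  note diff = ideal_at_chart_diff[OF S aff \<theta>(1) this]
  obtain V and \<Phi> :: "(sextuple \<Rightarrow> complex) set" where c: "(V, \<Phi>) \<in> charts" "h \<in> V" using chart_cover by blast
  have ev: "eventually (\<lambda>u. True \<longrightarrow> u \<circ> \<theta> \<in> S \<inter> T) (nz S h)" using \<theta>(3) by simp
  have dn: "\<exists>\<^sub>F v in nz S u. True" if "u \<in> S" for u
    using that eventually_nz_at[of "\<lambda>_. False" S u] by (auto simp: frequently_def)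
  show "ideal_at S h I (gap N) g"
    by (rule ideal_at_retraction(3)[OF c S(2) mor_comp_right \<theta>(1) diff[OF c] g dn ev])
qed

text \<open>Moving the six points along the conic with pairwise different speeds makes them distinct.\<close>

lemma injective_dense:
  assumes "h \<in> sextuples K" "affine_at N h" and S: "\<And>u. u \<in> sextuples K \<Longrightarrow> inj u \<Longrightarrow> u \<in> S"
  shows "\<exists>\<^sub>F u in nz S h. inj u"
  unfolding frequently_def
proof
  assume ev: "eventually (\<lambda>u. \<not> inj u) (nz S h)"
  define d :: "letter \<Rightarrow> complex" where
    "d a = (case a of LA \<Rightarrow> 0 | LB \<Rightarrow> 1 | LC \<Rightarrow> 2 | LD \<Rightarrow> 3 | LE \<Rightarrow> 4 | LF \<Rightarrow> 5)" for a
  have d: "d a = d b \<longleftrightarrow> a = b" for a b by (cases a; cases b) (simp_all add: d_def)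
  define t where "t a = param N (h a)" for a
  define \<gamma> where "\<gamma> r a = pt (vand (t a + r * d a))" for r a
  have h: "h a = pt (vand (t a))" for a
    unfolding t_def using assms by (intro pt_vand_param) (auto simp: sextuples_def affine_at_def)
  have \<gamma>0: "\<gamma> 0 = h" by (simp add: \<gamma>_def h fun_eq_iff)
  obtain V and \<Phi> :: "(sextuple \<Rightarrow> complex) set" where c: "(V, \<Phi>) \<in> charts" "h \<in> V" using chart_cover by blast
  then obtain q where q: "q \<in> polynomials \<Phi>" "q h \<noteq> 0" "\<forall>u\<in>S \<inter> V. q u \<noteq> 0 \<longrightarrow> \<not> inj u"
    using ev unfolding eventually_nz_chart[OF c] by blast
  obtain V0 and \<Phi>0 :: "letter \<Rightarrow> (point \<Rightarrow> complex) set" where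
    e: "V = {h. \<forall>a. h a \<in> V0 a}" "\<Phi> = {\<lambda>h. \<phi> (h a) | a \<phi>. \<phi> \<in> \<Phi>0 a}" "\<And>a. (V0 a, \<Phi>0 a) \<in> charts"
    using c(1) by (auto simp: charts_fun_def)
  have "\<forall>a. \<exists>j. V0 a = {P. coord_nonzero j P} \<and> \<Phi>0 a = range (\<lambda>i. coord_ratio i j)"
  proof
    fix a show "\<exists>j. V0 a = {P. coord_nonzero j P} \<and> \<Phi>0 a = range (\<lambda>i. coord_ratio i j)"
      using e(3)[of a] by (auto simp: charts_proj_def)
  qed
  then obtain j where j: "\<And>a. V0 a = {P. coord_nonzero (j a) P}" "\<And>a. \<Phi>0 a = range (\<lambda>i. coord_ratio i (j a))"
    by metis
  define m where "m a k r = (M *v vand (t a + r * d a)) $ k" for a k r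
  have m: "m a k r = M $ k $ 1 + M $ k $ 2 * (t a + r * d a) + M $ k $ 3 * (t a + r * d a)\<^sup>2" for a k r
    by (simp add: m_def matrix_vector_mult_def vand_def sum_3)
  have contm: "isCont (m a k) 0" for a k unfolding m by (intro continuous_intros)
  have nz: "M *v vand r \<noteq> 0" for r by (intro M_nonzero vand_nonzero)
  have cr: "coord_nonzero k (\<gamma> r a) \<longleftrightarrow> m a k r \<noteq> 0" "coord_ratio i k (\<gamma> r a) = m a i r / m a k r" for i k r a
    by (simp_all add: \<gamma>_def pt_def m_def coord_nonzero_abs_proj[OF nz] coord_ratio_abs_proj[OF nz])
  have mj: "m a (j a) 0 \<noteq> 0" for a using c(2) \<gamma>0 cr(1)[of "j a" 0 a] by (auto simp: e(1) j(1))
  have evV: "eventually (\<lambda>r. \<gamma> r \<in> V) (at 0)"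
  proof -
    have "eventually (\<lambda>r. m a (j a) r \<noteq> 0) (at 0)" for a
      using contm[of a "j a"] mj[of a] by (auto simp: isCont_def intro: tendsto_imp_eventually_ne)
    then show ?thesis by (simp add: e(1) j(1) cr(1) eventually_all_finite)
  qed
  \<comment> \<open>Along the curve \<open>\<gamma>\<close> a Zariski neighbourhood of
    \<open>h\<close> becomes an ordinary open condition on \<open>r\<close>, so a small nonzero
    \<open>r\<close> meets all requirements.\<close>
  have "isCont (\<lambda>r. q (\<gamma> r)) 0" using q(1)
  proof induction
    case (coord \<phi>)
    then obtain a i where \<phi>: "\<phi> = (\<lambda>h. coord_ratio i (j a) (h a))" unfolding e(2) j(2) by auto
    show ?case unfolding \<phi> cr using mj contm by (intro continuous_intros) auto
  qed (auto intro: continuous_intros)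
  then have evq: "eventually (\<lambda>r. q (\<gamma> r) \<noteq> 0) (at 0)"
    using q(2) \<gamma>0 by (auto simp: isCont_def intro: tendsto_imp_eventually_ne)
  have evi: "eventually (\<lambda>r. inj (\<gamma> r)) (at 0)"
  proof -
    have ne: "eventually (\<lambda>r. a \<noteq> b \<longrightarrow> t a + r * d a \<noteq> t b + r * d b) (at 0)" for a b
    proof (cases "t a = t b")
      case True
      have "eventually (\<lambda>r::complex. r \<noteq> 0) (at 0)" by (simp add: eventually_at_filter)
      then show ?thesis by eventually_elim (use True d[of a b] in auto)
    next
      case False
      have "isCont (\<lambda>r. (t a + r * d a) - (t b + r * d b)) 0" by (intro continuous_intros)
      then have "eventually (\<lambda>r. (t a + r * d a) - (t b + r * d b) \<noteq> 0) (at 0)"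
        using False tendsto_imp_eventually_ne[of "\<lambda>r. (t a + r * d a) - (t b + r * d b)" "t a - t b" "at 0" 0]
        by (simp add: isCont_def)
      then show ?thesis by eventually_elim auto
    qed
    then have "eventually (\<lambda>r. \<forall>a b. a \<noteq> b \<longrightarrow> t a + r * d a \<noteq> t b + r * d b) (at 0)"
      by (simp add: eventually_all_finite)
    then show ?thesis
    proof eventually_elim
      case (elim r)
      show ?case
      proof (rule injI)
        fix a b assume "\<gamma> r a = \<gamma> r b"
        then have "t a + r * d a = t b + r * d b" unfolding \<gamma>_def by (metis pt_vand(3))
        with elim show "a = b" by blast
      qed
    qed
  qed
  have "eventually (\<lambda>r::complex. False) (at 0)"
    using evV evq evi
  proof eventually_elim
    case (elim r)
    have "\<gamma> r \<in> sextuples K" by (auto simp: \<gamma>_def sextuples_def pt_vand(1))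
    with elim q(3) S show ?case by blast
  qed
  then show False by (simp add: trivial_limit_at)
qed

end

section \<open>Partitions of the letters\<close>

lemma UNIV_letter: "(UNIV :: letter set) = {LA, LB, LC, LD, LE, LF}"
  using letter.exhaust by auto

lemma card_letter: "card (UNIV :: letter set) = 6"
  by (simp add: UNIV_letter)

lemma letters_cover:
  fixes a b c d e f :: letter
  assumes "distinct [a, b, c, d, e, f]"
  shows "UNIV = {a, b, c, d, e, f}"
proof -
  have "card {a, b, c, d, e, f} = 6" using assms by simp
  then show ?thesis using card_subset_eq[of UNIV "{a, b, c, d, e, f}"] by (simp add: card_letter)
qed

lemma extend_letters:
  fixes xs :: "letter list"
  assumes "distinct xs"
  obtains ys where "distinct (xs @ ys)" "length (xs @ ys) = 6"
proof -
  obtain ys where ys: "set ys = UNIV - set xs" "distinct ys"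
    using finite_distinct_list[of "UNIV - set xs"] by auto
  have d: "distinct (xs @ ys)" using assms ys by auto
  have "set (xs @ ys) = UNIV" using ys by auto
  then have "length (xs @ ys) = 6" using distinct_card[OF d] by (simp add: card_letter)
  with d that show ?thesis by blast
qed

lemma count_blocks:
  fixes \<pi> :: "letter set set"
  assumes "\<pi> \<in> partitions_of_type \<tau>"
  shows "card {A \<in> \<pi>. card A = n} = count \<tau> n"
proof -
  have "count \<tau> n = count (image_mset card (mset_set \<pi>)) n"
    using assms by (simp add: partitions_of_type_def)
  also have "\<dots> = (\<Sum>A\<in>card -` {n} \<inter> \<pi>. count (mset_set \<pi>) A)"
    by (simp add: count_image_mset)
  also have "\<dots> = (\<Sum>A\<in>card -` {n} \<inter> \<pi>. 1)" by (intro sum.cong) auto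
  also have "card -` {n} \<inter> \<pi> = {A \<in> \<pi>. card A = n}" by auto
  finally show ?thesis by simp
qed

lemma blocks_disjoint:
  assumes "\<pi> \<in> partitions_of_type \<tau>" "A \<in> \<pi>" "B \<in> \<pi>" "A \<noteq> B"
  shows "A \<inter> B = {}"
proof -
  have "partition_on UNIV \<pi>" using assms(1) unfolding partitions_of_type_def by blast
  then show ?thesis using assms(2-4) by (intro disjointD[OF partition_onD2])
qed

lemma polydiagonal_eq: "h \<in> polydiagonal K \<pi> \<Longrightarrow> A \<in> \<pi> \<Longrightarrow> a \<in> A \<Longrightarrow> b \<in> A \<Longrightarrow> h a = h b"
  unfolding polydiagonal_def by blast

lemma types_of_letters:
  fixes a b c d e f :: letter
  assumes "distinct [a, b, c, d, e, f]"
  shows "{{a, b, c}, {d, e}, {f}} \<in> partitions_of_type {#3, 2, 1#}"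
    "{{a, b, c, d}, {e}, {f}} \<in> partitions_of_type {#4, 1, 1#}"
    "{{a, b}, {c, d}, {e, f}} \<in> partitions_of_type {#2, 2, 2#}"
    "{{a, b}, {c, d}, {e}, {f}} \<in> partitions_of_type {#2, 2, 1, 1#}"
    "{{a, b, c}, {d}, {e}, {f}} \<in> partitions_of_type {#3, 1, 1, 1#}"
proof -
  have [simp]: "a \<noteq> b" "a \<noteq> c" "a \<noteq> d" "a \<noteq> e" "a \<noteq> f" "b \<noteq> c" "b \<noteq> d" "b \<noteq> e" "b \<noteq> f"
    "c \<noteq> d" "c \<noteq> e" "c \<noteq> f" "d \<noteq> e" "d \<noteq> f" "e \<noteq> f"
    using assms by auto
  note [simp] = this[symmetric]
  note U = letters_cover[OF assms]
  have ne: "A \<noteq> B" if "x \<in> A" "x \<notin> B" for x :: letter and A B using that by auto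
  have N: "{a, b, c} \<noteq> {d, e}" "{a, b, c} \<noteq> {f}" "{a, b, c, d} \<noteq> {e}" "{a, b, c, d} \<noteq> {f}"
    "{a, b} \<noteq> {c, d}" "{a, b} \<noteq> {e, f}" "{a, b} \<noteq> {e}" "{a, b} \<noteq> {f}" "{a, b, c} \<noteq> {d}" "{a, b, c} \<noteq> {e}"
    by (rule ne[of a], simp, simp)+
  have N': "{d, e} \<noteq> {f}" "{c, d} \<noteq> {e, f}" "{c, d} \<noteq> {e}" "{c, d} \<noteq> {f}"
    by (rule ne[of d], simp, simp)+
  have I: "P \<in> partitions_of_type \<tau>"
    if "\<Union>P = UNIV" "disjoint P" "{} \<notin> P" "image_mset card (mset_set P) = \<tau>" for P \<tau>
    using that by (simp add: partitions_of_type_def partition_on_def)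
  show "{{a, b, c}, {d, e}, {f}} \<in> partitions_of_type {#3, 2, 1#}"
    by (rule I, (simp add: U, blast), simp add: disjoint_def, simp, simp add: N N' numeral_eq_Suc)
  show "{{a, b, c, d}, {e}, {f}} \<in> partitions_of_type {#4, 1, 1#}"
    by (rule I, (simp add: U, blast), simp add: disjoint_def, simp, simp add: N N' numeral_eq_Suc)
  show "{{a, b}, {c, d}, {e, f}} \<in> partitions_of_type {#2, 2, 2#}"
    by (rule I, (simp add: U, blast), simp add: disjoint_def, simp, simp add: N N' numeral_eq_Suc)
  show "{{a, b}, {c, d}, {e}, {f}} \<in> partitions_of_type {#2, 2, 1, 1#}"
    by (rule I, (simp add: U, blast), simp add: disjoint_def, simp, simp add: N N' numeral_eq_Suc)
  show "{{a, b, c}, {d}, {e}, {f}} \<in> partitions_of_type {#3, 1, 1, 1#}"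
    by (rule I, (simp add: U, blast), simp add: disjoint_def, simp, simp add: N N' numeral_eq_Suc)
qed

lemma sextuples0_D:
  assumes "h \<in> sextuples0 K" "distinct [a, b, c, d, e, f]"
  shows "\<not> (h a = h b \<and> h b = h c \<and> h d = h e)" "\<not> (h a = h b \<and> h b = h c \<and> h c = h d)"
proof -
  have h: "h \<in> sextuples K" "h \<notin> polydiagonal K {{a, b, c}, {d, e}, {f}}" "h \<notin> polydiagonal K {{a, b, c, d}, {e}, {f}}"
    using assms(1) types_of_letters(1,2)[OF assms(2)] unfolding sextuples0_def by blast+
  show "\<not> (h a = h b \<and> h b = h c \<and> h d = h e)" "\<not> (h a = h b \<and> h b = h c \<and> h c = h d)"
    using h by (auto simp: polydiagonal_def)
qed

text \<open>Each excluded type has exactly one block of size 3 or of size 4, and an injective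
  sextuple cannot be constant on it.\<close>

lemma inj_sextuples0:
  assumes "h \<in> sextuples K" "inj h"
  shows "h \<in> sextuples0 K"
proof -
  have False if "\<mu> \<in> partitions_of_type \<tau>" "h \<in> polydiagonal K \<mu>" "count \<tau> n = 1" "n \<ge> 2" for \<mu> \<tau> n
  proof -
    have "card {A \<in> \<mu>. card A = n} = 1" using count_blocks[OF that(1)] that(3) by simp
    then obtain A where A: "A \<in> \<mu>" "card A = n" by (auto simp: card_1_singleton_iff)
    have "\<not> is_singleton A" "A \<noteq> {}" using A(2) that(4) by (auto simp: is_singleton_altdef)
    then obtain a b where "a \<in> A" "b \<in> A" "a \<noteq> b" by (metis all_not_in_conv is_singletonI')
    with polydiagonal_eq[OF that(2) A(1)] assms(2) show False by (meson injD)
  qed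
  from this[of _ "{#3, 2, 1#}" 3] this[of _ "{#4, 1, 1#}" 4] show ?thesis
    using assms(1) unfolding sextuples0_def by auto
qed

lemma center_Z_iff:
  "h \<in> center_Z K \<longleftrightarrow> h \<in> sextuples0 K \<and>
     (\<exists>a b c d e f. distinct [a, b, c, d, e, f] \<and> h a = h b \<and> h c = h d \<and> h e = h f)" (is "_ \<longleftrightarrow> ?R")
proof
  assume "h \<in> center_Z K"
  then obtain \<pi> where \<pi>: "\<pi> \<in> partitions_of_type {#2, 2, 2#}" "h \<in> polydiagonal K \<pi>" "h \<in> sextuples0 K"
    unfolding center_Z_def polydiagonal0_def by blast
  have "card {A \<in> \<pi>. card A = 2} = 3" using count_blocks[OF \<pi>(1)] by simp
  then obtain A B C where "{A \<in> \<pi>. card A = 2} = {A, B, C}" "A \<noteq> B" "A \<noteq> C" "B \<noteq> C"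
    unfolding card_3_iff by blast
  then have ABC: "A \<in> \<pi>" "B \<in> \<pi>" "C \<in> \<pi>" "A \<noteq> B" "A \<noteq> C" "B \<noteq> C" "card A = 2" "card B = 2" "card C = 2"
    by blast+
  note dis = blocks_disjoint[OF \<pi>(1) ABC(1,2,4)] blocks_disjoint[OF \<pi>(1) ABC(1,3,5)] blocks_disjoint[OF \<pi>(1) ABC(2,3,6)]
  obtain a b where A: "A = {a, b}" "a \<noteq> b" using ABC(7) unfolding card_2_iff by blast
  obtain c d where B: "B = {c, d}" "c \<noteq> d" using ABC(8) unfolding card_2_iff by blast
  obtain e f where C: "C = {e, f}" "e \<noteq> f" using ABC(9) unfolding card_2_iff by blast
  have "distinct [a, b, c, d, e, f]" using dis A B C by auto
  moreover have "h a = h b" "h c = h d" "h e = h f"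
    using polydiagonal_eq[OF \<pi>(2) ABC(1), of a b] polydiagonal_eq[OF \<pi>(2) ABC(2), of c d]
      polydiagonal_eq[OF \<pi>(2) ABC(3), of e f] A B C by simp_all
  ultimately show ?R using \<pi>(3) by blast
next
  assume ?R
  then obtain a b c d e f where *: "h \<in> sextuples0 K" "distinct [a, b, c, d, e, f]" "h a = h b" "h c = h d" "h e = h f"
    by blast
  then have "h \<in> polydiagonal K {{a, b}, {c, d}, {e, f}}"
    by (auto simp: polydiagonal_def sextuples0_def)
  then show "h \<in> center_Z K" unfolding center_Z_def polydiagonal0_def
    using types_of_letters(3)[OF *(2)] *(1) by blast
qed

lemma center_Y_iff:
  "h \<in> center_Y K \<longleftrightarrow> h \<in> sextuples0 K \<and>
     (\<exists>a b c d e f. distinct [a, b, c, d, e, f] \<and> h a = h b \<and> (h c = h d \<or> h b = h c))" (is "_ \<longleftrightarrow> ?R")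
proof
  assume "h \<in> center_Y K"
  then consider \<pi> where "\<pi> \<in> partitions_of_type {#2, 2, 1, 1#}" "h \<in> polydiagonal K \<pi>" "h \<in> sextuples0 K"
    | \<pi> where "\<pi> \<in> partitions_of_type {#3, 1, 1, 1#}" "h \<in> polydiagonal K \<pi>" "h \<in> sextuples0 K"
    unfolding center_Y_def polydiagonal0_def by blast
  then show ?R
  proof cases
    case (1 \<pi>)
    have "card {A \<in> \<pi>. card A = 2} = 2" using count_blocks[OF 1(1)] by simp
    then obtain A B where "{A \<in> \<pi>. card A = 2} = {A, B}" "A \<noteq> B"
      using card_2_iff[of "{A \<in> \<pi>. card A = 2}"] by blast
    then have AB: "A \<in> \<pi>" "B \<in> \<pi>" "A \<noteq> B" "card A = 2" "card B = 2" by blast+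
    note dis = blocks_disjoint[OF 1(1) AB(1,2,3)]
    obtain a b where l: "A = {a, b}" "a \<noteq> b" using AB(4) unfolding card_2_iff by blast
    obtain c d where l': "B = {c, d}" "c \<noteq> d" using AB(5) unfolding card_2_iff by blast
    have "distinct [a, b, c, d]" using dis l l' by auto
    then obtain ys where ys: "distinct ([a, b, c, d] @ ys)" "length ([a, b, c, d] @ ys) = 6" by (rule extend_letters)
    then obtain e f where "ys = [e, f]" by (auto simp: length_Suc_conv numeral_eq_Suc)
    with ys have "distinct [a, b, c, d, e, f]" by simp
    moreover have "h a = h b" "h c = h d"
      using polydiagonal_eq[OF 1(2) AB(1), of a b] polydiagonal_eq[OF 1(2) AB(2), of c d] l l' by simp_all
    ultimately show ?thesis using 1(3) by blast
  next
    case (2 \<pi>)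
    have "card {A \<in> \<pi>. card A = 3} = 1" using count_blocks[OF 2(1)] by simp
    then obtain A where A: "A \<in> \<pi>" "card A = 3" by (auto simp: card_1_singleton_iff)
    obtain a b c where l: "A = {a, b, c}" "a \<noteq> b" "a \<noteq> c" "b \<noteq> c"
      using A(2) unfolding card_3_iff by blast
    then have "distinct [a, b, c]" by auto
    then obtain ys where ys: "distinct ([a, b, c] @ ys)" "length ([a, b, c] @ ys) = 6" by (rule extend_letters)
    then obtain d e f where "ys = [d, e, f]" by (auto simp: length_Suc_conv numeral_eq_Suc)
    with ys have "distinct [a, b, c, d, e, f]" by simp
    moreover have "h a = h b" "h b = h c"
      using polydiagonal_eq[OF 2(2) A(1), of a b] polydiagonal_eq[OF 2(2) A(1), of b c] l by simp_all
    ultimately show ?thesis using 2(3) by blast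
  qed
next
  assume ?R
  then obtain a b c d e f where *: "h \<in> sextuples0 K" "distinct [a, b, c, d, e, f]" "h a = h b" "h c = h d \<or> h b = h c"
    by blast
  from *(4) have "h \<in> polydiagonal K {{a, b}, {c, d}, {e}, {f}} \<or> h \<in> polydiagonal K {{a, b, c}, {d}, {e}, {f}}"
    using *(1,3) by (auto simp: polydiagonal_def sextuples0_def)
  then show "h \<in> center_Y K" unfolding center_Y_def polydiagonal0_def
    using types_of_letters(4,5)[OF *(2)] *(1) by blast
qed

text \<open>For each excluded partition \<open>h\<close> separates two letters \<open>a\<close>,
  \<open>b\<close> of a block, hence also \<open>\<theta> a\<close> and \<open>\<theta> b\<close>;
  near \<open>h\<close> these stay separated, which keeps the merged sextuple off the excluded
  polydiagonal.\<close>

lemma eventually_comp_sextuples0: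
  assumes "h \<in> sextuples0 K" "h \<circ> \<theta> = h"
  shows "eventually (\<lambda>u. u \<circ> \<theta> \<in> sextuples0 K) (nz (sextuples0 K) h)"
proof -
  define P where "P = partitions_of_type {#3, 2, 1#} \<union> partitions_of_type {#4, 1, 1#}"
  have "eventually (\<lambda>u. u \<circ> \<theta> \<notin> polydiagonal K \<mu>) (nz (sextuples0 K) h)" if "\<mu> \<in> P" for \<mu>
  proof -
    have "h \<in> sextuples K" "h \<notin> polydiagonal K \<mu>" using assms(1) that by (auto simp: sextuples0_def P_def)
    then obtain A a b where A: "A \<in> \<mu>" "a \<in> A" "b \<in> A" "h a \<noteq> h b" unfolding polydiagonal_def by blast
    have "h (\<theta> a) \<noteq> h (\<theta> b)" using A(4) assms(2) by (metis comp_apply)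
    from eventually_neq[OF assms(1)] show ?thesis
    proof eventually_elim
      case (elim u)
      with \<open>h (\<theta> a) \<noteq> h (\<theta> b)\<close> have ne: "(u \<circ> \<theta>) a \<noteq> (u \<circ> \<theta>) b" by (metis comp_apply)
      show ?case
      proof
        assume "u \<circ> \<theta> \<in> polydiagonal K \<mu>"
        from polydiagonal_eq[OF this A(1-3)] ne show False by blast
      qed
    qed
  qed
  then have "eventually (\<lambda>u. \<forall>\<mu>\<in>P. u \<circ> \<theta> \<notin> polydiagonal K \<mu>) (nz (sextuples0 K) h)"
    by (simp add: eventually_ball_finite_distrib)
  then show ?thesis using eventually_nz_self
    by eventually_elim (auto simp: sextuples0_def P_def sextuples_def)
qed

section \<open>The base locus of the axis\<close>

lemma axis3_pairs:
  "axis3 x0 x1 x2 y0 y1 y2 =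
    (x0 - x1) *s axis_rows (y0, 1, 0, 0) (x1 * y1, x1, y1, 1) (x2 * y2, x2, y2, 1) +
    (y0 - y1) *s axis_rows (x1, 0, 1, 0) (x1 * y1, x1, y1, 1) (x2 * y2, x2, y2, 1)"
  \<comment> \<open>The difference of the first two rows is \<open>x0 - x1\<close> times
    \<open>(y0, 1, 0, 0)\<close> plus \<open>y0 - y1\<close> times
    \<open>(x1, 0, 1, 0)\<close>.\<close>
  by (simp add: axis_defs vec_eq_iff forall_3 algebra_simps)

text \<open>In the second and then the third row \<open>x\<close> is replaced by \<open>x0\<close>.
  Once all rows have the form \<open>(x0 * y, x0, y, 1)\<close>, they lie in a plane and the axis
  vanishes; the two corrections are the terms on the right.\<close>

lemma axis3_triple:
  "axis3 x0 x1 x2 y0 y1 y2 =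
    (x1 - x0) *s axis_rows (x0 * y0, x0, y0, 1) (y1, 1, 0, 0) (x2 * y2, x2, y2, 1) +
    (x2 - x0) *s axis_rows (x0 * y0, x0, y0, 1) (x0 * y1, x0, y1, 1) (y2, 1, 0, 0)"
  by (simp add: axis_defs vec_eq_iff forall_3 algebra_simps)

text \<open>Subtracting the column of the \<open>y\<close> from that of the \<open>x\<close> leaves
  the entries \<open>x - y\<close> and a zero in the row of \<open>z\<close>. Expansion along this
  column has as cofactors, up to sign, the determinants with rows \<open>(x * y, y, 1)\<close>,
  \<open>(x' * y', y', 1)\<close> and \<open>(z^2, z, 1)\<close>, whose coefficients in
  \<open>z\<close> are recorded here.\<close>

definition minor :: "complex \<Rightarrow> complex \<Rightarrow> complex \<Rightarrow> complex \<Rightarrow> complex^3" where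
  "minor x y x' y' = vector [x' * y' * y - x * y * y', x * y - x' * y', y' - y]"

lemma axis3_matching:
  "axis3 x0 x1 x2 y0 y1 y2 = (x0 - y0) *s minor x1 y1 x2 y2 +
    (x1 - y1) *s minor x2 y2 x0 y0 + (x2 - y2) *s minor x0 y0 x1 y1"
  by (simp add: axis_defs minor_def vec_eq_iff forall_3 algebra_simps)

text \<open>As quadratic polynomials in \<open>z\<close>, the first vector has the zeros
  \<open>x\<close> and \<open>b\<close>, the second \<open>y\<close> and \<open>a\<close>.
  Evaluation at \<open>a\<close> and at \<open>b\<close> isolates the coefficients.\<close>

lemma pairs_independent:
  assumes "c *s axis_rows (b, 1, 0, 0) (a * b, a, b, 1) (x * y, x, y, 1) +
      d *s axis_rows (a, 0, 1, 0) (a * b, a, b, 1) (x * y, x, y, 1) = 0" (is "c *s ?P + d *s ?Q = 0")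
    and "a \<noteq> b" "x \<noteq> a" "y \<noteq> b"
  shows "c = 0 \<and> d = 0"
proof -
  have "dot (c *s ?P + d *s ?Q) v = 0" for v using assms(1) by simp
  then have e: "c * dot ?P v + d * dot ?Q v = 0" for v by (simp add: dot_add dot_scale)
  have P: "dot ?P (vand z) = - ((x - z) * (y - b) * (z - b))"
    and Q: "dot ?Q (vand z) = (y - z) * (x - a) * (z - a)" for z
    by (simp_all add: axis_defs dot_def vand_def power2_eq_square algebra_simps)
  show ?thesis using e[of "vand a"] e[of "vand b"] assms(2-4) by (simp add: P Q)
qed

text \<open>The two quadratic polynomials share the zero \<open>a\<close>; their other zeros
  \<open>y1\<close> and \<open>y2\<close> are distinct.\<close>

lemma triple_independent:
  assumes "c *s axis_rows (a * y0, a, y0, 1) (y1, 1, 0, 0) (a * y2, a, y2, 1) +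
      d *s axis_rows (a * y0, a, y0, 1) (a * y1, a, y1, 1) (y2, 1, 0, 0) = 0" (is "c *s ?P + d *s ?Q = 0")
    and "y0 \<noteq> y1" "y0 \<noteq> y2" "y1 \<noteq> y2" "y1 \<noteq> a" "y2 \<noteq> a"
  shows "c = 0 \<and> d = 0"
proof -
  have "dot (c *s ?P + d *s ?Q) v = 0" for v using assms(1) by simp
  then have e: "c * dot ?P v + d * dot ?Q v = 0" for v by (simp add: dot_add dot_scale)
  have P: "dot ?P (vand z) = (y0 - y2) * (z - a) * (z - y1)"
    and Q: "dot ?Q (vand z) = (y1 - y0) * (z - a) * (z - y2)" for z
    by (simp_all add: axis_defs dot_def vand_def power2_eq_square algebra_simps)
  show ?thesis using e[of "vand y1"] e[of "vand y2"] assms(2-6) by (simp add: P Q)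
qed

text \<open>Up to nonzero factors these are the Lagrange polynomials of the points
  \<open>y0\<close>, \<open>y1\<close>, \<open>y2\<close>.\<close>

lemma matching_independent:
  assumes "c *s minor y1 y1 y2 y2 + d *s minor y2 y2 y0 y0 + e *s minor y0 y0 y1 y1 = 0"
    and "y0 \<noteq> y1" "y0 \<noteq> y2" "y1 \<noteq> y2"
  shows "c = 0 \<and> d = 0 \<and> e = 0"
proof -
  have "dot (c *s minor y1 y1 y2 y2 + d *s minor y2 y2 y0 y0 + e *s minor y0 y0 y1 y1) v = 0" for v
    using assms(1) by simp
  then have e: "c * dot (minor y1 y1 y2 y2) v + d * dot (minor y2 y2 y0 y0) v + e * dot (minor y0 y0 y1 y1) v = 0" for v
    by (simp add: dot_add dot_scale)
  have P: "dot (minor s s t t) (vand z) = (t - s) * (z - s) * (z - t)" for s t z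
    by (simp add: minor_def dot_def vand_def power2_eq_square algebra_simps)
  show ?thesis using e[of "vand y0"] e[of "vand y1"] e[of "vand y2"] assms(2-4) by (simp add: P)
qed

section \<open>Coincidences forced by a vanishing axis\<close>

definition axis_conditions :: "complex \<Rightarrow> complex \<Rightarrow> complex \<Rightarrow> complex \<Rightarrow> complex \<Rightarrow> complex \<Rightarrow> bool" where
  "axis_conditions x0 x1 x2 y0 y1 y2 \<longleftrightarrow>
    (x0 = y0 \<or> x1 = x0 \<or> x2 = x0 \<or> y1 = y2) \<and> (x1 = y1 \<or> x2 = x1 \<or> x0 = x1 \<or> y2 = y0) \<and>
    (x2 = y2 \<or> x0 = x2 \<or> x1 = x2 \<or> y0 = y1) \<and> (x0 = y0 \<or> y1 = y0 \<or> y2 = y0 \<or> x1 = x2) \<and>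
    (x1 = y1 \<or> y2 = y1 \<or> y0 = y1 \<or> x2 = x0) \<and> (x2 = y2 \<or> y0 = y2 \<or> y1 = y2 \<or> x0 = x1)"

lemma axis3_zero_conditions:
  assumes "axis3 x0 x1 x2 y0 y1 y2 = 0"
  shows "axis_conditions x0 x1 x2 y0 y1 y2"
  using axis3_vand[of x0 x1 x2 y0 y1 y2, unfolded assms] unfolding axis_conditions_def by auto

text \<open>The condition that defines \<open>sextuples0\<close>, for maps into any set, so that it
  can be transferred from points to parameters.\<close>

definition spread :: "(letter \<Rightarrow> 'a) \<Rightarrow> bool" where
  "spread t \<longleftrightarrow> (\<forall>a b c d e f. distinct [a, b, c, d, e, f] \<longrightarrow>
    \<not> (t a = t b \<and> t b = t c \<and> t d = t e) \<and> \<not> (t a = t b \<and> t b = t c \<and> t c = t d))"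

lemma spread_sextuples0: "h \<in> sextuples0 K \<Longrightarrow> spread h"
  unfolding spread_def using sextuples0_D by blast

text \<open>Next to the coincidence \<open>t p0 = t q0\<close> the condition \<open>spread\<close>
  leaves so few others that the six products decide the case. Permuting the columns extends this to
  a coincidence in any column.\<close>

lemma base_locus_pair:
  fixes t :: "letter \<Rightarrow> complex"
  assumes d: "distinct [p0, p1, p2, q0, q1, q2]"
    and s: "spread t"
    and c: "axis_conditions (t p0) (t p1) (t p2) (t q0) (t q1) (t q2)" and e: "t p0 = t q0"
  shows "(t p1 = t q1 \<and> t p2 = t q2) \<or> (t p1 = t p2 \<and> t q1 = t q2)"
proof -
  note t = s[unfolded spread_def, rule_format]
  have tp: "\<not> (t p0 = t a \<and> t b = t c)" if "distinct [p0, q0, a, b, c, f]" for a b c f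
    using t[OF that] e by auto
  have tq: "\<not> (t p0 = t a \<and> t p0 = t b)" if "distinct [p0, q0, a, b, c, f]" for a b c f
    using t[OF that] e by auto
  have tt: "\<not> (t a = t b \<and> t b = t c)" if "distinct [a, b, c, p0, q0, f]" for a b c f
    using t[OF that] e by auto
  have [simp]: "p0 \<noteq> p1" "p0 \<noteq> p2" "p0 \<noteq> q0" "p0 \<noteq> q1" "p0 \<noteq> q2" "p1 \<noteq> p2" "p1 \<noteq> q0" "p1 \<noteq> q1"
    "p1 \<noteq> q2" "p2 \<noteq> q0" "p2 \<noteq> q1" "p2 \<noteq> q2" "q0 \<noteq> q1" "q0 \<noteq> q2" "q1 \<noteq> q2"
    using d by auto
  note [simp] = this[symmetric]
  \<comment> \<open>All consequences of \<open>spread\<close> next to \<open>t p0 = t q0\<close>: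
    twelve exclude a third letter with a disjoint pair, six a third and a fourth letter, four a
    disjoint triple.\<close>
  have base:
    "\<not> (t p0 = t p1 \<and> t q1 = t q2)"
    "\<not> (t p0 = t p1 \<and> t p2 = t q1)"
    "\<not> (t p0 = t p1 \<and> t p2 = t q2)"
    "\<not> (t p0 = t p2 \<and> t q1 = t q2)"
    "\<not> (t p0 = t p2 \<and> t p1 = t q1)"
    "\<not> (t p0 = t p2 \<and> t p1 = t q2)"
    "\<not> (t p0 = t q1 \<and> t p1 = t p2)"
    "\<not> (t p0 = t q1 \<and> t p1 = t q2)"
    "\<not> (t p0 = t q1 \<and> t p2 = t q2)"
    "\<not> (t p0 = t q2 \<and> t p1 = t p2)"
    "\<not> (t p0 = t q2 \<and> t p1 = t q1)"
    "\<not> (t p0 = t q2 \<and> t p2 = t q1)"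
    "\<not> (t p0 = t p1 \<and> t p0 = t p2)"
    "\<not> (t p0 = t p1 \<and> t p0 = t q1)"
    "\<not> (t p0 = t p1 \<and> t p0 = t q2)"
    "\<not> (t p0 = t p2 \<and> t p0 = t q1)"
    "\<not> (t p0 = t p2 \<and> t p0 = t q2)"
    "\<not> (t p0 = t q1 \<and> t p0 = t q2)"
    "\<not> (t p1 = t p2 \<and> t p2 = t q1)"
    "\<not> (t p1 = t p2 \<and> t p2 = t q2)"
    "\<not> (t p1 = t q1 \<and> t q1 = t q2)"
    "\<not> (t p2 = t q1 \<and> t q1 = t q2)"
    by (rule tp[of p1 q1 q2 p2], simp,
      rule tp[of p1 p2 q1 q2], simp,
      rule tp[of p1 p2 q2 q1], simp,
      rule tp[of p2 q1 q2 p1], simp,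
      rule tp[of p2 p1 q1 q2], simp,
      rule tp[of p2 p1 q2 q1], simp,
      rule tp[of q1 p1 p2 q2], simp,
      rule tp[of q1 p1 q2 p2], simp,
      rule tp[of q1 p2 q2 p1], simp,
      rule tp[of q2 p1 p2 q1], simp,
      rule tp[of q2 p1 q1 p2], simp,
      rule tp[of q2 p2 q1 p1], simp,
      rule tq[of p1 p2 q1 q2], simp,
      rule tq[of p1 q1 p2 q2], simp,
      rule tq[of p1 q2 p2 q1], simp,
      rule tq[of p2 q1 p1 q2], simp,
      rule tq[of p2 q2 p1 q1], simp,
      rule tq[of q1 q2 p1 p2], simp,
      rule tt[of p1 p2 q1 q2], simp,
      rule tt[of p1 p2 q2 q1], simp,
      rule tt[of p1 q1 q2 p2], simp,
      rule tt[of p2 q1 q2 p1], simp)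
  from base c e show ?thesis unfolding axis_conditions_def by metis
qed

lemma base_locus:
  fixes t :: "letter \<Rightarrow> complex"
  assumes d: "distinct [p0, p1, p2, q0, q1, q2]"
    and s: "spread t"
    and z: "axis3 (t p0) (t p1) (t p2) (t q0) (t q1) (t q2) = 0"
  shows "(t p0 = t q0 \<and> t p1 = t q1 \<and> t p2 = t q2) \<or> (t p0 = t p1 \<and> t q0 = t q1) \<or>
    (t p0 = t p2 \<and> t q0 = t q2) \<or> (t p1 = t p2 \<and> t q1 = t q2) \<or>
    (t p0 = t p1 \<and> t p0 = t p2) \<or> (t q0 = t q1 \<and> t q0 = t q2)"
proof -
  note c = axis3_zero_conditions[OF z]
  consider "t p0 = t q0" | "t p1 = t q1" | "t p2 = t q2" | "t p0 \<noteq> t q0" "t p1 \<noteq> t q1" "t p2 \<noteq> t q2" by blast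
  then show ?thesis
  proof cases
    case 1
    then show ?thesis using base_locus_pair[OF d s c] by blast
  next
    case 2
    have "axis_conditions (t p1) (t p0) (t p2) (t q1) (t q0) (t q2)"
      using c unfolding axis_conditions_def by metis
    then show ?thesis using base_locus_pair[of p1 p0 p2 q1 q0 q2 t] 2 d s by auto
  next
    case 3
    have "axis_conditions (t p2) (t p0) (t p1) (t q2) (t q0) (t q1)"
      using c unfolding axis_conditions_def by metis
    then show ?thesis using base_locus_pair[of p2 p0 p1 q2 q0 q1 t] 3 d s by auto
  next
    case 4
    \<comment> \<open>Only coincidences within the rows are left: a row without any forces the other
      row to be constant, and a row with exactly one equal pair forces the same pair in the
      other.\<close>
    then show ?thesis using c unfolding axis_conditions_def by metis
  qed
qed

section \<open>Coincidences near a given sextuple\<close>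

lemma center_Z_partner:
  assumes "u \<in> center_Z K"
  shows "\<exists>y. y \<noteq> x \<and> u x = u y"
proof -
  obtain a b c d e f where *: "distinct [a, b, c, d, e, f]" "u a = u b" "u c = u d" "u e = u f"
    using assms unfolding center_Z_iff by blast
  have "x \<in> {a, b, c, d, e, f}" using letters_cover[OF *(1)] by blast
  then show ?thesis using * by (elim insertE) auto
qed

text \<open>An equal triple would give two different overlapping pairs in \<open>P\<close>, so only
  two disjoint pairs can occur.\<close>

lemma center_Y_pairs:
  assumes "u \<in> center_Y K" "\<And>x y. u x = u y \<Longrightarrow> x \<noteq> y \<Longrightarrow> {x, y} \<in> P"
    and "\<And>A B. A \<in> P \<Longrightarrow> B \<in> P \<Longrightarrow> A \<noteq> B \<Longrightarrow> A \<inter> B = {}"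
  obtains A B where "A \<in> P" "B \<in> P" "A \<noteq> B" "\<forall>x\<in>A. \<forall>y\<in>A. u x = u y" "\<forall>x\<in>B. \<forall>y\<in>B. u x = u y"
proof -
  obtain a b c d where *: "distinct [a, b, c, d]" "u a = u b" "u c = u d \<or> u b = u c"
    using assms(1) unfolding center_Y_iff by auto
  have ab: "{a, b} \<in> P" using assms(2) * by simp
  from *(3) show ?thesis
  proof
    assume cd: "u c = u d"
    then have "{c, d} \<in> P" using assms(2) * by simp
    moreover have "{a, b} \<noteq> {c, d}" using *(1) by (auto simp: doubleton_eq_iff)
    ultimately show thesis
      by (rule that[OF ab]) (use * cd in auto)
  next
    assume bc: "u b = u c"
    then have "{b, c} \<in> P" using assms(2) * by simp
    moreover have "{a, b} \<noteq> {b, c}" using *(1) by (auto simp: doubleton_eq_iff)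
    ultimately show ?thesis using assms(3)[OF ab] by blast
  qed
qed

text \<open>A further coincidence would merge two of the pairs into four equal letters.\<close>

lemma coincidences_matching:
  assumes h: "h \<in> sextuples0 K" and d: "distinct [a0, b0, a1, b1, a2, b2]"
    and e: "h a0 = h b0" "h a1 = h b1" "h a2 = h b2" and xy: "h x = h y" "x \<noteq> y"
  shows "{x, y} \<in> {{a0, b0}, {a1, b1}, {a2, b2}}"
proof -
  have "h a0 \<noteq> h a1" "h a0 \<noteq> h a2" "h a1 \<noteq> h a2"
    using sextuples0_D(2)[OF h, of a0 b0 a1 b1 a2 b2] sextuples0_D(2)[OF h, of a0 b0 a2 b2 a1 b1]
      sextuples0_D(2)[OF h, of a1 b1 a2 b2 a0 b0] d e by auto
  moreover have "x \<in> {a0, b0, a1, b1, a2, b2}" "y \<in> {a0, b0, a1, b1, a2, b2}"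
    using letters_cover[OF d] by blast+
  ultimately show ?thesis using xy e by (elim insertE) auto
qed

text \<open>A further coincidence would merge the pairs, or enlarge one of them to a triple beside
  the other.\<close>

lemma coincidences_pairs:
  assumes h: "h \<in> sextuples0 K" and d: "distinct [a0, b0, a1, b1, a2, b2]"
    and e: "h a0 = h b0" "h a1 = h b1" "h a2 \<noteq> h b2" and xy: "h x = h y" "x \<noteq> y"
  shows "{x, y} \<in> {{a0, b0}, {a1, b1}}"
proof -
  have "h a0 \<noteq> h a1" "h a0 \<noteq> h a2" "h a0 \<noteq> h b2" "h a1 \<noteq> h a2" "h a1 \<noteq> h b2"
    using sextuples0_D(2)[OF h, of a0 b0 a1 b1 a2 b2] sextuples0_D(1)[OF h, of a0 b0 a2 a1 b1 b2]
      sextuples0_D(1)[OF h, of a0 b0 b2 a1 b1 a2] sextuples0_D(1)[OF h, of a1 b1 a2 a0 b0 b2]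
      sextuples0_D(1)[OF h, of a1 b1 b2 a0 b0 a2] d e by auto
  moreover have "x \<in> {a0, b0, a1, b1, a2, b2}" "y \<in> {a0, b0, a1, b1, a2, b2}"
    using letters_cover[OF d] by blast+
  ultimately show ?thesis using xy e by (elim insertE) auto
qed

lemma coincidences_triple:
  assumes h: "h \<in> sextuples0 K" and d: "distinct [a, b, c, d, e, f]"
    and abc: "h a = h b" "h a = h c" and xy: "h x = h y" "x \<noteq> y"
  shows "x \<in> {a, b, c}" "y \<in> {a, b, c}"
proof -
  have "h a \<noteq> h d" "h a \<noteq> h e" "h a \<noteq> h f" "h d \<noteq> h e" "h d \<noteq> h f" "h e \<noteq> h f"
    using sextuples0_D[OF h, of a b c d e f] sextuples0_D[OF h, of a b c e f d]
      sextuples0_D[OF h, of a b c f d e] d abc by auto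
  moreover have "x \<in> {a, b, c, d, e, f}" "y \<in> {a, b, c, d, e, f}"
    using letters_cover[OF d] by blast+
  ultimately have "x \<in> {a, b, c} \<and> y \<in> {a, b, c}" using xy abc by (elim insertE) auto
  then show "x \<in> {a, b, c}" "y \<in> {a, b, c}" by auto
qed

section \<open>Extension of the Pascal map\<close>

text \<open>The ideal of the \<open>z k\<close> is generated by \<open>t\<close>: the quotients
  \<open>r k\<close> are regular and one of them is a unit at \<open>x\<close>.\<close>

definition principal_at ::
    "'a::charted_space set \<Rightarrow> 'a \<Rightarrow> 'k set \<Rightarrow> ('k \<Rightarrow> 'a \<Rightarrow> complex) \<Rightarrow> bool" where
  "principal_at S x I z \<longleftrightarrow> (\<exists>t r. (\<forall>k\<in>I. reg S x (r k)) \<and>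
     eventually (\<lambda>y. \<forall>k\<in>I. z k y = t y * r k y) (nz S x) \<and> (\<exists>k\<in>I. r k x \<noteq> 0))"

lemma principal_at_blow_up:
  fixes B :: "('a::charted_space \<times> 'r::finite proj) set"
  assumes "is_blow_up X Z B" "b \<in> B" "generates_at X Z (fst b) I z" "finite I"
  shows "principal_at B b I (\<lambda>k y. z k (fst y))"
proof -
  obtain k0 r where r: "k0 \<in> I" "r k0 = (\<lambda>_. 1)" "\<forall>k\<in>I. reg B b (r k)"
    "eventually (\<lambda>y. \<forall>k\<in>I. z k (fst y) = z k0 (fst y) * r k y) (nz B b)"
    by (rule blow_up_principal[OF assms])
  have "r k0 b \<noteq> 0" using r(2) by simp
  then show ?thesis unfolding principal_at_def
    using r(1,3,4) by (intro exI[of _ "\<lambda>y. z k0 (fst y)"] exI[of _ r]) blast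
qed

lemma principal_at_fst:
  assumes "principal_at X (fst b) I z" "b \<in> B" "fst ` B \<subseteq> X"
  shows "principal_at B b I (\<lambda>k y. z k (fst y))"
proof -
  obtain t r where r: "\<And>k. k \<in> I \<Longrightarrow> reg X (fst b) (r k)" "\<exists>k\<in>I. r k (fst b) \<noteq> 0"
    "eventually (\<lambda>y. \<forall>k\<in>I. z k y = t y * r k y) (nz X (fst b))"
    using assms(1) unfolding principal_at_def by blast
  from eventually_fst[OF r(3) assms(2,3)] reg_fst[OF r(1) assms(2,3)] r(2) show ?thesis
    unfolding principal_at_def
    by (intro exI[of _ "\<lambda>y. t (fst y)"] exI[of _ "\<lambda>k y. r k (fst y)"]) blast
qed

lemma principal_at_mult:
  assumes "principal_at S x I z" "eventually (\<lambda>y. \<forall>k\<in>I. z' k y = w y * z k y) (nz S x)"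
  shows "principal_at S x I z'"
proof -
  obtain t r where r: "\<forall>k\<in>I. reg S x (r k)" "\<exists>k\<in>I. r k x \<noteq> 0"
    "eventually (\<lambda>y. \<forall>k\<in>I. z k y = t y * r k y) (nz S x)"
    using assms(1) unfolding principal_at_def by blast
  from assms(2) r(3) have "eventually (\<lambda>y. \<forall>k\<in>I. z' k y = (w y * t y) * r k y) (nz S x)"
    by eventually_elim simp
  with r(1,2) show ?thesis unfolding principal_at_def
    by (intro exI[of _ "\<lambda>y. w y * t y"] exI[of _ r]) blast
qed

lemma factor_two:
  fixes F P Q :: "'a::charted_space \<Rightarrow> complex^3"
  assumes "principal_at S x {k1, k2} z"
    and reg: "\<And>i. reg S x (\<lambda>y. P y $ i)" "\<And>i. reg S x (\<lambda>y. Q y $ i)"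
    and F: "eventually (\<lambda>y. F y = z k1 y *s P y + z k2 y *s Q y) (nz S x)"
    and ind: "\<And>c d. c *s P x + d *s Q x = 0 \<Longrightarrow> c = 0 \<and> d = 0"
  shows "\<exists>t G. (\<forall>i. reg S x (\<lambda>y. G y $ i)) \<and> G x \<noteq> 0 \<and> eventually (\<lambda>y. F y = t y *s G y) (nz S x)"
proof -
  obtain t r where r: "reg S x (r k1)" "reg S x (r k2)" "r k1 x \<noteq> 0 \<or> r k2 x \<noteq> 0"
    "eventually (\<lambda>y. z k1 y = t y * r k1 y \<and> z k2 y = t y * r k2 y) (nz S x)"
    using assms(1) unfolding principal_at_def by auto
  define G where "G y = r k1 y *s P y + r k2 y *s Q y" for y
  have "reg S x (\<lambda>y. G y $ i)" for i
    unfolding G_def vector_add_component vector_smult_component by (intro reg_add reg_mult reg r(1,2))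
  moreover have "G x \<noteq> 0" using ind r(3) unfolding G_def by blast
  moreover from F r(4) have "eventually (\<lambda>y. F y = t y *s G y) (nz S x)"
    by eventually_elim (simp add: G_def)
  ultimately show ?thesis by blast
qed

lemma factor_three:
  fixes F P Q R :: "'a::charted_space \<Rightarrow> complex^3"
  assumes "principal_at S x {k1, k2, k3} z"
    and reg: "\<And>i. reg S x (\<lambda>y. P y $ i)" "\<And>i. reg S x (\<lambda>y. Q y $ i)" "\<And>i. reg S x (\<lambda>y. R y $ i)"
    and F: "eventually (\<lambda>y. F y = z k1 y *s P y + z k2 y *s Q y + z k3 y *s R y) (nz S x)"
    and ind: "\<And>c d e. c *s P x + d *s Q x + e *s R x = 0 \<Longrightarrow> c = 0 \<and> d = 0 \<and> e = 0"
  shows "\<exists>t G. (\<forall>i. reg S x (\<lambda>y. G y $ i)) \<and> G x \<noteq> 0 \<and> eventually (\<lambda>y. F y = t y *s G y) (nz S x)"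
proof -
  obtain t r where r: "reg S x (r k1)" "reg S x (r k2)" "reg S x (r k3)" "r k1 x \<noteq> 0 \<or> r k2 x \<noteq> 0 \<or> r k3 x \<noteq> 0"
    "eventually (\<lambda>y. z k1 y = t y * r k1 y \<and> z k2 y = t y * r k2 y \<and> z k3 y = t y * r k3 y) (nz S x)"
    using assms(1) unfolding principal_at_def by auto
  define G where "G y = r k1 y *s P y + r k2 y *s Q y + r k3 y *s R y" for y
  have "reg S x (\<lambda>y. G y $ i)" for i
    unfolding G_def vector_add_component vector_smult_component by (intro reg_add reg_mult reg r(1-3))
  moreover have "G x \<noteq> 0" using ind r(4) unfolding G_def by blast
  moreover from F r(5) have "eventually (\<lambda>y. F y = t y *s G y) (nz S x)"
    by eventually_elim (simp add: G_def)
  ultimately show ?thesis by blast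
qed

lemma reg_axis_rows:
  assumes "reg S x a0" "reg S x b0" "reg S x c0" "reg S x d0" "reg S x a1" "reg S x b1" "reg S x c1" "reg S x d1"
    "reg S x a2" "reg S x b2" "reg S x c2" "reg S x d2"
  shows "reg S x (\<lambda>y. axis_rows (a0 y, b0 y, c0 y, d0 y) (a1 y, b1 y, c1 y, d1 y) (a2 y, b2 y, c2 y, d2 y) $ i)"
proof -
  have "\<forall>i. reg S x (\<lambda>y. axis_rows (a0 y, b0 y, c0 y, d0 y) (a1 y, b1 y, c1 y, d1 y) (a2 y, b2 y, c2 y, d2 y) $ i)"
    unfolding forall_3 axis_rows_def det3_def prod.case vector_3
    by (intro conjI reg_intros assms)
  then show ?thesis by blast
qed

lemma reg_minor:
  assumes "reg S x a" "reg S x b" "reg S x c" "reg S x d"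
  shows "reg S x (\<lambda>y. minor (a y) (b y) (c y) (d y) $ i)"
proof -
  have "\<forall>i. reg S x (\<lambda>y. minor (a y) (b y) (c y) (d y) $ i)"
    unfolding forall_3 minor_def vector_3 by (intro conjI reg_intros assms)
  then show ?thesis by blast
qed

text \<open>One point \<open>x\<close> of the iterated blow-up with its images \<open>b\<close> and
  \<open>h\<close>. The frame belongs to the point, because no single frame is affine at all
  sextuples.\<close>

locale resolution = conic_frame K N M for K N M +
  fixes X' :: "(sextuple \<times> 'r::finite proj) set"
    and X :: "((sextuple \<times> 'r proj) \<times> 't::finite proj) set"
    and x :: "(sextuple \<times> 'r proj) \<times> 't proj"
  assumes bu1: "is_blow_up (sextuples0 K) (center_Z K) X'"
    and bu2: "is_blow_up X' (proper_transform (center_Z K) X' (center_Y K)) X"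
    and dense: "\<And>h. h \<in> sextuples0 K \<Longrightarrow> \<exists>\<^sub>F u in nz (sextuples0 K) h. inj u"
    and x: "x \<in> X" and aff: "affine_at N (fst (fst x))"
begin

abbreviation b where "b \<equiv> fst x"
abbreviation h where "h \<equiv> fst (fst x)"

lemma b: "b \<in> X'"
  using blow_up_fst[OF bu2] x by auto

lemma h: "h \<in> sextuples0 K"
  using blow_up_fst[OF bu1] b by auto

lemma h_sextuples: "sextuples0 K \<subseteq> sextuples K" "h \<in> sextuples K"
  using h by (auto simp: sextuples0_def)

lemma mor_point: "mor X x (\<lambda>y. fst (fst y) a)"
  by (rule mor_eval[OF mor_fst[OF mor_fst[OF mor_id x] x] x])

lemma eventually_base:
  assumes "eventually P (nz (sextuples0 K) h)"
  shows "eventually (\<lambda>y. P (fst (fst y))) (nz X x)"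
  using eventually_fst[OF eventually_fst[OF assms b blow_up_fst[OF bu1]] x blow_up_fst[OF bu2]] .

lemma affine_near: "eventually (affine_at N) (nz (sextuples0 K) h)"
  by (rule eventually_affine_at[of "sextuples0 K" h "\<lambda>u. u", OF mor_eval_id h aff])

lemma param_h_eq_iff: "param N (h a) = param N (h c) \<longleftrightarrow> h a = h c"
  using h_sextuples(2) aff by (intro param_eq_iff) (auto simp: sextuples_def affine_at_def)

definition coord where "coord a y = param N (fst (fst y) a)" for y :: "(sextuple \<times> 'r proj) \<times> 't proj"

lemma reg_coord: "reg X x (coord a)"
  unfolding coord_def using aff by (intro reg_param(1)[OF mor_point x]) (simp add: affine_at_def)

definition pascal_axis where "pascal_axis xs ys i j k y =
  axis3 (coord (xs i) y) (coord (xs j) y) (coord (xs k) y) (coord (ys i) y) (coord (ys j) y) (coord (ys k) y)"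

text \<open>One map \<open>\<phi>\<close> serves at all points near \<open>x\<close>; gluing relies
  on this.\<close>

definition extends where "extends s \<longleftrightarrow>
  (\<exists>\<phi>. eventually (\<lambda>y. mor X y \<phi> \<and> (inj (fst (fst y)) \<longrightarrow> \<phi> y = pascal_line s (fst (fst y)))) (nz X x))"

lemma coord_x_eq_iff: "coord a x = coord c x \<longleftrightarrow> h a = h c"
  by (simp add: coord_def param_h_eq_iff)

lemma spread_coord: "spread (\<lambda>a. coord a x)"
  using spread_sextuples0[OF h] by (simp add: spread_def coord_x_eq_iff)

text \<open>Reduces the computation of an ideal to combinatorics of letters: near \<open>h\<close>
  only coincidences already present in \<open>h\<close> have to be considered.\<close>

lemma generates_at_letters:
  assumes "finite I" and \<theta>: "h \<circ> \<theta> = h" "\<And>a. \<theta> a = a \<or> (\<theta> a, a) \<in> I"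
    and T: "\<And>u. u \<circ> \<theta> \<in> sextuples0 K \<Longrightarrow> u \<circ> \<theta> \<in> T"
      "\<And>u. u \<in> T \<Longrightarrow> \<forall>a c. u a = u c \<longrightarrow> h a = h c \<Longrightarrow> \<forall>(a, c)\<in>I. u a = u c"
  shows "generates_at (sextuples0 K) T h I (gap N)"
proof (rule generates_at_diagonal[OF h_sextuples(1) h aff assms(1) \<theta>])
  show "eventually (\<lambda>u. u \<circ> \<theta> \<in> sextuples0 K \<inter> T) (nz (sextuples0 K) h)"
    using eventually_comp_sextuples0[OF h \<theta>(1)] by eventually_elim (simp add: T(1))
  show "eventually (\<lambda>u. u \<in> T \<longrightarrow> (\<forall>(a, c)\<in>I. u a = u c)) (nz (sextuples0 K) h)"
    using eventually_neq[OF h] by (rule eventually_mono) (rule impI, rule T(2))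
qed

lemma generates_at_matching:
  assumes d: "distinct [a0, b0, a1, b1, a2, b2]" and e: "h a0 = h b0" "h a1 = h b1" "h a2 = h b2"
  shows "generates_at (sextuples0 K) (center_Z K) h {(a0, b0), (a1, b1), (a2, b2)} (gap N)"
proof (rule generates_at_letters)
  define \<theta> where "\<theta> = id(b0 := a0, b1 := a1, b2 := a2)"
  show "h \<circ> \<theta> = h" using e by (auto simp: \<theta>_def fun_eq_iff)
  show "\<theta> a = a \<or> (\<theta> a, a) \<in> {(a0, b0), (a1, b1), (a2, b2)}" for a by (auto simp: \<theta>_def)
  have "(u \<circ> \<theta>) a0 = (u \<circ> \<theta>) b0" "(u \<circ> \<theta>) a1 = (u \<circ> \<theta>) b1" "(u \<circ> \<theta>) a2 = (u \<circ> \<theta>) b2" for u :: sextuple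
    using d by (auto simp: \<theta>_def)
  then show "u \<circ> \<theta> \<in> center_Z K" if "u \<circ> \<theta> \<in> sextuples0 K" for u
    unfolding center_Z_iff using that d by blast
  fix u assume u: "u \<in> center_Z K" "\<forall>a c. u a = u c \<longrightarrow> h a = h c"
  have "u a = u c" if "{a, c} \<in> {{a0, b0}, {a1, b1}, {a2, b2}}" for a c
  proof -
    obtain y where y: "y \<noteq> a" "u a = u y" using center_Z_partner[OF u(1)] by blast
    then have "{a, y} \<in> {{a0, b0}, {a1, b1}, {a2, b2}}"
      by (intro coincidences_matching[OF h d e u(2)[rule_format, OF y(2)]]) simp
    then have "y = c" using that d y(1) by (auto simp: doubleton_eq_iff)
    with y show ?thesis by simp
  qed
  then show "\<forall>(a, b)\<in>{(a0, b0), (a1, b1), (a2, b2)}. u a = u b" by simp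
qed simp

section \<open>Ideals made principal by the two blow-ups\<close>

lemma principal_away:
  assumes hZ: "h \<notin> center_Z K" and I: "finite I" and gz: "generates_at (sextuples0 K) (center_Y K) h I (gap N)"
  shows "principal_at X x I (\<lambda>k y. gap N k (fst (fst y)))"
  by (rule principal_at_blow_up[OF bu2 x generates_at_proper_transform_away[OF bu1 b hZ gz] I])

text \<open>Here the two pairs are the only coincidences of \<open>h\<close>. Hence \<open>h\<close>
  is off \<open>Z\<close>, and near \<open>h\<close> the set \<open>Y\<close> is this one
  polydiagonal.\<close>

lemma principal_pairs_away:
  assumes d: "distinct [a0, b0, a1, b1, a2, b2]" and e: "h a0 = h b0" "h a1 = h b1" "h a2 \<noteq> h b2"
  shows "principal_at X x {(a0, b0), (a1, b1)} (\<lambda>k y. gap N k (fst (fst y)))"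
proof (rule principal_away)
  note co = coincidences_pairs[OF h d e]
  show "h \<notin> center_Z K"
  proof
    assume "h \<in> center_Z K"
    from center_Z_partner[OF this, of a2] obtain y where "y \<noteq> a2" "h a2 = h y" by blast
    with co[of a2 y] d show False by (auto simp: doubleton_eq_iff)
  qed
  show "generates_at (sextuples0 K) (center_Y K) h {(a0, b0), (a1, b1)} (gap N)"
  proof (rule generates_at_letters)
    define \<theta> where "\<theta> = id(b0 := a0, b1 := a1)"
    show "h \<circ> \<theta> = h" using e by (auto simp: \<theta>_def fun_eq_iff)
    show "\<theta> a = a \<or> (\<theta> a, a) \<in> {(a0, b0), (a1, b1)}" for a by (auto simp: \<theta>_def)
    have "(u \<circ> \<theta>) a0 = (u \<circ> \<theta>) b0" "(u \<circ> \<theta>) a1 = (u \<circ> \<theta>) b1" for u :: sextuple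
      using d by (auto simp: \<theta>_def)
    then show "u \<circ> \<theta> \<in> center_Y K" if "u \<circ> \<theta> \<in> sextuples0 K" for u
      unfolding center_Y_iff using that d by blast
    fix u assume u: "u \<in> center_Y K" "\<forall>a c. u a = u c \<longrightarrow> h a = h c"
    have 1: "{p, q} \<in> {{a0, b0}, {a1, b1}}" if "u p = u q" "p \<noteq> q" for p q
      by (rule co[OF u(2)[rule_format, OF that(1)] that(2)])
    have 2: "A \<inter> B = {}" if "A \<in> {{a0, b0}, {a1, b1}}" "B \<in> {{a0, b0}, {a1, b1}}" "A \<noteq> B" for A B
      using that d by auto
    obtain A B where AB: "A \<in> {{a0, b0}, {a1, b1}}" "B \<in> {{a0, b0}, {a1, b1}}" "A \<noteq> B"
      "\<forall>x\<in>A. \<forall>y\<in>A. u x = u y" "\<forall>x\<in>B. \<forall>y\<in>B. u x = u y"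
      by (rule center_Y_pairs[OF u(1) 1 2])
    then have "u a0 = u b0 \<and> u a1 = u b1" by auto
    then show "\<forall>(a, b)\<in>{(a0, b0), (a1, b1)}. u a = u b" by simp
  qed simp
qed simp

text \<open>A letter outside the triple coincides with no other one, so \<open>h\<close> is off
  \<open>Z\<close>, and \<open>Y\<close> is locally the polydiagonal of the triple.\<close>

lemma principal_triple:
  assumes d: "distinct [a0, a1, a2, c0, c1, c2]" and e: "h a0 = h a1" "h a0 = h a2"
  shows "principal_at X x {(a0, a1), (a0, a2)} (\<lambda>k y. gap N k (fst (fst y)))"
proof (rule principal_away)
  note co = coincidences_triple[OF h d e]
  show "h \<notin> center_Z K"
  proof
    assume "h \<in> center_Z K"
    from center_Z_partner[OF this, of c0] obtain y where "y \<noteq> c0" "h c0 = h y" by blast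
    with co(1)[of c0 y] d show False by auto
  qed
  show "generates_at (sextuples0 K) (center_Y K) h {(a0, a1), (a0, a2)} (gap N)"
  proof (rule generates_at_letters)
    define \<theta> where "\<theta> = id(a1 := a0, a2 := a0)"
    show "h \<circ> \<theta> = h" using e by (auto simp: \<theta>_def fun_eq_iff)
    show "\<theta> a = a \<or> (\<theta> a, a) \<in> {(a0, a1), (a0, a2)}" for a by (auto simp: \<theta>_def)
    have "(u \<circ> \<theta>) a0 = (u \<circ> \<theta>) a1" "(u \<circ> \<theta>) a1 = (u \<circ> \<theta>) a2" for u :: sextuple
      using d by (auto simp: \<theta>_def)
    then show "u \<circ> \<theta> \<in> center_Y K" if "u \<circ> \<theta> \<in> sextuples0 K" for u
      unfolding center_Y_iff using that d by blast
    fix u assume u: "u \<in> center_Y K" "\<forall>a c. u a = u c \<longrightarrow> h a = h c"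
    then obtain p q r s where *: "distinct [p, q, r, s]" "u p = u q" "u r = u s \<or> u q = u r"
      unfolding center_Y_iff by auto
    have co': "p \<in> {a0, a1, a2} \<and> q \<in> {a0, a1, a2}" if "u p = u q" "p \<noteq> q" for p q
      using co[of p q] u(2) that by blast
    have pq: "p \<in> {a0, a1, a2}" "q \<in> {a0, a1, a2}" using co'[of p q] * by auto
    \<comment> \<open>Two disjoint equal pairs would need four letters inside the triple.\<close>
    have "u q = u r"
    proof (rule ccontr)
      assume "u q \<noteq> u r"
      with * have "u r = u s" by blast
      then have "{p, q, r, s} \<subseteq> {a0, a1, a2}" using co'[of r s] pq * by auto
      from card_mono[OF _ this] have "card {p, q, r, s} \<le> card {a0, a1, a2}" by simp
      with * d show False by simp
    qed
    then have "r \<in> {a0, a1, a2}" using co'[of q r] * by auto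
    with pq * \<open>u q = u r\<close> have "u a0 = u a1 \<and> u a0 = u a2" by (elim insertE) auto
    then show "\<forall>(a, b)\<in>{(a0, a1), (a0, a2)}. u a = u b" by auto
  qed simp
qed simp

text \<open>The cases differ in the quotients \<open>r\<close> at \<open>b\<close>. If one belonging
  to the two pairs is a unit, the first blow-up suffices. Otherwise the gap \<open>w\<close> of the
  third pair generates the ideal of the centre, and the quotients of the other two gaps by it vanish
  at \<open>b\<close> and cut out the proper transform of \<open>Y\<close>.\<close>

lemma principal_pairs_center:
  assumes d: "distinct [a0, b0, a1, b1, a2, b2]" and e: "h a0 = h b0" "h a1 = h b1" "h a2 = h b2"
  shows "principal_at X x {(a0, b0), (a1, b1)} (\<lambda>k y. gap N k (fst (fst y)))"
proof -
  define I where "I = {(a0, b0), (a1, b1)}"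
  define w where "w = (a2, b2)"
  have fin: "finite I" and wI: "w \<notin> I" using d by (auto simp: I_def w_def)
  have J: "insert w I = {(a0, b0), (a1, b1), (a2, b2)}" by (auto simp: I_def w_def)
  have gz: "generates_at (sextuples0 K) (center_Z K) (fst b) (insert w I) (gap N)"
    unfolding J by (rule generates_at_matching[OF d e])
  note X'H = blow_up_fst[OF bu1] and XX' = blow_up_fst[OF bu2]
  obtain k0 r where r: "k0 \<in> insert w I" "r k0 = (\<lambda>_. 1)" "\<forall>k\<in>insert w I. reg X' b (r k)"
    "eventually (\<lambda>y. \<forall>k\<in>insert w I. gap N k (fst y) = gap N k0 (fst y) * r k y) (nz X' b)"
    by (rule blow_up_principal[OF bu1 b gz finite.insertI[OF fin]])
  have r': "eventually (\<lambda>y. \<forall>k\<in>I. gap N k (fst y) = gap N k0 (fst y) * r k y) (nz X' b)"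
    using r(4) by eventually_elim simp
  show ?thesis
  proof (cases "\<exists>k\<in>I. r k b \<noteq> 0")
    case True
    then have "principal_at X' b I (\<lambda>k y. gap N k (fst y))"
      unfolding principal_at_def using r(3) r'
      by (intro exI[of _ "\<lambda>y. gap N k0 (fst y)"] exI[of _ r]) blast
    from principal_at_fst[OF this x XX'] show ?thesis unfolding I_def .
  next
    case False
    have k0: "k0 = w" using False r(1,2) by auto
    define \<theta> where "\<theta> = id(b0 := a0, b1 := a1)"
    have \<theta>h: "h \<circ> \<theta> = h" using e by (auto simp: \<theta>_def fun_eq_iff)
    note comp = eventually_comp_sextuples0[OF h \<theta>h]
    note co = coincidences_matching[OF h d e]
    have diff: "ideal_at (sextuples0 K) h I (gap N) (\<lambda>u. param N (u (\<theta> a)) - param N (u a))" for a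
    proof (cases "\<theta> a = a")
      case True
      then show ?thesis by (simp add: ideal_at_zero)
    next
      case False
      then have "(\<theta> a, a) \<in> I" by (auto simp: \<theta>_def I_def split: if_splits)
      from ideal_at_generator[OF fin this, of "sextuples0 K" h "gap N"] show ?thesis
        by (simp add: gap_def[abs_def])
    qed
    have "generates_at X' (proper_transform (center_Z K) X' (center_Y K)) b I r"
    proof (rule generates_at_proper_transform_exceptional[OF bu1 b fin wI gz,
        where D = inj and \<rho> = "\<lambda>u. u \<circ> \<theta>"])
      show "reg X' b (r k)" if "k \<in> I" for k using r(3) that by blast
      show "r k b = 0" if "k \<in> I" for k using False that by blast
      show "eventually (\<lambda>y. gap N k (fst y) = gap N w (fst y) * r k y) (nz X' b)" if "k \<in> I" for k
        using r' unfolding k0 by eventually_elim (use that in blast)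
      show "\<exists>\<^sub>F u in nz (sextuples0 K) v. inj u" if "v \<in> sextuples0 K" for v using dense that .
      show "eventually (\<lambda>u. inj u \<longrightarrow> gap N w u \<noteq> 0) (nz (sextuples0 K) (fst b))"
        using affine_near eventually_nz_self
      proof eventually_elim
        case (elim u)
        then have u: "u \<in> sextuples K" using h_sextuples by blast
        have "a2 \<noteq> b2" using d by auto
        then show ?case unfolding w_def gap_eq_0_iff[OF u elim(1)] by (auto dest: injD)
      qed
      show "mor (sextuples0 K) (fst b) (\<lambda>u. u \<circ> \<theta>)" by (rule mor_comp_right)
      show "fst b \<circ> \<theta> = fst b" by (rule \<theta>h)
      show "eventually (\<lambda>u. u \<circ> \<theta> \<in> sextuples0 K) (nz (sextuples0 K) (fst b))" by (rule comp)
      show "ideal_at (sextuples0 K) (fst b) I (gap N) (\<lambda>u. \<phi> (u \<circ> \<theta>) - \<phi> u)"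
        if "(V, \<Phi>) \<in> charts" "fst b \<in> V" "\<phi> \<in> \<Phi>" for V \<Phi> \<phi>
        by (rule ideal_at_chart_diff[OF h_sextuples(1) h aff \<theta>h diff that])
      show "eventually (\<lambda>u. \<forall>k\<in>I. gap N k (u \<circ> \<theta>) = 0) (nz (sextuples0 K) (fst b))"
        using d by (auto simp: I_def gap_def \<theta>_def intro!: always_eventually)
      show "eventually (\<lambda>u. gap N w (u \<circ> \<theta>) = gap N w u) (nz (sextuples0 K) (fst b))"
        using d by (auto simp: w_def gap_def \<theta>_def intro!: always_eventually)
      show "eventually (\<lambda>u. inj u \<longrightarrow> u \<circ> \<theta> \<in> center_Y K) (nz (sextuples0 K) (fst b))"
        using comp
      proof eventually_elim
        case (elim u)
        have "(u \<circ> \<theta>) a0 = (u \<circ> \<theta>) b0" "(u \<circ> \<theta>) a1 = (u \<circ> \<theta>) b1" using d by (auto simp: \<theta>_def)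
        then show ?case unfolding center_Y_iff using elim d by blast
      qed
      \<comment> \<open>Of the three polydiagonals of \<open>Y\<close> through \<open>h\<close>, two
        contain the third pair and lie in \<open>w = 0\<close>; the remaining one is that of the two
        pairs in \<open>I\<close>.\<close>
      show "eventually (\<lambda>u. u \<in> center_Y K \<longrightarrow> gap N w u = 0 \<or> (\<forall>k\<in>I. gap N k u = 0)) (nz (sextuples0 K) (fst b))"
        using eventually_neq[OF h]
      proof eventually_elim
        case (elim u)
        show ?case
        proof
          assume u: "u \<in> center_Y K"
          let ?P = "{{a0, b0}, {a1, b1}, {a2, b2}}"
          have 1: "{p, q} \<in> ?P" if "u p = u q" "p \<noteq> q" for p q
            by (rule co[OF elim[rule_format, OF that(1)] that(2)])
          have 2: "A \<inter> B = {}" if "A \<in> ?P" "B \<in> ?P" "A \<noteq> B" for A B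
            using that d by auto
          obtain A B where AB: "A \<in> ?P" "B \<in> ?P" "A \<noteq> B"
            "\<forall>x\<in>A. \<forall>y\<in>A. u x = u y" "\<forall>x\<in>B. \<forall>y\<in>B. u x = u y"
            by (rule center_Y_pairs[OF u 1 2])
          define Q where "Q S \<longleftrightarrow> (\<forall>x\<in>S. \<forall>y\<in>S. u x = u y)" for S
          have "Q A" "Q B" using AB(4,5) unfolding Q_def .
          with AB(1-3) have "Q {a2, b2} \<or> (Q {a0, b0} \<and> Q {a1, b1})" by blast
          then have "u a2 = u b2 \<or> (u a0 = u b0 \<and> u a1 = u b1)" unfolding Q_def by blast
          then show "gap N w u = 0 \<or> (\<forall>k\<in>I. gap N k u = 0)" by (auto simp: w_def I_def gap_def)
        qed
      qed
      show "eventually (\<lambda>u. (\<forall>k\<in>insert w I. gap N k u = 0) \<longrightarrow> u \<in> center_Z K) (nz (sextuples0 K) (fst b))"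
        using affine_near eventually_nz_self
      proof eventually_elim
        case (elim u)
        then have u: "u \<in> sextuples K" using h_sextuples by blast
        show ?case
        proof
          assume "\<forall>k\<in>insert w I. gap N k u = 0"
          then have "u a0 = u b0" "u a1 = u b1" "u a2 = u b2"
            unfolding J by (simp_all add: gap_eq_0_iff[OF u elim(1)])
          with d elim(2) show "u \<in> center_Z K" unfolding center_Z_iff by blast
        qed
      qed
    qed
    \<comment> \<open>The second blow-up makes the quotients principal; multiplying by the gap
      \<open>k0\<close>, which is \<open>w\<close> here, returns to the gaps.\<close>
    from principal_at_blow_up[OF bu2 x this fin]
    have "principal_at X x I (\<lambda>k y. r k (fst y))" .
    moreover have "eventually (\<lambda>y. \<forall>k\<in>I. gap N k (fst (fst y)) = gap N k0 (fst (fst y)) * r k (fst y)) (nz X x)"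
      by (rule eventually_fst[OF r' x XX'])
    ultimately show ?thesis unfolding I_def[symmetric] by (rule principal_at_mult)
  qed
qed

lemma principal_pairs:
  assumes "distinct [a0, b0, a1, b1, a2, b2]" "h a0 = h b0" "h a1 = h b1"
  shows "principal_at X x {(a0, b0), (a1, b1)} (\<lambda>k y. gap N k (fst (fst y)))"
  using principal_pairs_away[OF assms] principal_pairs_center[OF assms] by blast

section \<open>Local extensions of the Pascal map\<close>

lemma extends_of_factor:
  assumes s: "s = array_class xs ys" and ijk: "i \<noteq> j" "i \<noteq> k" "j \<noteq> k"
    and dist: "distinct [xs i, xs j, xs k, ys i, ys j, ys k]"
    and factor: "\<exists>t G. (\<forall>i. reg X x (\<lambda>y. G y $ i)) \<and> G x \<noteq> 0 \<and>
      eventually (\<lambda>y. pascal_axis xs ys i j k y = t y *s G y) (nz X x)"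
  shows "extends s"
proof -
  obtain t G where G: "\<And>i. reg X x (\<lambda>y. G y $ i)" "G x \<noteq> 0"
    and F: "eventually (\<lambda>y. pascal_axis xs ys i j k y = t y *s G y) (nz X x)"
    using factor by blast
  define g where "g i y = (G y v* N) $ i" for i y
  have regg: "reg X x (g i)" for i
    unfolding g_def vector_matrix_mult_def vec_lambda_beta by (intro reg_sum reg_mult reg_const G(1))
  obtain i0 where i0: "g i0 x \<noteq> 0"
    using N_nonzero[OF G(2)] by (auto simp: g_def vec_eq_iff)
  define \<phi> where "\<phi> y = abs_proj (\<chi> i. g i y)" for y
  have \<phi>: "\<phi> y = ln (G y)" for y by (simp add: \<phi>_def g_def ln_def vec_lambda_eta)
  have "eventually (\<lambda>y. \<forall>i. reg X y (g i)) (nz X x)"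
    using reg_eventually[OF regg] by (simp add: eventually_all_finite)
  moreover have nz: "eventually (\<lambda>y. g i0 y \<noteq> 0) (nz X x)" by (rule reg_nonzero[OF regg x i0])
  ultimately have mor: "eventually (\<lambda>y. mor X y \<phi>) (nz X x)"
    using eventually_nz_self unfolding \<phi>_def by eventually_elim (blast intro: mor_abs_proj)
  have "eventually (\<lambda>y. inj (fst (fst y)) \<longrightarrow> \<phi> y = pascal_line s (fst (fst y))) (nz X x)"
    using F nz eventually_base[OF affine_near] eventually_base[OF eventually_nz_self]
  proof eventually_elim
    case (elim y)
    show ?case
    proof
      assume inj: "inj (fst (fst y))"
      define u where "u = fst (fst y)"
      have u: "u \<in> sextuples K" "affine_at N u" using elim h_sextuples by (auto simp: u_def)
      define p where "p a = param N (u a)" for a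
      have up: "u a = pt (vand (p a))" for a
        unfolding p_def using u by (intro pt_vand_param) (auto simp: sextuples_def affine_at_def)
      have "inj p" using inj unfolding u_def[symmetric]
        by (intro injI) (metis up injD)
      note pl = pascal_line_eq[OF s ijk dist this up]
      have eq: "axis3 (p (xs i)) (p (xs j)) (p (xs k)) (p (ys i)) (p (ys j)) (p (ys k)) = t y *s G y"
        using elim(1) by (simp add: p_def u_def pascal_axis_def coord_def)
      have G0: "G y \<noteq> 0" using elim(2) by (auto simp: g_def)
      \<comment> \<open>The axis of an injective sextuple is nonzero, so dividing by
        \<open>t\<close> does not change the line.\<close>
      have "t y \<noteq> 0" using pl(2) unfolding eq by auto
      then have "ln (t y *s G y) = ln (G y)" using G0 by (rule ln_scale)
      then show "\<phi> y = pascal_line s (fst (fst y))" using pl(1) unfolding eq \<phi> u_def by simp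
    qed
  qed
  with mor have "eventually (\<lambda>y. mor X y \<phi> \<and> (inj (fst (fst y)) \<longrightarrow> \<phi> y = pascal_line s (fst (fst y)))) (nz X x)"
    by eventually_elim simp
  then show ?thesis unfolding extends_def by blast
qed

lemma extends_pairs:
  assumes s: "s = array_class xs ys" and ijk: "i \<noteq> j" "i \<noteq> k" "j \<noteq> k"
    and dist: "distinct [xs i, xs j, xs k, ys i, ys j, ys k]" and e: "h (xs i) = h (xs j)" "h (ys i) = h (ys j)"
  shows "extends s"
proof -
  have d: "distinct [xs i, xs j, ys i, ys j, xs k, ys k]" using dist by auto
  note pr = principal_pairs[OF d e]
  define P where "P y = axis_rows (coord (ys i) y, 1, 0, 0) (coord (xs j) y * coord (ys j) y, coord (xs j) y, coord (ys j) y, 1)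
    (coord (xs k) y * coord (ys k) y, coord (xs k) y, coord (ys k) y, 1)" for y
  define Q where "Q y = axis_rows (coord (xs j) y, 0, 1, 0) (coord (xs j) y * coord (ys j) y, coord (xs j) y, coord (ys j) y, 1)
    (coord (xs k) y * coord (ys k) y, coord (xs k) y, coord (ys k) y, 1)" for y
  show ?thesis
  proof (rule extends_of_factor[OF s ijk dist], rule factor_two[OF pr, where P = P and Q = Q])
    show "reg X x (\<lambda>y. P y $ i)" "reg X x (\<lambda>y. Q y $ i)" for i
      unfolding P_def Q_def by (intro reg_axis_rows reg_mult reg_const reg_coord)+
    show "eventually (\<lambda>y. pascal_axis xs ys i j k y =
      gap N (xs i, xs j) (fst (fst y)) *s P y + gap N (ys i, ys j) (fst (fst y)) *s Q y) (nz X x)"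
      by (rule always_eventually, unfold pascal_axis_def, subst axis3_pairs) (simp add: P_def Q_def gap_def coord_def)
    \<comment> \<open>Any of these equalities would create four equal letters, or a triple beside a
      disjoint pair.\<close>
    have ne: "coord (xs i) x \<noteq> coord (ys i) x" "coord (xs k) x \<noteq> coord (xs i) x" "coord (ys k) x \<noteq> coord (ys i) x"
      using sextuples0_D(2)[OF h, of "xs i" "xs j" "ys i" "ys j" "xs k" "ys k"]
        sextuples0_D(1)[OF h, of "xs i" "xs j" "xs k" "ys i" "ys j" "ys k"]
        sextuples0_D(1)[OF h, of "ys i" "ys j" "ys k" "xs i" "xs j" "xs k"] e dist unfolding coord_x_eq_iff by auto
    have pe: "coord (xs j) x = coord (xs i) x" "coord (ys j) x = coord (ys i) x" using e unfolding coord_x_eq_iff by simp_all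
    show "c = 0 \<and> d = 0" if "c *s P x + d *s Q x = 0" for c d
      by (rule pairs_independent[OF that[unfolded P_def Q_def pe] ne])
  qed
qed

lemma extends_triple:
  assumes s: "s = array_class xs ys" and ijk: "i \<noteq> j" "i \<noteq> k" "j \<noteq> k"
    and dist: "distinct [xs i, xs j, xs k, ys i, ys j, ys k]" and e: "h (xs i) = h (xs j)" "h (xs i) = h (xs k)"
  shows "extends s"
proof -
  note pr = principal_triple[OF dist e]
  define P where "P y = axis_rows (coord (xs i) y * coord (ys i) y, coord (xs i) y, coord (ys i) y, 1) (coord (ys j) y, 1, 0, 0)
    (coord (xs k) y * coord (ys k) y, coord (xs k) y, coord (ys k) y, 1)" for y
  define Q where "Q y = axis_rows (coord (xs i) y * coord (ys i) y, coord (xs i) y, coord (ys i) y, 1)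
    (coord (xs i) y * coord (ys j) y, coord (xs i) y, coord (ys j) y, 1) (coord (ys k) y, 1, 0, 0)" for y
  show ?thesis
  \<comment> \<open>The gaps are opposite in sign to the factors \<open>x1 - x0\<close> and
    \<open>x2 - x0\<close> of \<open>axis3_triple\<close>.\<close>
  proof (rule extends_of_factor[OF s ijk dist], rule factor_two[OF pr, where P = "\<lambda>y. - P y" and Q = "\<lambda>y. - Q y"])
    show "reg X x (\<lambda>y. (- P y) $ i)" "reg X x (\<lambda>y. (- Q y) $ i)" for i
      unfolding P_def Q_def vector_uminus_component
      by (intro reg_minus reg_axis_rows reg_mult reg_const reg_coord)+
    show "eventually (\<lambda>y. pascal_axis xs ys i j k y =
      gap N (xs i, xs j) (fst (fst y)) *s (- P y) + gap N (xs i, xs k) (fst (fst y)) *s (- Q y)) (nz X x)"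
      by (rule always_eventually, unfold pascal_axis_def, subst axis3_triple) (simp add: P_def Q_def gap_def coord_def)
    have ne: "coord (ys i) x \<noteq> coord (ys j) x" "coord (ys i) x \<noteq> coord (ys k) x" "coord (ys j) x \<noteq> coord (ys k) x"
       "coord (ys j) x \<noteq> coord (xs i) x" "coord (ys k) x \<noteq> coord (xs i) x"
      using sextuples0_D[OF h, of "xs i" "xs j" "xs k" "ys i" "ys j" "ys k"]
        sextuples0_D[OF h, of "xs i" "xs j" "xs k" "ys i" "ys k" "ys j"]
        sextuples0_D[OF h, of "xs i" "xs j" "xs k" "ys j" "ys k" "ys i"]
        sextuples0_D[OF h, of "xs i" "xs j" "xs k" "ys k" "ys j" "ys i"] e dist unfolding coord_x_eq_iff by auto
    have pe: "coord (xs j) x = coord (xs i) x" "coord (xs k) x = coord (xs i) x" using e unfolding coord_x_eq_iff by simp_all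
    show "c = 0 \<and> d = 0" if "c *s (- P x) + d *s (- Q x) = 0" for c d
    proof -
      have "(- c) *s P x + (- d) *s Q x = 0" using that by (simp add: vec_eq_iff)
      from triple_independent[OF this[unfolded P_def Q_def pe] ne] show ?thesis by simp
    qed
  qed
qed

text \<open>The gaps of the three columns generate the ideal of \<open>Z\<close> itself, so the
  factorization comes from the first blow-up.\<close>

lemma extends_matching:
  assumes s: "s = array_class xs ys" and ijk: "i \<noteq> j" "i \<noteq> k" "j \<noteq> k"
    and dist: "distinct [xs i, xs j, xs k, ys i, ys j, ys k]"
    and e: "h (xs i) = h (ys i)" "h (xs j) = h (ys j)" "h (xs k) = h (ys k)"
  shows "extends s"
proof -
  have d: "distinct [xs i, ys i, xs j, ys j, xs k, ys k]" using dist by auto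
  have "principal_at X' b {(xs i, ys i), (xs j, ys j), (xs k, ys k)} (\<lambda>k y. gap N k (fst y))"
    by (rule principal_at_blow_up[OF bu1 b generates_at_matching[OF d e]]) simp
  note pr = principal_at_fst[OF this x blow_up_fst[OF bu2]]
  define P where "P a c y = minor (coord (xs a) y) (coord (ys a) y) (coord (xs c) y) (coord (ys c) y)" for a c y
  show ?thesis
  proof (rule extends_of_factor[OF s ijk dist], rule factor_three[OF pr, where P = "P j k" and Q = "P k i" and R = "P i j"])
    show "reg X x (\<lambda>y. P j k y $ i)" "reg X x (\<lambda>y. P k i' y $ i)" "reg X x (\<lambda>y. P i' j y $ i)" for i i'
      unfolding P_def by (intro reg_minor reg_coord)+
    show "eventually (\<lambda>y. pascal_axis xs ys i j k y =
      gap N (xs i, ys i) (fst (fst y)) *s P j k y + gap N (xs j, ys j) (fst (fst y)) *s P k i y +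
      gap N (xs k, ys k) (fst (fst y)) *s P i j y) (nz X x)"
      by (rule always_eventually, unfold pascal_axis_def, subst axis3_matching) (simp add: P_def gap_def coord_def)
    have ne: "coord (ys i) x \<noteq> coord (ys j) x" "coord (ys i) x \<noteq> coord (ys k) x" "coord (ys j) x \<noteq> coord (ys k) x"
      using sextuples0_D(2)[OF h, of "xs i" "ys i" "ys j" "xs j" "xs k" "ys k"]
        sextuples0_D(2)[OF h, of "xs i" "ys i" "ys k" "xs k" "xs j" "ys j"]
        sextuples0_D(2)[OF h, of "xs j" "ys j" "ys k" "xs k" "xs i" "ys i"] e dist unfolding coord_x_eq_iff by auto
    have pe: "coord (xs i) x = coord (ys i) x" "coord (xs j) x = coord (ys j) x" "coord (xs k) x = coord (ys k) x" using e unfolding coord_x_eq_iff by simp_all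
    show "c = 0 \<and> d = 0 \<and> e = 0" if "c *s P j k x + d *s P k i x + e *s P i j x = 0" for c d e
      by (rule matching_independent[OF that[unfolded P_def pe] ne])
  qed
qed

lemma extends_pascal:
  assumes "s \<in> pascal_symbols"
  shows "extends s"
proof -
  obtain xs ys where s: "s = array_class xs ys" and r: "range xs \<union> range ys = UNIV"
    using assms unfolding pascal_symbols_def by blast
  have s': "s = array_class ys xs" unfolding s array_class_def by blast
  \<comment> \<open>Six entries that exhaust six letters are distinct.\<close>
  have "set [xs 1, xs 2, xs 3, ys 1, ys 2, ys 3] = UNIV" using r by (auto simp: UNIV_3)
  then have "card (set [xs 1, xs 2, xs 3, ys 1, ys 2, ys 3]) = length [xs 1, xs 2, xs 3, ys 1, ys 2, ys 3]"
    by (simp only: card_letter) simp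
  then have d: "distinct [xs 1, xs 2, xs 3, ys 1, ys 2, ys 3]" by (rule card_distinct)
  have ne: "(1::3) \<noteq> 2" "(1::3) \<noteq> 3" "(2::3) \<noteq> 3" by simp_all
  let ?F = "pascal_axis xs ys 1 2 3"
  show ?thesis
  proof (cases "?F x = 0")
    case False
    have "reg X x (\<lambda>y. ?F y $ i)" for i
      unfolding pascal_axis_def axis3_def by (intro reg_axis_rows reg_mult reg_const reg_coord)
    moreover have "eventually (\<lambda>y. ?F y = 1 *s ?F y) (nz X x)" by simp
    ultimately show ?thesis
      using False by (intro extends_of_factor[OF s ne d] exI[of _ "\<lambda>_. 1"] exI[of _ ?F]) blast
  next
    case True
    note base_locus[OF d spread_coord True[unfolded pascal_axis_def], unfolded coord_x_eq_iff]
    then consider "h (xs 1) = h (ys 1)" "h (xs 2) = h (ys 2)" "h (xs 3) = h (ys 3)"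
      | "h (xs 1) = h (xs 2)" "h (ys 1) = h (ys 2)" | "h (xs 1) = h (xs 3)" "h (ys 1) = h (ys 3)"
      | "h (xs 2) = h (xs 3)" "h (ys 2) = h (ys 3)"
      | "h (xs 1) = h (xs 2)" "h (xs 1) = h (xs 3)" | "h (ys 1) = h (ys 2)" "h (ys 1) = h (ys 3)"
      by blast
    then show ?thesis
    proof cases
      case 1
      then show ?thesis by (rule extends_matching[OF s ne d])
    next
      case 2
      then show ?thesis by (rule extends_pairs[OF s ne d])
    next
      case 3
      have d: "distinct [xs 1, xs 3, xs 2, ys 1, ys 3, ys 2]" using d by auto
      show ?thesis using 3 by (intro extends_pairs[OF s _ _ _ d]) auto
    next
      case 4
      have d: "distinct [xs 2, xs 3, xs 1, ys 2, ys 3, ys 1]" using d by auto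
      show ?thesis using 4 by (intro extends_pairs[OF s _ _ _ d]) auto
    next
      case 5
      then show ?thesis by (rule extends_triple[OF s ne d])
    next
      case 6
      have d: "distinct [ys 1, ys 2, ys 3, xs 1, xs 2, xs 3]" using d by auto
      from 6 show ?thesis by (rule extends_triple[OF s' ne d])
    qed
  qed
qed

end

section \<open>Uniqueness and gluing of the local extensions\<close>

lemma affine_frame_exists:
  assumes "nonsingular_conic K" "h \<in> sextuples K"
  obtains N M where "conic_frame K N M" "affine_at N h"
proof -
  have "finite (range h)" "range h \<subseteq> K" using assms(2) by (auto simp: sextuples_def)
  from conic_frame_affine[OF assms(1) this] show ?thesis
    using that by (metis affine_at_def rangeI)
qed

lemma injective_sextuples_dense:
  assumes "nonsingular_conic K" "h \<in> sextuples0 K"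
  shows "\<exists>\<^sub>F u in nz (sextuples0 K) h. inj u"
proof -
  have h: "h \<in> sextuples K" using assms(2) by (simp add: sextuples0_def)
  obtain N M where "conic_frame K N M" "affine_at N h" using affine_frame_exists[OF assms(1) h] .
  then show ?thesis using h inj_sextuples0 by (intro conic_frame.injective_dense) auto
qed

text \<open>By separatedness a disagreement at \<open>x\<close> would persist near \<open>x\<close>,
  leaving no point of \<open>D\<close> there.\<close>

lemma extension_unique:
  fixes f g :: "'a::charted_space \<Rightarrow> 'n::finite proj"
  assumes "mor S x f" "mor S x g" "x \<in> S" "\<exists>\<^sub>F y in nz S x. D y"
    and "eventually (\<lambda>y. D y \<longrightarrow> f y = p y) (nz S x)" "eventually (\<lambda>y. D y \<longrightarrow> g y = p y) (nz S x)"
  shows "f x = g x"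
proof (rule ccontr)
  assume "f x \<noteq> g x"
  from mor_proj_separated[OF assms(1-3) this] assms(5,6) have "eventually (\<lambda>y. \<not> D y) (nz S x)"
    by eventually_elim auto
  with assms(4) show False by (simp add: frequently_def)
qed

theorem theorem3p3:
  fixes K :: "point set"
    and s :: "pascal_array set"
    and X' :: "(sextuple \<times> 'r::finite proj) set"
    and X :: "((sextuple \<times> 'r proj) \<times> 't::finite proj) set"
  assumes "nonsingular_conic K"
    and "s \<in> pascal_symbols"
    and "is_blow_up (sextuples0 K) (center_Z K) X'"
    and "is_blow_up X' (proper_transform (center_Z K) X' (center_Y K)) X"
  shows "\<exists>q :: (sextuple \<times> 'r proj) \<times> 't proj \<Rightarrow> line. regular_morphism X UNIV q \<and>
    (\<forall>h' \<in> X. \<forall>l. pascal_map_value K s (fst (fst h')) l \<longrightarrow> q h' = l)"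
proof -
  note XX' = blow_up_fst[OF assms(4)] and X'H = blow_up_fst[OF assms(3)]
  define \<beta> where "\<beta> y = fst (fst y)" for y :: "(sextuple \<times> 'r proj) \<times> 't proj"
  have dense0: "\<exists>\<^sub>F u in nz (sextuples0 K) h. inj u" if "h \<in> sextuples0 K" for h
    using injective_sextuples_dense[OF assms(1) that] .
  have dense1: "\<exists>\<^sub>F u in nz X' b. inj (fst u)" if "b \<in> X'" for b
    by (rule blow_up_dense[OF assms(3) _ that]) (rule dense0)
  have dense: "\<exists>\<^sub>F u in nz X y. inj (\<beta> u)" if "y \<in> X" for y
    unfolding \<beta>_def by (rule blow_up_dense[OF assms(4) _ that]) (rule dense1)
  \<comment> \<open>Germs of extensions at \<open>y\<close>. By density they all have the same value
    at \<open>y\<close>, which defines \<open>q\<close> pointwise.\<close>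
  define ext where "ext \<phi> y \<longleftrightarrow> mor X y \<phi> \<and> eventually (\<lambda>u. inj (\<beta> u) \<longrightarrow> \<phi> u = pascal_line s (\<beta> u)) (nz X y)"
    for \<phi> y
  have unique: "\<phi> y = \<psi> y" if "ext \<phi> y" "ext \<psi> y" "y \<in> X" for \<phi> \<psi> y
    using that dense[OF that(3)] unfolding ext_def
    by (intro extension_unique[where D = "\<lambda>u. inj (\<beta> u)" and p = "\<lambda>u. pascal_line s (\<beta> u)"]) auto
  have exists: "\<exists>\<phi>. eventually (ext \<phi>) (nz X y)" if y: "y \<in> X" for y
  proof -
    have "\<beta> y \<in> sextuples K" using XX' X'H y by (auto simp: \<beta>_def sextuples0_def)
    then obtain N M where NM: "conic_frame K N M" "affine_at N (\<beta> y)" using affine_frame_exists[OF assms(1)] by blast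
    have res: "resolution K N M X' X y"
      by (intro resolution.intro resolution_axioms.intro NM(1) assms(3,4) dense0 y NM(2)[unfolded \<beta>_def])
    from resolution.extends_pascal[OF res assms(2)]
    obtain \<phi> where \<phi>: "eventually (\<lambda>y. mor X y \<phi> \<and> (inj (\<beta> y) \<longrightarrow> \<phi> y = pascal_line s (\<beta> y))) (nz X y)"
      unfolding \<beta>_def resolution.extends_def[OF res] by blast
    \<comment> \<open>The extension found near \<open>y\<close> is one at every nearby point as
      well, so \<open>q\<close> agrees with a single morphism there.\<close>
    have "eventually (ext \<phi>) (nz X y)" using eventually_nz_iterate[OF \<phi>] \<phi>
      unfolding ext_def by eventually_elim (auto elim!: eventually_mono)
    then show ?thesis by blast
  qed
  define q where "q y = (SOME l. \<exists>\<phi>. ext \<phi> y \<and> \<phi> y = l)" for y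
  have q: "q y = \<phi> y" if "ext \<phi> y" "y \<in> X" for \<phi> y
  proof -
    have "\<exists>l. \<exists>\<phi>. ext \<phi> y \<and> \<phi> y = l" using that by blast
    from someI_ex[OF this] obtain \<psi> where "ext \<psi> y" "\<psi> y = q y" unfolding q_def by blast
    with unique[OF _ that(1) that(2)] show ?thesis by metis
  qed
  show ?thesis
  proof (intro exI[of _ q] conjI ballI allI impI)
    show "regular_morphism X UNIV q"
    proof (rule regular_morphism_I)
      fix y assume y: "y \<in> X"
      obtain \<phi> where \<phi>: "eventually (ext \<phi>) (nz X y)" using exists[OF y] by blast
      have "mor X y \<phi>" using eventually_nz_at[OF \<phi> y] by (simp add: ext_def)
      moreover from \<phi> eventually_nz_self have "eventually (\<lambda>u. q u = \<phi> u) (nz X y)"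
        by eventually_elim (rule q)
      ultimately show "mor X y q" using y by (rule mor_eq_cong)
    qed
  next
    \<comment> \<open>A local representative \<open>\<phi>\<close> of the rational map at
      \<open>\<beta> y\<close>, composed with \<open>\<beta>\<close>, is an extension at
      \<open>y\<close>; uniqueness identifies its value \<open>l\<close> with
      \<open>q y\<close>.\<close>
    fix y l assume y: "y \<in> X" and "pascal_map_value K s (fst (fst y)) l"
    then obtain U \<phi> where U: "openin (zariski_on (sextuples0 K)) U" "\<beta> y \<in> U"
      and \<phi>: "regular_morphism U UNIV \<phi>" "\<forall>u \<in> U \<inter> {h \<in> sextuples0 K. inj h}. \<phi> u = pascal_line s u" "\<phi> (\<beta> y) = l"
      unfolding pascal_map_value_def rational_map_value_def \<beta>_def by blast
    have UH: "U \<subseteq> sextuples0 K" using U(1) by (rule openin_zariski_on_subset)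
    have ev: "eventually (\<lambda>u. u \<in> U) (nz (sextuples0 K) (fst (fst y)))"
      using U unfolding openin_zariski_on_iff \<beta>_def by blast
    have "fst y \<in> X'" using XX' y by auto
    from eventually_fst[OF eventually_fst[OF ev this X'H] y XX']
    have evU: "eventually (\<lambda>u. \<beta> u \<in> U) (nz X y)" unfolding \<beta>_def .
    have "mor X y \<beta>" unfolding \<beta>_def by (rule mor_fst[OF mor_fst[OF mor_id y] y])
    then have "mor X y (\<lambda>u. \<phi> (\<beta> u))"
      using y regular_morphism_mor[OF \<phi>(1) U(2)] evU by (rule mor_compose)
    moreover have "eventually (\<lambda>u. inj (\<beta> u) \<longrightarrow> \<phi> (\<beta> u) = pascal_line s (\<beta> u)) (nz X y)"
      using evU by eventually_elim (use \<phi>(2) UH in auto)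
    ultimately have "ext (\<lambda>u. \<phi> (\<beta> u)) y" unfolding ext_def by blast
    from q[OF this y] \<phi>(3) show "q y = l" by simp
  qed
qed

end
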